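(* Let $d\ge 1$ and consider the nearest-neighbor random-cluster model on $\mathbb{Z}^d$ with cluster weight $q=2$ and free boundary conditions. Let $\tilde p_c=\tilde p_c(2)$ be the critical parameter defined in the context. \begin{enumerate} \item For every $p\in[0,1]$ with $p>\tilde p_c$, $$\mu_{\mathbb{Z}^d,p,2}(0\leftrightarrow\infty)\ \ge\ \frac{p-\tilde p_c}{p}.$$ \item For every $p\in[0,1]$ with $p<\tilde p_c$, there exists $c=c(p)>0$ such that for every $x\in\mathbb{Z}^d$, $$\mu_{\mathbb{Z}^d,p,2}(0\leftrightarrow x)\ \le\ \exp(-c|x|).$$ \end{enumerate}
   Context: Fix a norm $|\cdot|$ on $\mathbb{Z}^d$ (the restriction of a norm on $\mathbb{R}^d$), and regard $\mathbb{Z}^d$ as a graph with nearest-neighbor edges. Random-cluster measure. For a finite subgraph $\Lambda=(V,E)$ of $\mathbb{Z}^d$, a percolation configuration is an element $\omega=(\omega_e)_{e\in E}\in\{0,1\}^E$, identified with the subgraph of $\Lambda$ with vertex set $V$ and edge set $\{e\in E:\omega_e=1\}$. An edge $e$ is open if $\omega_e=1$ and closed otherwise. Let $k(\omega)$ be the number of connected components of $\omega$ (isolated vertices included), $o(\omega)$ the number of open edges and $f(\omega)$ the number of closed edges. For $p\in[0,1]$ and $q>0$, the random-cluster measure on $\Lambda$ with free boundary conditions is the probability measure $$\mu_{\Lambda,p,q}(\omega)=\frac{q^{k(\omega)}}{Z}\,p^{o(\omega)}(1-p)^{f(\omega)},$$ where $Z$ is the normalizing constant. A finite set $S\subset\mathbb{Z}^d$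 is identified with the subgraph whose vertex set is $S$ and whose edges are all nearest-neighbor edges with both endpoints in $S$. For $q\ge1$, $\mu_{\mathbb{Z}^d,p,q}$ is the weak limit of the finite-volume free measures as the volume increases to $\mathbb{Z}^d$. Connectivity. $x\leftrightarrow y$ is the event that $x$ and $y$ are joined by a finite path of open edges. $0\leftrightarrow\infty$ is the event that for every $n\in\mathbb{N}$ there is $x\in\mathbb{Z}^d$ with $|x|\ge n$ and $0\leftrightarrow x$. Critical parameter $\tilde p_c$. For a finite $S\subset\mathbb{Z}^d$ containing $0$, let $\Delta S$ be the set of nearest-neighbor edges of $\mathbb{Z}^d$ with exactly one endpoint in $S$; for $\{x,y\}\in\Delta S$ we always write $x\in S$ and $y\notin S$. With $q=2$, define $$\varphi_p(S):=p\sum_{\{x,y\}\in\Delta S}\mu_{S,p,2}(0\leftrightarrow x),$$ $$\tilde p_c:=\sup\{p\in[0,1]:\ \varphi_p(S)<1\ \text{for some finite } S\subset\mathbb{Z}^d \text{ containing } 0\}.$$ *)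

theory Defs
  imports "HOL-Probability.Probability"
begin

definition nearest :: "int ^ 'n \<Rightarrow> int ^ 'n \<Rightarrow> bool" where
  "nearest x y \<longleftrightarrow> (\<Sum>i\<in>UNIV. \<bar>x $ i - y $ i\<bar>) = 1"

text \<open>The nearest-neighbour edges of the lattice, as unordered pairs of vertices.\<close>

typedef ('n::finite) edge = "{{x, y} | x y :: int ^ 'n. nearest x y}"
  morphisms ends Abs_edge
proof -
  fix i :: 'n
  have "nearest 0 (axis i 1 :: int ^ 'n)"
    by (auto simp: nearest_def axis_def if_distrib[of abs] cong: if_cong)
  then show "\<exists>e. e \<in> {{x, y} | x y :: int ^ 'n. nearest x y}"
    by blast
qed

type_synonym 'n config = "'n edge \<Rightarrow> bool"

definition open_adj :: "('n::finite) config \<Rightarrow> int ^ 'n \<Rightarrow> int ^ 'n \<Rightarrow> bool" where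
  "open_adj \<omega> x y \<longleftrightarrow> (\<exists>e. ends e = {x, y} \<and> \<omega> e)"

definition connects :: "('n::finite) config \<Rightarrow> int ^ 'n \<Rightarrow> int ^ 'n \<Rightarrow> bool" where
  "connects \<omega> x y \<longleftrightarrow> (open_adj \<omega>)\<^sup>*\<^sup>* x y"

text \<open>
  A percolation configuration on a finite subgraph \<open>(V, E)\<close> is a function on \<open>E\<close>. It is represented
  by its extension that is closed outside \<open>E\<close>; its open paths are then automatically paths in the
  subgraph, and finite-volume measures for different subgraphs live on one type.
\<close>

definition configs :: "('n::finite) edge set \<Rightarrow> 'n config set" where
  "configs E = {\<omega>. \<forall>e. \<omega> e \<longrightarrow> e \<in> E}"

definition num_clusters :: "(int ^ 'n) set \<Rightarrow> ('n::finite) config \<Rightarrow> nat" where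
  "num_clusters V \<omega> = card (V // {(x, y). x \<in> V \<and> y \<in> V \<and> connects \<omega> x y})"

definition rc_weight ::
  "(int ^ 'n) set \<Rightarrow> ('n::finite) edge set \<Rightarrow> real \<Rightarrow> real \<Rightarrow> 'n config \<Rightarrow> real" where
  "rc_weight V E p q \<omega> =
     q ^ num_clusters V \<omega> * p ^ card {e \<in> E. \<omega> e} * (1 - p) ^ card {e \<in> E. \<not> \<omega> e}"

definition rc_partition :: "(int ^ 'n) set \<Rightarrow> ('n::finite) edge set \<Rightarrow> real \<Rightarrow> real \<Rightarrow> real" where
  "rc_partition V E p q = (\<Sum>\<omega>\<in>configs E. rc_weight V E p q \<omega>)"

definition rc_measure ::
  "(int ^ 'n) set \<Rightarrow> ('n::finite) edge set \<Rightarrow> real \<Rightarrow> real \<Rightarrow> 'n config measure" where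
  "rc_measure V E p q =
     point_measure (configs E) (\<lambda>\<omega>. ennreal (rc_weight V E p q \<omega> / rc_partition V E p q))"

lemma prob_space_rc_measure:
  assumes E: "finite E" and p: "0 \<le> p" "p \<le> 1" and q: "0 < q"
  shows "prob_space (rc_measure V E p q)"
proof -
  have "configs E \<subseteq> (\<lambda>A e. e \<in> A) ` Pow E"
  proof
    fix \<omega> assume "\<omega> \<in> configs E"
    then have "\<omega> = (\<lambda>e. e \<in> {e. \<omega> e})" "{e. \<omega> e} \<in> Pow E"
      by (auto simp: configs_def)
    then show "\<omega> \<in> (\<lambda>A e. e \<in> A) ` Pow E"
      by (rule image_eqI)
  qed
  then have fin: "finite (configs E)"
    using E by (meson finite_Pow_iff finite_imageI finite_subset)
  have nonneg: "0 \<le> rc_weight V E p q \<omega>" for \<omega>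
    using p q by (simp add: rc_weight_def)
  define \<omega>0 where "\<omega>0 = (\<lambda>e. p > 0 \<and> e \<in> E)"
  have "\<omega>0 \<in> configs E"
    by (simp add: \<omega>0_def configs_def)
  moreover have "0 < rc_weight V E p q \<omega>0"
    using p q by (cases "p = 0") (simp_all add: \<omega>0_def rc_weight_def)
  ultimately have pos: "0 < rc_partition V E p q"
    using fin nonneg unfolding rc_partition_def by (meson sum_pos2)
  have "(\<Sum>\<omega>\<in>configs E. ennreal (rc_weight V E p q \<omega> / rc_partition V E p q)) =
        ennreal (\<Sum>\<omega>\<in>configs E. rc_weight V E p q \<omega> / rc_partition V E p q)"
    using nonneg pos by (intro sum_ennreal) simp
  also have "\<dots> = 1"
    using pos by (simp flip: sum_divide_distrib rc_partition_def)
  finally show ?thesis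
    unfolding rc_measure_def using fin
    by (intro prob_spaceI) (simp add: space_point_measure emeasure_point_measure_finite)
qed

definition induced_edges :: "(int ^ 'n) set \<Rightarrow> ('n::finite) edge set" where
  "induced_edges S = {e. ends e \<subseteq> S}"

abbreviation rc_measure_on :: "(int ^ 'n) set \<Rightarrow> real \<Rightarrow> real \<Rightarrow> ('n::finite) config measure" where
  "rc_measure_on S \<equiv> rc_measure S (induced_edges S)"

text \<open>
  The weak limit is taken along the net of finite vertex sets directed by inclusion. Continuity refers
  to the product topology on configurations.
\<close>

definition is_rc_limit :: "real \<Rightarrow> real \<Rightarrow> ('n::finite) config measure \<Rightarrow> bool" where
  "is_rc_limit p q M \<longleftrightarrow>
     prob_space M \<and> sets M = sets (\<Pi>\<^sub>M e\<in>UNIV. count_space UNIV) \<and>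
     (\<forall>f :: 'n config \<Rightarrow> real. continuous_on UNIV f \<longrightarrow> bounded (range f) \<longrightarrow>
        ((\<lambda>S. \<integral>\<omega>. f \<omega> \<partial>rc_measure_on S p q) \<longlongrightarrow> (\<integral>\<omega>. f \<omega> \<partial>M))
          (finite_subsets_at_top UNIV))"

definition rc_lattice :: "real \<Rightarrow> real \<Rightarrow> ('n::finite) config measure" where
  "rc_lattice p q = (THE M. is_rc_limit p q M)"

definition is_norm :: "('a::real_vector \<Rightarrow> real) \<Rightarrow> bool" where
  "is_norm N \<longleftrightarrow>
     (\<forall>x. 0 \<le> N x) \<and> (\<forall>x. N x = 0 \<longleftrightarrow> x = 0) \<and>
     (\<forall>a x. N (a *\<^sub>R x) = \<bar>a\<bar> * N x) \<and> (\<forall>x y. N (x + y) \<le> N x + N y)"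

definition real_vec :: "int ^ 'n \<Rightarrow> real ^ 'n" where
  "real_vec x = (\<chi> i. of_int (x $ i))"

definition connects_infinity :: "(real ^ 'n \<Rightarrow> real) \<Rightarrow> ('n::finite) config \<Rightarrow> bool" where
  "connects_infinity N \<omega> \<longleftrightarrow> (\<forall>n::nat. \<exists>x. N (real_vec x) \<ge> real n \<and> connects \<omega> 0 x)"

text \<open>
  Each edge with exactly one endpoint in \<open>S\<close> is listed once, as the ordered pair whose first
  component is the endpoint in \<open>S\<close>.
\<close>

definition edge_boundary :: "(int ^ 'n) set \<Rightarrow> ((int ^ 'n) \<times> (int ^ ('n::finite))) set" where
  "edge_boundary S = {(x, y). x \<in> S \<and> y \<notin> S \<and> nearest x y}"

definition rc_phi :: "real \<Rightarrow> real \<Rightarrow> (int ^ ('n::finite)) set \<Rightarrow> real" where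
  "rc_phi q p S =
     p * (\<Sum>(x, y)\<in>edge_boundary S.
            \<P>(\<omega> in rc_measure_on S p q. connects \<omega> 0 x))"

definition pc_tilde :: "('n::finite) itself \<Rightarrow> real \<Rightarrow> real" where
  "pc_tilde _ q =
     Sup {p \<in> {0..1}. \<exists>S :: (int ^ 'n) set. finite S \<and> 0 \<in> S \<and> rc_phi q p S < 1}"

end

theory Submission
  imports Defs
begin

text \<open>
  Everything is proved for finite graphs, uniformly in the graph, and then carried to the limit. Write
  \<open>r = p / (2 - p)\<close>, and let \<open>two_point p E x y\<close> be the probability that \<open>x\<close> and \<open>y\<close> are joined under the
  free measure with cluster weight 2 on a finite edge set \<open>E\<close>.

  The cluster weight 2 enters through one identity. If an edge between \<open>x\<close> and \<open>u\<close> is added to \<open>E\<close>, then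
  an open copy of it is worth \<open>p\<close> where \<open>x\<close> and \<open>u\<close> were joined and \<open>p / 2\<close> where they were not, and
  this makes the new two-point function of \<open>x\<close> a multiple of
  \<open>two_point p E x y + r * two_point p E u y\<close> (lemma \<open>two_point_insert_edge\<close>). Removing the edges at \<open>x\<close>
  one at a time, this identity and the monotonicity of two-point functions in the graph give the
  Simon--Lieb inequality (\<open>simon_lieb\<close>): for \<open>x \<in> S\<close> and \<open>y \<notin> S\<close>,
  \<open>two_point p E x y\<close> is at most \<open>r\<close> times the sum over the boundary edges \<open>(a, b)\<close> of \<open>S\<close> of
  \<open>two_point p (induced_edges S) x a * two_point p E b y\<close>. Iterated over translates of \<open>S\<close>, it shows that
  the two-point function decays exponentially as soon as the boundary sum of some \<open>S\<close> is less than
  \<open>1 / r\<close> (\<open>exponential_decay\<close>). Below the critical parameter such an \<open>S\<close> exists, because \<open>r \<le> p\<close> and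
  because two-point functions increase with \<open>p\<close>; this is the second claim.

  Above the critical parameter no such \<open>S\<close> exists: exponential decay would make \<open>\<phi>\<^sub>p\<close> of a large ball
  less than 1. So every finite \<open>S\<close> containing the origin has boundary sum at least \<open>1 / r\<close>, which is
  more than the bound \<open>1 / p\<close> that the definition of the critical parameter suggests, and exactly what
  the next step needs. Let \<open>\<theta>(p)\<close> be the probability that the origin is joined to the outer boundary of
  a finite set \<open>D\<close>. The derivative of \<open>\<theta>\<close> is a sum of covariances divided by \<open>p (1 - p)\<close>, and positive
  association bounds each covariance below by \<open>r\<close> times the probability that the edge is closed and
  pivotal (\<open>derivative_ge_pivotal\<close>). If the origin does not reach the outer boundary, let \<open>S\<close> be the set
  of vertices of \<open>D\<close> that do not reach it. The edges around \<open>S\<close> are closed, the edge at \<open>(a, b)\<close> is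
  pivotal if the origin is joined to \<open>a\<close>, and given \<open>S\<close> the configuration inside it has the free law.
  Hence the expected number of pivotal edges is at least \<open>(1 - \<theta>) / r\<close> (\<open>expected_pivotal_ge\<close>), so
  \<open>\<theta>' \<ge> (1 - \<theta>) / (p (1 - p)) \<ge> (1 - \<theta>) / p\<close>. This says that \<open>p (1 - \<theta>(p))\<close> is nonincreasing above the
  critical parameter, and the first claim follows by integration (\<open>exit_probability_ge\<close>).

  Positive association and monotonicity in the volume and in \<open>p\<close> are all instances of
  \<open>fk_positive_association\<close>, a consequence of the four functions theorem and of the submodularity of
  the rank. Monotonicity in the volume also makes the finite-volume measures converge on every event
  that depends on finitely many edges, and Kolmogorov's theorem turns the limits into a measure
  (\<open>is_rc_limit_rc_lattice\<close>). Connection events are monotone limits of events that depend on finitely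
  many edges, so the bounds pass to the lattice.
\<close>

section \<open>Edges and connections\<close>

lemma nearest_sym: "nearest x y \<longleftrightarrow> nearest y x"
  by (simp add: nearest_def abs_minus_commute)

lemma nearest_neq: "nearest x y \<Longrightarrow> x \<noteq> y"
  by (auto simp: nearest_def)

lemma edge_cases:
  obtains x y where "ends e = {x, y}" "nearest x y" "x \<noteq> y"
  using ends[of e] nearest_neq by blast

lemma edge_ends_neq: "ends e = {x, y} \<Longrightarrow> x \<noteq> y"
  by (metis edge_cases doubleton_eq_iff insert_absorb2)

lemma edge_ends_nearest: "ends e = {x, y} \<Longrightarrow> nearest x y"
  by (metis edge_cases doubleton_eq_iff nearest_sym)

lemma edge_at_cases:
  assumes "x \<in> ends e"
  obtains u where "ends e = {x, u}" "nearest x u"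
proof -
  obtain a b where ab: "ends e = {a, b}" "nearest a b"
    using edge_cases by blast
  show ?thesis
  proof (cases "x = a")
    case True
    then show ?thesis using ab that[of b] by simp
  next
    case False
    then have "x = b" using ab assms by simp
    then show ?thesis using ab that[of a] nearest_sym[of a b] by (simp add: insert_commute)
  qed
qed

lemma ex_edge: "nearest x y \<Longrightarrow> \<exists>e. ends e = {x, y}"
  using Abs_edge_inverse[of "{x, y}"] by blast

lemma finite_ends [simp]: "finite (ends e)"
  by (rule edge_cases[of e]) simp

lemma open_adj_sym: "open_adj \<omega> x y \<Longrightarrow> open_adj \<omega> y x"
  by (auto simp: open_adj_def insert_commute)

text \<open>
  Configurations in a finite volume are treated as sets of open edges; the Boolean functions come back
  only with the infinite-volume measure.
\<close>

definition joined :: "('n::finite) edge set \<Rightarrow> int ^ 'n \<Rightarrow> int ^ 'n \<Rightarrow> bool" where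
  "joined F = connects (\<lambda>e. e \<in> F)"

lemma joined_refl [simp]: "joined F x x"
  by (simp add: joined_def connects_def)

lemma joined_trans: "joined F x y \<Longrightarrow> joined F y z \<Longrightarrow> joined F x z"
  by (simp add: joined_def connects_def)

lemma joined_sym: "joined F x y \<Longrightarrow> joined F y x"
  unfolding joined_def connects_def
  by (rule sympD[OF symp_rtranclp]) (auto intro: sympI open_adj_sym)

lemma joined_step:
  assumes "joined F x y" "e \<in> F" "ends e = {y, z}"
  shows "joined F x z"
proof -
  have "open_adj (\<lambda>e. e \<in> F) y z"
    using assms by (auto simp: open_adj_def)
  then show ?thesis
    using assms(1) by (simp add: joined_def connects_def)
qed

lemma connects_mono:
  assumes "connects \<omega> x y" "\<And>e. \<omega> e \<Longrightarrow> \<omega>' e"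
  shows "connects \<omega>' x y"
proof -
  have "open_adj \<omega> \<le> open_adj \<omega>'"
    using assms(2) unfolding open_adj_def le_fun_def le_bool_def by blast
  then show ?thesis
    using assms(1) rtranclp_mono unfolding connects_def by blast
qed

lemma joined_mono: "joined F x y \<Longrightarrow> F \<subseteq> G \<Longrightarrow> joined G x y"
  unfolding joined_def by (erule connects_mono) auto

lemma joined_induct [consumes 1, case_names refl step]:
  assumes "joined F x y" and "P x"
    and "\<And>e y z. joined F x y \<Longrightarrow> P y \<Longrightarrow> e \<in> F \<Longrightarrow> ends e = {y, z} \<Longrightarrow> P z"
  shows "P y"
  using assms(1) unfolding joined_def connects_def
  by (induction rule: rtranclp_induct)
    (use assms(2,3) in \<open>auto simp: open_adj_def joined_def connects_def\<close>)

lemma joined_empty: "joined {} x y \<longleftrightarrow> x = y"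
proof
  assume "joined {} x y"
  then show "x = y"
    by (induction rule: joined_induct) auto
qed simp

text \<open>
  A path that uses the new edge can be cut at its first and last visits to \<open>{u, v}\<close>, so it uses the
  edge at most once.
\<close>

lemma joined_insert:
  assumes e: "ends e = {u, v}"
  shows "joined (insert e F) x y \<longleftrightarrow>
    joined F x y \<or> joined F x u \<and> joined F v y \<or> joined F x v \<and> joined F u y"
    (is "?L \<longleftrightarrow> ?R y")
proof
  assume ?L
  then show "?R y"
  proof (induction rule: joined_induct)
    case (step e' y z)
    show ?case
    proof (cases "e' = e")
      case True
      with step e have "y = u \<and> z = v \<or> y = v \<and> z = u"
        by (metis doubleton_eq_iff)
      with step show ?thesis
        using joined_refl[of F u] joined_refl[of F v] by blast
    next
      case False
      with step have "joined F w y \<Longrightarrow> joined F w z" for w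
        by (auto intro: joined_step)
      with step show ?thesis
        by blast
    qed
  qed simp
next
  assume "?R y"
  moreover have "joined (insert e F) u v" "joined (insert e F) v u"
    using e joined_step[of "insert e F" u u e v] joined_step[of "insert e F" v v e u]
    by (auto simp: insert_commute)
  moreover have "joined (insert e F) a b" if "joined F a b" for a b
    using that by (rule joined_mono) auto
  ultimately show ?L
    by (meson joined_trans)
qed

section \<open>Clusters and the rank of an edge set\<close>

definition num_components :: "(int ^ 'n) set \<Rightarrow> ('n::finite) edge set \<Rightarrow> nat" where
  "num_components V F = num_clusters V (\<lambda>e. e \<in> F)"

lemma num_components_image:
  "num_components V F = card ((\<lambda>x. {y \<in> V. joined F x y}) ` V)"
proof -
  have "V // {(x, y). x \<in> V \<and> y \<in> V \<and> joined F x y} = (\<lambda>x. {y \<in> V. joined F x y}) ` V"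
    by (auto simp: quotient_def Image_def)
  then show ?thesis
    by (simp add: num_components_def num_clusters_def joined_def)
qed

text \<open>
  If \<open>u\<close> and \<open>v\<close> lie in different clusters, the new edge merges these two into \<open>W\<close> and leaves all other
  clusters as they were.
\<close>

lemma num_components_insert:
  assumes V: "finite V" and e: "ends e = {u, v}" "u \<in> V" "v \<in> V"
  shows "num_components V (insert e F) + (if joined F u v then 0 else 1)
       = num_components V F"
proof (cases "joined F u v")
  case True
  then have "joined (insert e F) x y \<longleftrightarrow> joined F x y" for x y
    using joined_insert[OF e(1), of F x y] by (meson joined_sym joined_trans)
  with True show ?thesis
    by (simp add: num_components_image)
next
  case False
  define C where "C = (\<lambda>x. {y \<in> V. joined F x y})"
  define C' where "C' = (\<lambda>x. {y \<in> V. joined (insert e F) x y})"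
  define W where "W = C u \<union> C v"
  have W: "W \<subseteq> V" "u \<in> W"
    using e by (auto simp: W_def C_def)
  have C_eq: "C x = C y \<longleftrightarrow> joined F x y" if "x \<in> V" "y \<in> V" for x y
  proof
    assume "C x = C y"
    then have "y \<in> C x"
      using that by (simp add: C_def)
    then show "joined F x y"
      by (simp add: C_def)
  next
    assume "joined F x y"
    then have "joined F x z \<longleftrightarrow> joined F y z" for z
      using joined_sym joined_trans by metis
    then show "C x = C y"
      by (simp add: C_def)
  qed
  have C'1: "C' x = W" if "x \<in> W" for x
  proof -
    have "joined F u x \<or> joined F v x"
      using that by (auto simp: W_def C_def)
    then have "joined (insert e F) x y \<longleftrightarrow> joined F u y \<or> joined F v y" for y
      unfolding joined_insert[OF e(1)] by (metis joined_sym joined_trans)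
    then show ?thesis
      by (auto simp: C'_def W_def C_def)
  qed
  have C'2: "C' x = C x" if "x \<in> V - W" for x
  proof -
    have "\<not> joined F x u" "\<not> joined F x v"
      using that unfolding W_def C_def by (auto dest: joined_sym)
    then show ?thesis
      unfolding C'_def C_def joined_insert[OF e(1)] by simp
  qed
  have CW: "C ` W = {C u, C v}"
  proof
    show "C ` W \<subseteq> {C u, C v}"
    proof
      fix D assume "D \<in> C ` W"
      then obtain x where x: "D = C x" "x \<in> V" "joined F u x \<or> joined F v x"
        using W by (auto simp: W_def C_def)
      then show "D \<in> {C u, C v}"
        using C_eq[of u x] C_eq[of v x] e by auto
    qed
    show "{C u, C v} \<subseteq> C ` W"
      using e by (auto simp: W_def C_def)
  qed
  have "C' ` V = C' ` W \<union> C' ` (V - W)"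
    using W by auto
  also have "C' ` W = {W}"
    using C'1 W by auto
  also have "C' ` (V - W) = C ` (V - W)"
    using C'2 by auto
  finally have 1: "C' ` V = insert W (C ` (V - W))"
    by simp
  have outside: "\<not> D \<subseteq> W" if "D \<in> C ` (V - W)" for D
    using that by (auto simp: C_def)
  then have "W \<notin> C ` (V - W)"
    by blast
  then have card1: "card (C' ` V) = card (C ` (V - W)) + 1"
    using V 1 by simp
  have 2: "C ` V = {C u, C v} \<union> C ` (V - W)"
    using W CW by (metis Diff_partition image_Un)
  have "{C u, C v} \<inter> C ` (V - W) = {}"
    using outside unfolding W_def by blast
  moreover have "C u \<noteq> C v"
    using C_eq e False by simp
  ultimately have "card (C ` V) = card (C ` (V - W)) + 2"
    using V unfolding 2 by (subst card_Un_disjoint) auto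
  with card1 False show ?thesis
    by (simp add: num_components_image C_def C'_def)
qed

lemma num_components_empty: "finite V \<Longrightarrow> num_components V {} = card V"
proof -
  have "(\<lambda>x. {y \<in> V. joined {} x y}) ` V = (\<lambda>x. {x}) ` V"
    by (rule image_cong) (auto simp: joined_empty)
  then show ?thesis
    unfolding num_components_image by (simp add: card_image)
qed

text \<open>
  The number of edges of a spanning forest of \<open>F\<close>. The number of clusters on a vertex set \<open>V\<close> is
  \<open>card V - rank F\<close>, so \<open>(1 / q) ^ rank F\<close> is the cluster weight up to a constant. In contrast to the
  number of clusters, the rank does not depend on \<open>V\<close>; this allows measures on different volumes to be
  compared.
\<close>

definition rank :: "('n::finite) edge set \<Rightarrow> nat" where
  "rank F = card (\<Union>(ends ` F)) - num_components (\<Union>(ends ` F)) F"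

lemma num_components_diff_indep:
  assumes "finite F" "finite V" "finite W" "\<Union>(ends ` F) \<subseteq> V" "\<Union>(ends ` F) \<subseteq> W"
  shows "num_components V F \<le> card V"
    and "card V - num_components V F = card W - num_components W F"
proof -
  have "num_components V F \<le> card V \<and> num_components W F \<le> card W \<and>
    card V - num_components V F = card W - num_components W F"
    using assms
  proof (induction F)
    case empty
    then show ?case
      using num_components_empty by fastforce
  next
    case (insert e F)
    obtain u v where "ends e = {u, v}"
      using edge_cases by blast
    then show ?case
      using insert num_components_insert[of V e u v F] num_components_insert[of W e u v F]
      by (auto split: if_splits)
  qed
  then show "num_components V F \<le> card V"
    and "card V - num_components V F = card W - num_components W F"
    by auto
qed

lemma num_components_plus_rank:
  assumes "finite F" "finite V" "\<Union>(ends ` F) \<subseteq> V"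
  shows "num_components V F + rank F = card V"
proof -
  have "finite (\<Union>(ends ` F))"
    using assms by auto
  then show ?thesis
    using num_components_diff_indep[of F V "\<Union>(ends ` F)"] assms by (simp add: rank_def)
qed

lemma rank_empty [simp]: "rank {} = 0"
  by (simp add: rank_def)

lemma rank_insert:
  assumes "finite F" "ends e = {u, v}"
  shows "rank (insert e F) = rank F + (if joined F u v then 0 else 1)"
proof -
  define V where "V = \<Union>(ends ` insert e F)"
  have "finite V" "\<Union>(ends ` F) \<subseteq> V" "u \<in> V" "v \<in> V"
    using assms by (auto simp: V_def)
  then show ?thesis
    using num_components_insert[of V e u v F] assms num_components_plus_rank[of F V]
      num_components_plus_rank[of "insert e F" V]
    by (simp add: V_def split: if_splits)
qed

text \<open>
  The larger set already joins the endpoints of \<open>e\<close> whenever the smaller one does.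
\<close>

lemma rank_insert_diminishing:
  assumes "finite G" "F \<subseteq> G"
  shows "rank (insert e G) + rank F \<le> rank (insert e F) + rank G"
proof -
  obtain u v where uv: "ends e = {u, v}"
    using edge_cases by blast
  have "finite F"
    using assms finite_subset by blast
  then show ?thesis
    using rank_insert[OF _ uv] assms joined_mono[of F u v G] by auto
qed

text \<open>
  The edges of \<open>G - F\<close> are added one at a time, to \<open>F \<inter> G\<close> on one side and to \<open>F\<close> on the other. This is
  the source of positive association for \<open>q \<ge> 1\<close>.
\<close>

lemma rank_submodular:
  assumes "finite F" "finite G"
  shows "rank (F \<union> G) + rank (F \<inter> G) \<le> rank F + rank G"
proof -
  have "rank (F \<union> H) + rank (F \<inter> G) \<le> rank F + rank (F \<inter> G \<union> H)" if "finite H" "H \<subseteq> G" for H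
    using that
  proof (induction H)
    case (insert e H)
    have "rank (insert e (F \<union> H)) + rank (F \<inter> G \<union> H) \<le> rank (insert e (F \<inter> G \<union> H)) + rank (F \<union> H)"
      using insert assms by (intro rank_insert_diminishing) auto
    with insert show ?case by simp
  qed simp
  from this[OF assms(2)] show ?thesis
    by (simp add: Un_commute Int_commute Un_absorb1 sup.absorb2)
qed

section \<open>The four functions theorem\<close>

lemma sum_Pow_insert:
  fixes f :: "'a set \<Rightarrow> 'b::comm_monoid_add"
  assumes "finite E" "e \<notin> E"
  shows "(\<Sum>A\<in>Pow (insert e E). f A) = (\<Sum>A\<in>Pow E. f A + f (insert e A))"
proof -
  have inj: "inj_on (insert e) (Pow E)"
    using assms(2) by (auto simp: inj_on_def)
  have "(\<Sum>A\<in>Pow (insert e E). f A) = (\<Sum>A\<in>Pow E. f A) + (\<Sum>A\<in>insert e ` Pow E. f A)"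
    unfolding Pow_insert using assms by (intro sum.union_disjoint) auto
  then show ?thesis
    by (simp add: sum.reindex[OF inj] sum.distrib)
qed

text \<open>
  The case of a single element. Only the products \<open>s\<close> and \<open>t\<close> of mixed type are not bounded term by term.
  Both are at most \<open>u\<close>, and \<open>s * t\<close> is at most \<open>u * (c False * d True)\<close>, so expanding
  \<open>(u - s) * (u - t) \<ge> 0\<close> bounds \<open>s + t\<close>.
\<close>

lemma four_functions_single:
  fixes a b c d :: "bool \<Rightarrow> real"
  assumes nonneg: "\<And>i. 0 \<le> a i" "\<And>i. 0 \<le> b i" "\<And>i. 0 \<le> c i" "\<And>i. 0 \<le> d i"
    and le: "\<And>i j. a i * b j \<le> c (i \<or> j) * d (i \<and> j)"
  shows "(a False + a True) * (b False + b True) \<le> (c False + c True) * (d False + d True)"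
proof -
  define u where "u = c True * d False"
  define s where "s = a False * b True"
  define t where "t = a True * b False"
  have st: "s \<le> u" "t \<le> u" "0 \<le> s" "0 \<le> t"
    using le[of False True] le[of True False] nonneg by (auto simp: u_def s_def t_def)
  have ff: "a False * b False \<le> c False * d False" and tt: "a True * b True \<le> c True * d True"
    using le[of False False] le[of True True] by auto
  have "s + t \<le> u + c False * d True"
  proof (cases "u = 0")
    case True
    then show ?thesis
      using st nonneg by (simp add: add_increasing)
  next
    case False
    with st have u: "0 < u" by linarith
    have "s * t = (a False * b False) * (a True * b True)"
      by (simp add: s_def t_def)
    also have "\<dots> \<le> (c False * d False) * (c True * d True)"
      using nonneg by (intro mult_mono[OF ff tt] mult_nonneg_nonneg) auto
    also have "\<dots> = u * (c False * d True)"
      by (simp add: u_def)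
    finally have "s * t \<le> u * (c False * d True)" .
    moreover have "0 \<le> (u - s) * (u - t)"
      using st by simp
    ultimately have "u * (s + t) \<le> u * (u + c False * d True)"
      by (simp add: algebra_simps)
    with u show ?thesis by simp
  qed
  with ff tt show ?thesis
    by (simp add: algebra_simps u_def s_def t_def)
qed

text \<open>
  The Ahlswede--Daykin theorem. Summing each function over the two states of one element preserves the
  hypothesis, by the case of a single element, so induction on \<open>E\<close> applies.
\<close>

theorem four_functions:
  fixes \<alpha> \<beta> \<gamma> \<delta> :: "'a set \<Rightarrow> real"
  assumes "finite E"
    and "\<And>A. A \<subseteq> E \<Longrightarrow> 0 \<le> \<alpha> A" "\<And>A. A \<subseteq> E \<Longrightarrow> 0 \<le> \<beta> A"
    and "\<And>A. A \<subseteq> E \<Longrightarrow> 0 \<le> \<gamma> A" "\<And>A. A \<subseteq> E \<Longrightarrow> 0 \<le> \<delta> A"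
    and "\<And>A B. A \<subseteq> E \<Longrightarrow> B \<subseteq> E \<Longrightarrow> \<alpha> A * \<beta> B \<le> \<gamma> (A \<union> B) * \<delta> (A \<inter> B)"
  shows "(\<Sum>A\<in>Pow E. \<alpha> A) * (\<Sum>A\<in>Pow E. \<beta> A) \<le> (\<Sum>A\<in>Pow E. \<gamma> A) * (\<Sum>A\<in>Pow E. \<delta> A)"
  using assms
proof (induction E arbitrary: \<alpha> \<beta> \<gamma> \<delta> rule: finite_induct)
  case empty
  then show ?case by simp
next
  case (insert e E)
  define \<sigma> where "\<sigma> = (\<lambda>i A. if i then Set.insert e A else A :: 'a set)"
  have \<sigma>: "\<sigma> i A \<union> \<sigma> j B = \<sigma> (i \<or> j) (A \<union> B)" "\<sigma> i A \<inter> \<sigma> j B = \<sigma> (i \<and> j) (A \<inter> B)"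
    if "A \<subseteq> E" "B \<subseteq> E" for i j A B
    using that insert.hyps by (auto simp: \<sigma>_def)
  have \<sigma>_sub: "\<sigma> i A \<subseteq> Set.insert e E" if "A \<subseteq> E" for i A
    using that by (auto simp: \<sigma>_def)
  note nonneg = insert.prems(1-4)[OF \<sigma>_sub]
  have fold: "f A + f (Set.insert e A) = f (\<sigma> False A) + f (\<sigma> True A)" for f :: "'a set \<Rightarrow> real" and A
    by (simp add: \<sigma>_def)
  have "(f (\<sigma> False A) + f (\<sigma> True A)) \<ge> 0" if "A \<subseteq> E" "f = \<alpha> \<or> f = \<beta> \<or> f = \<gamma> \<or> f = \<delta>" for A f
    using that nonneg by (auto intro!: add_nonneg_nonneg)
  moreover have "(\<alpha> (\<sigma> False A) + \<alpha> (\<sigma> True A)) * (\<beta> (\<sigma> False B) + \<beta> (\<sigma> True B))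
     \<le> (\<gamma> (\<sigma> False (A \<union> B)) + \<gamma> (\<sigma> True (A \<union> B))) * (\<delta> (\<sigma> False (A \<inter> B)) + \<delta> (\<sigma> True (A \<inter> B)))"
    if A: "A \<subseteq> E" and B: "B \<subseteq> E" for A B
  proof (rule four_functions_single)
    fix i j
    have AB: "A \<union> B \<subseteq> E" "A \<inter> B \<subseteq> E"
      using A B by auto
    show "0 \<le> \<alpha> (\<sigma> i A)" "0 \<le> \<beta> (\<sigma> i B)" "0 \<le> \<gamma> (\<sigma> i (A \<union> B))" "0 \<le> \<delta> (\<sigma> i (A \<inter> B))"
      using A B AB nonneg by auto
    show "\<alpha> (\<sigma> i A) * \<beta> (\<sigma> j B) \<le> \<gamma> (\<sigma> (i \<or> j) (A \<union> B)) * \<delta> (\<sigma> (i \<and> j) (A \<inter> B))"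
      using insert.prems(5)[OF \<sigma>_sub[OF A, of i] \<sigma>_sub[OF B, of j]] \<sigma>[OF A B] by simp
  qed
  ultimately show ?case
    unfolding sum_Pow_insert[OF insert.hyps] fold by (intro insert.IH) auto
qed

section \<open>Positive association of the random-cluster measure\<close>

text \<open>
  The weight of \<open>F\<close> in the random-cluster measure on the edge set \<open>E\<close>, up to the constant factor
  \<open>q ^ card V\<close>. The letters refer to Fortuin and Kasteleyn.
\<close>

definition fk_weight :: "real \<Rightarrow> real \<Rightarrow> ('n::finite) edge set \<Rightarrow> 'n edge set \<Rightarrow> real" where
  "fk_weight q p E F = p ^ card F * (1 - p) ^ card (E - F) * (1 / q) ^ rank F"

definition fk_Z :: "real \<Rightarrow> real \<Rightarrow> ('n::finite) edge set \<Rightarrow> real" where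
  "fk_Z q p E = (\<Sum>F\<in>Pow E. fk_weight q p E F)"

definition fk_ex :: "real \<Rightarrow> real \<Rightarrow> ('n::finite) edge set \<Rightarrow> ('n edge set \<Rightarrow> real) \<Rightarrow> real" where
  "fk_ex q p E f = (\<Sum>F\<in>Pow E. fk_weight q p E F * f F) / fk_Z q p E"

abbreviation fk_prob :: "real \<Rightarrow> real \<Rightarrow> ('n::finite) edge set \<Rightarrow> ('n edge set \<Rightarrow> bool) \<Rightarrow> real" where
  "fk_prob q p E X \<equiv> fk_ex q p E (\<lambda>F. of_bool (X F))"

lemma fk_weight_nonneg: "0 \<le> p \<Longrightarrow> p \<le> 1 \<Longrightarrow> 0 < q \<Longrightarrow> 0 \<le> fk_weight q p E F"
  by (simp add: fk_weight_def)

lemma fk_Z_pos: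
  assumes "finite E" "0 \<le> p" "p \<le> 1" "0 < q"
  shows "0 < fk_Z q p E"
proof -
  define F where "F = (if p = 0 then {} else E)"
  have "0 < fk_weight q p E F"
    using assms by (simp add: F_def fk_weight_def)
  moreover have "F \<in> Pow E"
    by (simp add: F_def)
  ultimately show ?thesis
    unfolding fk_Z_def using assms fk_weight_nonneg by (intro sum_pos2[of _ F]) auto
qed

lemma fk_ex_add: "fk_ex q p E (\<lambda>F. f F + g F) = fk_ex q p E f + fk_ex q p E g"
  by (simp add: fk_ex_def distrib_left sum.distrib add_divide_distrib)

lemma fk_ex_diff: "fk_ex q p E (\<lambda>F. f F - g F) = fk_ex q p E f - fk_ex q p E g"
  by (simp add: fk_ex_def right_diff_distrib sum_subtractf diff_divide_distrib)

lemma fk_ex_cmult: "fk_ex q p E (\<lambda>F. c * f F) = c * fk_ex q p E f"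
  by (simp add: fk_ex_def sum_distrib_left mult.left_commute)

lemma fk_ex_sum: "fk_ex q p E (\<lambda>F. \<Sum>i\<in>I. f i F) = (\<Sum>i\<in>I. fk_ex q p E (f i))"
  by (simp add: fk_ex_def sum_distrib_left sum_divide_distrib[symmetric] sum.swap[of _ I])

lemma fk_ex_const:
  assumes "finite E" "0 \<le> p" "p \<le> 1" "0 < q"
  shows "fk_ex q p E (\<lambda>F. c) = c"
  using fk_Z_pos[OF assms] by (simp add: fk_ex_def fk_Z_def flip: sum_distrib_right)

lemma fk_ex_cong: "(\<And>F. F \<subseteq> E \<Longrightarrow> f F = g F) \<Longrightarrow> fk_ex q p E f = fk_ex q p E g"
  unfolding fk_ex_def by (auto intro!: arg_cong2[where f = "(/)"] sum.cong)

lemma fk_ex_mono: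
  assumes "finite E" "0 \<le> p" "p \<le> 1" "0 < q"
    and "\<And>F. F \<subseteq> E \<Longrightarrow> f F \<le> g F"
  shows "fk_ex q p E f \<le> fk_ex q p E g"
  unfolding fk_ex_def using fk_Z_pos[OF assms(1-4)] assms
  by (intro divide_right_mono sum_mono mult_left_mono) (auto simp: fk_weight_nonneg)

lemma fk_prob_bounds:
  assumes "finite E" "0 \<le> p" "p \<le> 1" "0 < q"
  shows "0 \<le> fk_prob q p E X" "fk_prob q p E X \<le> 1"
  using fk_ex_mono[OF assms, of "\<lambda>_. 0" "\<lambda>F. of_bool (X F)"]
    fk_ex_mono[OF assms, of "\<lambda>F. of_bool (X F)" "\<lambda>_. 1"] fk_ex_const[OF assms]
  by auto

lemma fk_prob_mono:
  assumes "finite E" "0 \<le> p" "p \<le> 1" "0 < q"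
    and "\<And>F. F \<subseteq> E \<Longrightarrow> X F \<Longrightarrow> Y F"
  shows "fk_prob q p E X \<le> fk_prob q p E Y"
  by (rule fk_ex_mono) (use assms in auto)

lemma fk_prob_not:
  assumes "finite E" "0 \<le> p" "p \<le> 1" "0 < q"
  shows "fk_prob q p E (\<lambda>F. \<not> X F) = 1 - fk_prob q p E X"
  using fk_ex_diff[of q p E "\<lambda>_. 1" "\<lambda>F. of_bool (X F)"] fk_ex_const[OF assms]
  by (simp add: of_bool_not_iff)

text \<open>
  The edges of \<open>A - B\<close> move from the first configuration to the second. Each of them turns a factor
  \<open>p * (1 - p')\<close> into \<open>p' * (1 - p)\<close>, which is no smaller, and the cluster weights are compared by
  submodularity of the rank.
\<close>

lemma fk_weight_lattice:
  assumes fin: "finite E'" and E: "E \<subseteq> E'" and p: "0 \<le> p" "p \<le> p'" "p' \<le> 1" and q: "1 \<le> q"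
    and A: "A \<subseteq> E" and B: "B \<subseteq> E'"
  shows "fk_weight q p E A * fk_weight q p' E' B
       \<le> fk_weight q p' E' (A \<union> B) * fk_weight q p E (A \<inter> B)"
proof -
  have finite: "finite E" "finite A" "finite B"
    using fin E A B by (meson finite_subset)+
  define j where "j = card (A - B)"
  have card_A: "card A = card (A \<inter> B) + j"
    unfolding j_def by (metis card_Int_Diff finite(2))
  have card_U: "card (A \<union> B) = card B + j"
    unfolding j_def using finite by (metis Un_Diff_cancel add.commute card_Un_disjoint Diff_disjoint finite_Diff Un_commute)
  have "E - A \<inter> B = (E - A) \<union> (A - B)"
    using A by auto
  moreover have "(E - A) \<inter> (A - B) = {}"
    by auto
  ultimately have card_E: "card (E - A \<inter> B) = card (E - A) + j"
    unfolding j_def using finite by (simp add: card_Un_disjoint)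
  have "E' - B = (E' - (A \<union> B)) \<union> (A - B)"
    using A E by auto
  moreover have "(E' - (A \<union> B)) \<inter> (A - B) = {}"
    by auto
  ultimately have card_E': "card (E' - B) = card (E' - (A \<union> B)) + j"
    unfolding j_def using finite fin by (simp add: card_Un_disjoint)
  define c where "c = p ^ card (A \<inter> B) * (1 - p) ^ card (E - A) * p' ^ card B *
    (1 - p') ^ card (E' - (A \<union> B))"
  have "fk_weight q p E A * fk_weight q p' E' B
      = c * ((p * (1 - p')) ^ j * (1 / q) ^ (rank A + rank B))"
    by (simp add: fk_weight_def c_def card_A card_E' power_add power_mult_distrib)
  also have "\<dots> \<le> c * ((p' * (1 - p)) ^ j * (1 / q) ^ (rank (A \<union> B) + rank (A \<inter> B)))"
  proof (intro mult_left_mono mult_mono)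
    have "p * (1 - p') \<le> p' * (1 - p)"
      using p by (simp add: algebra_simps)
    then show "(p * (1 - p')) ^ j \<le> (p' * (1 - p)) ^ j"
      using p by (intro power_mono) auto
    show "(1 / q) ^ (rank A + rank B) \<le> (1 / q) ^ (rank (A \<union> B) + rank (A \<inter> B))"
      using q by (intro power_decreasing rank_submodular finite) auto
    show "0 \<le> c"
      using p by (simp add: c_def)
  qed (use p q in auto)
  also have "\<dots> = fk_weight q p' E' (A \<union> B) * fk_weight q p E (A \<inter> B)"
    by (simp add: fk_weight_def c_def card_U card_E power_add power_mult_distrib)
  finally show ?thesis .
qed

text \<open>
  One instance of the four functions theorem gives both comparison principles: \<open>E = E'\<close> and \<open>p = p'\<close> is
  the FKG inequality, and the trivial event \<open>Y\<close> gives monotonicity in the edge set and in the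
  parameter.
\<close>

theorem fk_positive_association:
  assumes fin: "finite E'" and E: "E \<subseteq> E'" and p: "0 \<le> p" "p \<le> p'" "p' \<le> 1" and q: "1 \<le> q"
    and X: "mono X" and Y: "mono Y"
  shows "fk_prob q p E X * fk_prob q p' E' Y \<le> fk_prob q p' E' (\<lambda>F. X F \<and> Y F)"
proof -
  have finE: "finite E"
    using fin E finite_subset by blast
  define \<alpha> where "\<alpha> = (\<lambda>A. if A \<subseteq> E then fk_weight q p E A * of_bool (X A) else 0)"
  define \<beta> where "\<beta> = (\<lambda>B. fk_weight q p' E' B * of_bool (Y B))"
  define \<gamma> where "\<gamma> = (\<lambda>B. fk_weight q p' E' B * of_bool (X B \<and> Y B))"
  define \<delta> where "\<delta> = (\<lambda>A. if A \<subseteq> E then fk_weight q p E A else 0)"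
  have sum_E: "(\<Sum>A\<in>Pow E'. if A \<subseteq> E then f A else 0) = (\<Sum>A\<in>Pow E. f A)" for f :: "'a edge set \<Rightarrow> real"
    using fin E by (subst sum.inter_filter[symmetric]) (auto intro!: sum.cong)
  have nonneg: "0 \<le> fk_weight q p E A" "0 \<le> fk_weight q p' E' A" for A
    using p q by (auto intro!: fk_weight_nonneg)
  have "(\<Sum>A\<in>Pow E'. \<alpha> A) * (\<Sum>A\<in>Pow E'. \<beta> A) \<le> (\<Sum>A\<in>Pow E'. \<gamma> A) * (\<Sum>A\<in>Pow E'. \<delta> A)"
  proof (rule four_functions[OF fin])
    fix A B assume "A \<subseteq> E'" and B: "B \<subseteq> E'"
    show "\<alpha> A * \<beta> B \<le> \<gamma> (A \<union> B) * \<delta> (A \<inter> B)"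
    proof (cases "A \<subseteq> E \<and> X A \<and> Y B")
      case True
      then have "X (A \<union> B)" "Y (A \<union> B)" "A \<inter> B \<subseteq> E"
        using monoD[OF X, of A "A \<union> B"] monoD[OF Y, of B "A \<union> B"] by auto
      with True show ?thesis
        using fk_weight_lattice[OF fin E p q _ B] by (simp add: \<alpha>_def \<beta>_def \<gamma>_def \<delta>_def)
    next
      case False
      then have "\<alpha> A * \<beta> B = 0"
        by (auto simp: \<alpha>_def \<beta>_def)
      moreover have "0 \<le> \<gamma> (A \<union> B) * \<delta> (A \<inter> B)"
        using nonneg by (simp add: \<gamma>_def \<delta>_def)
      ultimately show ?thesis
        by linarith
    qed
  qed (use nonneg in \<open>auto simp: \<alpha>_def \<beta>_def \<gamma>_def \<delta>_def\<close>)
  then have "(\<Sum>A\<in>Pow E. fk_weight q p E A * of_bool (X A)) * (\<Sum>A\<in>Pow E'. \<beta> A)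
      \<le> (\<Sum>A\<in>Pow E'. \<gamma> A) * fk_Z q p E"
    unfolding \<alpha>_def \<delta>_def sum_E fk_Z_def .
  moreover have "0 < fk_Z q p E" "0 < fk_Z q p' E'"
    using fin finE p q by (auto intro!: fk_Z_pos)
  ultimately show ?thesis
    by (simp add: fk_ex_def \<beta>_def \<gamma>_def field_simps)
qed

corollary fk_prob_increasing:
  assumes fin: "finite E'" and E: "E \<subseteq> E'" and p: "0 \<le> p" "p \<le> p'" "p' \<le> 1" and q: "1 \<le> q"
    and X: "mono X"
  shows "fk_prob q p E X \<le> fk_prob q p' E' X"
  using fk_positive_association[OF assms, of "\<lambda>_. True"] fk_ex_const[of E' p' q 1] assms
  by (simp add: mono_def)

lemma mono_joined [simp, intro]: "mono (\<lambda>F. joined F x y)"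
  by (auto simp: mono_def intro: joined_mono)

section \<open>Adding an edge\<close>

lemma fk_weight_closed:
  assumes "finite E" "e \<notin> E" "F \<subseteq> E"
  shows "fk_weight q p (insert e E) F = (1 - p) * fk_weight q p E F"
proof -
  have "insert e E - F = insert e (E - F)" "e \<notin> E - F"
    using assms by auto
  then show ?thesis
    using assms by (simp add: fk_weight_def)
qed

lemma fk_weight_open:
  assumes "finite E" "e \<notin> E" "F \<subseteq> E" "ends e = {u, v}"
  shows "fk_weight q p (insert e E) (insert e F)
    = p * fk_weight q p E F * (if joined F u v then 1 else 1 / q)"
proof -
  have "insert e E - insert e F = E - F" "e \<notin> F" "finite F"
    using assms by (auto intro: finite_subset)
  then show ?thesis
    using rank_insert[OF _ assms(4), of F] by (simp add: fk_weight_def)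
qed

text \<open>
  Given the other edges, an open \<open>e\<close> has weight \<open>p\<close> if its endpoints are joined without it, and \<open>p / q\<close>
  otherwise, since it then reduces the number of clusters.
\<close>

lemma fk_sum_insert_edge:
  assumes "finite E" "e \<notin> E" "ends e = {u, v}"
  shows "(\<Sum>F\<in>Pow (insert e E). fk_weight q p (insert e E) F * f F) =
    (\<Sum>F\<in>Pow E. fk_weight q p E F *
      ((1 - p) * f F + p * (if joined F u v then 1 else 1 / q) * f (insert e F)))"
  unfolding sum_Pow_insert[OF assms(1,2)] using assms
  by (intro sum.cong) (auto simp: fk_weight_closed fk_weight_open[OF assms(1,2) _ assms(3)] algebra_simps)

section \<open>Random-cluster measures as weighted sums\<close>

lemma finite_induced_edges: "finite S \<Longrightarrow> finite (induced_edges S)"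
proof -
  assume "finite S"
  then have "finite (ends ` induced_edges S)"
    by (intro finite_subset[OF _ finite_Pow_iff[THEN iffD2]]) (auto simp: induced_edges_def)
  then show ?thesis
    by (rule finite_imageD) (auto simp: inj_on_def ends_inject)
qed

lemma configs_eq: "configs E = (\<lambda>F e. e \<in> F) ` Pow E"
proof
  show "configs E \<subseteq> (\<lambda>F e. e \<in> F) ` Pow E"
  proof
    fix \<omega> assume "\<omega> \<in> configs E"
    then have "\<omega> = (\<lambda>e. e \<in> {e. \<omega> e})" "{e. \<omega> e} \<in> Pow E"
      by (auto simp: configs_def)
    then show "\<omega> \<in> (\<lambda>F e. e \<in> F) ` Pow E"
      by (rule image_eqI)
  qed
qed (auto simp: configs_def)

lemma inj_config: "inj_on (\<lambda>F e. e \<in> F) A"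
  by (auto simp: inj_on_def fun_eq_iff)

text \<open>
  The constant \<open>q ^ card V\<close> cancels in the normalised measure.
\<close>

lemma rc_weight_eq:
  assumes "finite E" "finite V" "\<Union>(ends ` E) \<subseteq> V" "F \<subseteq> E" "0 < q"
  shows "rc_weight V E p q (\<lambda>e. e \<in> F) = q ^ card V * fk_weight q p E F"
proof -
  have "num_components V F + rank F = card V"
    using assms by (intro num_components_plus_rank) (auto intro: finite_subset)
  then have "q ^ card V * (1 / q) ^ rank F = q ^ num_components V F"
    using assms(5) by (simp add: power_add power_one_over flip: \<open>_ = card V\<close>)
  moreover have "{e \<in> E. e \<in> F} = F" "{e \<in> E. e \<notin> F} = E - F"
    using assms by auto
  ultimately show ?thesis
    by (simp add: rc_weight_def fk_weight_def num_components_def)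
qed

lemma integral_rc_measure:
  fixes f :: "('n::finite) config \<Rightarrow> real"
  assumes S: "finite S" and p: "0 \<le> p" "p \<le> 1" and q: "0 < q"
  shows "(\<integral>\<omega>. f \<omega> \<partial>rc_measure_on S p q) = fk_ex q p (induced_edges S) (\<lambda>F. f (\<lambda>e. e \<in> F))"
proof -
  let ?E = "induced_edges S :: 'n edge set"
  have E: "finite ?E" "\<Union>(ends ` ?E) \<subseteq> S"
    using S by (auto simp: finite_induced_edges) (auto simp: induced_edges_def)
  note weight = rc_weight_eq[OF E(1) S E(2) _ q]
  have Z: "rc_partition S ?E p q = q ^ card S * fk_Z q p ?E"
    by (simp add: rc_partition_def configs_eq sum.reindex[OF inj_config] fk_Z_def sum_distrib_left weight)
  have "0 \<le> rc_weight S ?E p q \<omega> / rc_partition S ?E p q" if "\<omega> \<in> configs ?E" for \<omega>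
    using that fk_weight_nonneg[OF p q] fk_Z_pos[OF E(1) p q] q
    by (auto simp: configs_eq weight Z intro!: divide_nonneg_pos mult_nonneg_nonneg)
  then have "(\<integral>\<omega>. f \<omega> \<partial>rc_measure_on S p q) =
      (\<Sum>\<omega>\<in>configs ?E. rc_weight S ?E p q \<omega> / rc_partition S ?E p q * f \<omega>)"
    unfolding rc_measure_def using E(1)
    by (subst lebesgue_integral_point_measure_finite) (auto simp: configs_eq)
  also have "\<dots> = (\<Sum>F\<in>Pow ?E. fk_weight q p ?E F / fk_Z q p ?E * f (\<lambda>e. e \<in> F))"
    using q by (auto simp: configs_eq sum.reindex[OF inj_config] weight Z intro!: sum.cong)
  finally show ?thesis
    by (simp add: fk_ex_def sum_divide_distrib)
qed

lemma prob_rc_measure: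
  fixes P :: "('n::finite) config \<Rightarrow> bool"
  assumes S: "finite S" and p: "0 \<le> p" "p \<le> 1" and q: "0 < q"
  shows "\<P>(\<omega> in rc_measure_on S p q. P \<omega>) = fk_prob q p (induced_edges S) (\<lambda>F. P (\<lambda>e. e \<in> F))"
proof -
  let ?M = "rc_measure_on S p q"
  interpret prob_space ?M
    using assms by (intro prob_space_rc_measure finite_induced_edges)
  have "{\<omega> \<in> space ?M. P \<omega>} \<in> sets ?M"
    by (auto simp: rc_measure_def space_point_measure sets_point_measure)
  then have "measure ?M {\<omega> \<in> space ?M. P \<omega>} = (\<integral>\<omega>. indicator {\<omega> \<in> space ?M. P \<omega>} \<omega> \<partial>?M)"
    by (simp add: Int_absorb2)
  also have "\<dots> = (\<integral>\<omega>. of_bool (P \<omega>) \<partial>?M)"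
    by (intro Bochner_Integration.integral_cong) (auto simp: indicator_def)
  finally show ?thesis
    using integral_rc_measure[OF assms, of "\<lambda>\<omega>. of_bool (P \<omega>)"] by simp
qed

section \<open>The graph norm of the lattice\<close>

definition l1 :: "int ^ ('n::finite) \<Rightarrow> nat" where
  "l1 x = nat (\<Sum>i\<in>UNIV. \<bar>x $ i\<bar>)"

lemma int_l1: "int (l1 x) = (\<Sum>i\<in>UNIV. \<bar>x $ i\<bar>)"
  by (simp add: l1_def sum_nonneg)

lemma l1_zero [simp]: "l1 0 = 0"
  by (simp add: l1_def)

lemma l1_triangle: "l1 (x + y) \<le> l1 x + l1 y"
proof -
  have "int (l1 (x + y)) \<le> int (l1 x) + int (l1 y)"
    unfolding int_l1 sum.distrib[symmetric] by (intro sum_mono) (simp add: abs_triangle_ineq)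
  then show ?thesis by simp
qed

lemma nearest_iff_l1: "nearest x y \<longleftrightarrow> l1 (y - x) = 1"
proof -
  have "nearest x y \<longleftrightarrow> int (l1 (y - x)) = 1"
    by (simp add: nearest_def int_l1 abs_minus_commute)
  then show ?thesis by simp
qed

lemma l1_component: "\<bar>x $ i\<bar> \<le> int (l1 x)"
  unfolding int_l1 by (rule member_le_sum) auto

text \<open>
  The volume of balls matters only through its polynomial growth, which loses against exponential
  decay.
\<close>

lemma l1_ball_finite: "finite {x :: int ^ ('n::finite). l1 x \<le> m}"
  and l1_ball_card: "card {x :: int ^ ('n::finite). l1 x \<le> m} \<le> (2 * m + 1) ^ CARD('n)"
proof -
  define C where "C = (UNIV :: 'n set) \<rightarrow>\<^sub>E {- int m..int m}"
  have sub: "{x :: int ^ 'n. l1 x \<le> m} \<subseteq> vec_lambda ` C"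
  proof
    fix x :: "int ^ 'n" assume x: "x \<in> {x. l1 x \<le> m}"
    have "($) x \<in> C"
      unfolding C_def using x l1_component[of x] by (auto simp: abs_le_iff) (smt (verit) of_nat_mono)+
    then show "x \<in> vec_lambda ` C"
      by (metis image_eqI vec_nth_inverse)
  qed
  have "finite C"
    by (simp add: C_def finite_PiE)
  then show "finite {x :: int ^ 'n. l1 x \<le> m}"
    using sub finite_subset by blast
  have "card {x :: int ^ 'n. l1 x \<le> m} \<le> card C"
    using sub \<open>finite C\<close> by (meson card_image_le card_mono finite_imageI le_trans)
  also have "\<dots> = (2 * m + 1) ^ CARD('n)"
    by (simp add: C_def card_PiE nat_add_distrib nat_mult_distrib)
  finally show "card {x :: int ^ 'n. l1 x \<le> m} \<le> (2 * m + 1) ^ CARD('n)" .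
qed

lemma finite_l1_bounded:
  fixes S :: "(int ^ ('n::finite)) set"
  assumes "finite S"
  obtains m where "S \<subseteq> {x. l1 x \<le> m}"
proof
  show "S \<subseteq> {x. l1 x \<le> Max (insert 0 (l1 ` S))}"
    using assms by auto
qed

lemma nearest_l1_le: "nearest x y \<Longrightarrow> l1 y \<le> l1 x + 1"
  using l1_triangle[of x "y - x"] by (simp add: nearest_iff_l1)

lemma finite_edge_boundary:
  assumes "finite S"
  shows "finite (edge_boundary S)"
proof -
  obtain m where "S \<subseteq> {x. l1 x \<le> m}"
    using assms finite_l1_bounded by blast
  then have "edge_boundary S \<subseteq> {x. l1 x \<le> m} \<times> {x. l1 x \<le> m + 1}"
    by (auto simp: edge_boundary_def dest!: nearest_l1_le)
  then show ?thesis
    by (rule finite_subset) (auto intro: l1_ball_finite)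
qed

section \<open>The Simon--Lieb inequality\<close>

definition two_point :: "real \<Rightarrow> ('n::finite) edge set \<Rightarrow> int ^ 'n \<Rightarrow> int ^ 'n \<Rightarrow> real" where
  "two_point p E x y = fk_prob 2 p E (\<lambda>F. joined F x y)"

lemma two_point_bounds:
  assumes "finite E" "0 \<le> p" "p \<le> 1"
  shows "0 \<le> two_point p E x y" "two_point p E x y \<le> 1"
  unfolding two_point_def using assms by (auto intro!: fk_prob_bounds)

lemma two_point_mono:
  assumes "finite E'" "E \<subseteq> E'" "0 \<le> p" "p \<le> p'" "p' \<le> 1"
  shows "two_point p E x y \<le> two_point p' E' x y"
  unfolding two_point_def using assms by (intro fk_prob_increasing) auto

lemma two_point_refl: "finite E \<Longrightarrow> 0 \<le> p \<Longrightarrow> p \<le> 1 \<Longrightarrow> two_point p E x x = 1"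
  by (simp add: two_point_def fk_ex_const)

lemma not_joined_isolated:
  assumes "\<And>e. e \<in> F \<Longrightarrow> x \<notin> ends e" "joined F x y"
  shows "x = y"
  using assms(2) by (induction rule: joined_induct) (use assms(1) in auto)

lemma two_point_isolated:
  assumes "\<And>e. e \<in> E \<Longrightarrow> x \<notin> ends e" "x \<noteq> y"
  shows "two_point p E x y = 0"
proof -
  have "two_point p E x y = fk_ex 2 p E (\<lambda>F. 0)"
    unfolding two_point_def using assms not_joined_isolated[of _ x y]
    by (intro fk_ex_cong) auto
  then show ?thesis
    by (simp add: fk_ex_def)
qed

text \<open>
  For \<open>q = 2\<close> the contributions with closed and with open \<open>e\<close> add up to a combination of old two-point
  functions. Where \<open>x\<close> and \<open>u\<close> are joined, the events \<open>x \<leftrightarrow> y\<close> and \<open>u \<leftrightarrow> y\<close> agree and \<open>e\<close> has total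
  weight \<open>1 = (1 - p / 2) + p / 2\<close>. Where they are not, these events exclude each other; the first has
  weight \<open>(1 - p) + p / 2 = 1 - p / 2\<close> and the second occurs only through an open \<open>e\<close>, with weight
  \<open>p / 2\<close>.
\<close>

lemma two_point_insert_edge:
  assumes E: "finite E" "e \<notin> E" and e: "ends e = {x, u}" and p: "0 \<le> p" "p \<le> 1"
  shows "two_point p (insert e E) x y * (1 + p / (2 - p) * two_point p E x u)
       = two_point p E x y + p / (2 - p) * two_point p E u y"
proof -
  define S where "S = (\<lambda>f. \<Sum>F\<in>Pow E. fk_weight 2 p E F * f F)"
  let ?xy = "\<lambda>F. of_bool (joined F x y) :: real"
  let ?uy = "\<lambda>F. of_bool (joined F u y) :: real"
  let ?xu = "\<lambda>F. of_bool (joined F x u) :: real"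
  have S: "two_point p E a b = S (\<lambda>F. of_bool (joined F a b)) / fk_Z 2 p E" for a b
    by (simp add: two_point_def fk_ex_def S_def)
  have Z: "0 < fk_Z 2 p E" "0 < fk_Z 2 p (insert e E)"
    using E p by (auto intro!: fk_Z_pos)
  have lin: "S (\<lambda>F. a * f F + b * g F) = a * S f + b * S g" for a b f g
    by (simp add: S_def distrib_left sum.distrib sum_distrib_left mult.left_commute)
  have Z': "fk_Z 2 p (insert e E) = (1 - p / 2) * fk_Z 2 p E + p / 2 * S ?xu"
  proof -
    have "fk_Z 2 p (insert e E) = S (\<lambda>F. (1 - p / 2) * 1 + p / 2 * ?xu F)"
      using fk_sum_insert_edge[OF E e, of 2 p "\<lambda>_. 1"]
      by (simp add: fk_Z_def S_def) (intro sum.cong, auto)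
    also have "\<dots> = (1 - p / 2) * S (\<lambda>_. 1) + p / 2 * S ?xu"
      by (rule lin)
    finally show ?thesis
      by (simp add: S_def fk_Z_def)
  qed
  have "fk_Z 2 p (insert e E) * two_point p (insert e E) x y
      = S (\<lambda>F. (1 - p) * ?xy F + p * (if joined F x u then 1 else 1 / 2) * ?xy (insert e F))"
    using Z fk_sum_insert_edge[OF E e] by (simp add: two_point_def fk_ex_def S_def)
  also have "\<dots> = S (\<lambda>F. (1 - p / 2) * ?xy F + p / 2 * ?uy F)"
  proof -
    have "(1 - p) * ?xy F + p * (if joined F x u then 1 else 1 / 2) * ?xy (insert e F)
        = (1 - p / 2) * ?xy F + p / 2 * ?uy F" for F
    proof (cases "joined F x u")
      case True
      then have "joined F u y \<longleftrightarrow> joined F x y"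
        by (meson joined_sym joined_trans)
      with True show ?thesis
        by (simp add: joined_insert[OF e] algebra_simps)
    next
      case False
      then have "\<not> (joined F x y \<and> joined F u y)"
        by (meson joined_sym joined_trans)
      with False show ?thesis
        by (auto simp: joined_insert[OF e] algebra_simps)
    qed
    then show ?thesis
      by simp
  qed
  also have "\<dots> = (1 - p / 2) * S ?xy + p / 2 * S ?uy"
    by (rule lin)
  finally have "((1 - p / 2) * fk_Z 2 p E + p / 2 * S ?xu) * two_point p (insert e E) x y
      = (1 - p / 2) * S ?xy + p / 2 * S ?uy"
    unfolding Z' .
  moreover have "S ?xu = fk_Z 2 p E * two_point p E x u" "S ?xy = fk_Z 2 p E * two_point p E x y"
    "S ?uy = fk_Z 2 p E * two_point p E u y"
    using Z by (simp_all add: S)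
  ultimately have "fk_Z 2 p E * (((1 - p / 2) + p / 2 * two_point p E x u) * two_point p (insert e E) x y)
      = fk_Z 2 p E * ((1 - p / 2) * two_point p E x y + p / 2 * two_point p E u y)"
    by (simp add: algebra_simps)
  then have "((1 - p / 2) + p / 2 * two_point p E x u) * two_point p (insert e E) x y
      = (1 - p / 2) * two_point p E x y + p / 2 * two_point p E u y"
    using Z by simp
  then show ?thesis
    using p by (simp add: field_simps)
qed

text \<open>
  Induction on \<open>E\<close>, removing an edge \<open>e\<close> between \<open>x\<close> and a neighbour \<open>u\<close>. If \<open>u \<in> S\<close>, the identity of
  \<open>two_point_insert_edge\<close> is used twice: in \<open>E\<close> it expresses the left-hand side by the two-point functions
  to which the induction hypothesis applies, and inside \<open>S\<close> it puts the resulting sums together again.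
  The two normalising factors compare in the right direction because two-point functions increase with
  the graph. If \<open>u \<notin> S\<close>, the identity itself produces the term of the boundary edge \<open>(x, u)\<close>.
\<close>

theorem simon_lieb:
  fixes S :: "(int ^ ('n::finite)) set"
  assumes "finite E" "x \<in> S" "y \<notin> S" and p: "0 \<le> p" "p \<le> 1"
  shows "two_point p E x y \<le>
    p / (2 - p) * (\<Sum>(a, b)\<in>{(a, b). a \<in> S \<and> b \<notin> S \<and> (\<exists>e\<in>E. ends e = {a, b})}.
      two_point p (E \<inter> induced_edges S) x a * two_point p E b y)"
  using assms(1,2)
proof (induction E arbitrary: x rule: finite_psubset_induct)
  case (psubset E)
  define r where "r = p / (2 - p)"
  have r: "0 \<le> r"
    using p by (simp add: r_def)
  define D :: "'n edge set \<Rightarrow> _" where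
    "D = (\<lambda>E. {(a, b). a \<in> S \<and> b \<notin> S \<and> (\<exists>e\<in>E. ends e = {a, b})})"
  define B where "B = (\<lambda>E x. \<Sum>(a, b)\<in>D E. two_point p (E \<inter> induced_edges S) x a * two_point p E b y)"
  have fin: "finite F" if "F \<subseteq> E" for F
    using that psubset.hyps finite_subset by blast
  have fin_D: "finite (D F)" if "F \<subseteq> E" for F
  proof (rule finite_subset)
    show "D F \<subseteq> (\<Union>(ends ` F)) \<times> (\<Union>(ends ` F))"
      by (auto simp: D_def)
    show "finite (\<Union>(ends ` F) \<times> \<Union>(ends ` F))"
      using fin[OF that] by auto
  qed
  have IH: "two_point p (E - {e}) w y \<le> r * B (E - {e}) w" if "e \<in> E" "w \<in> S" for e w
    using that psubset.IH[of "E - {e}" w] unfolding B_def D_def r_def by blast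
  have nonneg: "0 \<le> two_point p F a b" if "F \<subseteq> E" for F a b
    using two_point_bounds(1) fin[OF that] p by blast
  consider e u where "e \<in> E" "ends e = {x, u}" "u \<in> S" | e u where "e \<in> E" "ends e = {x, u}" "u \<notin> S"
    | "\<And>e. e \<in> E \<Longrightarrow> x \<notin> ends e"
  proof (cases "\<exists>e\<in>E. x \<in> ends e")
    case True
    then obtain e u where "e \<in> E" "ends e = {x, u}"
      using edge_at_cases by metis
    then show ?thesis
      using that by blast
  qed (use that in blast)
  then have "two_point p E x y \<le> r * B E x"
  proof cases
    case (1 e u)
    let ?E = "E - {e}"
    have E: "finite ?E" "e \<notin> ?E" "insert e ?E = E"
      using 1 fin by auto
    have e_S: "e \<in> induced_edges S"
      using 1 psubset.prems by (simp add: induced_edges_def)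
    then have ES: "finite (?E \<inter> induced_edges S)" "e \<notin> ?E \<inter> induced_edges S"
      "insert e (?E \<inter> induced_edges S) = E \<inter> induced_edges S"
      using 1 fin by auto
    have D_eq: "D ?E = D E"
    proof -
      have "\<not> ends e = {a, b}" if "b \<notin> S" for a b
        using that e_S by (auto simp: induced_edges_def)
      then show ?thesis
        unfolding D_def by blast
    qed
    define t where "t = 1 + r * two_point p ?E x u"
    have t: "0 < t"
      using r nonneg[of ?E x u] by (simp add: t_def add_pos_nonneg)
    have "two_point p E x y * t = two_point p ?E x y + r * two_point p ?E u y"
      using two_point_insert_edge[OF E(1,2) 1(2) p, of y] E by (simp add: t_def r_def)
    also have "\<dots> \<le> r * B ?E x + r * (r * B ?E u)"
      using IH[OF 1(1)] psubset.prems 1(3) r by (intro add_mono mult_left_mono) auto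
    also have "\<dots> = r * (B ?E x + r * B ?E u)"
      by (simp add: algebra_simps)
    also have "\<dots> \<le> r * (B E x * t)"
    proof (intro mult_left_mono r)
      have "B ?E x + r * B ?E u = (\<Sum>(a, b)\<in>D E. (two_point p (?E \<inter> induced_edges S) x a
          + r * two_point p (?E \<inter> induced_edges S) u a) * two_point p ?E b y)"
        unfolding B_def D_eq by (simp add: sum_distrib_left case_prod_unfold algebra_simps flip: sum.distrib)
      also have "\<dots> \<le> (\<Sum>(a, b)\<in>D E. (two_point p (E \<inter> induced_edges S) x a * t) * two_point p E b y)"
      proof (intro sum_mono, clarify)
        fix a b
        have "two_point p (?E \<inter> induced_edges S) x a + r * two_point p (?E \<inter> induced_edges S) u a
            = two_point p (E \<inter> induced_edges S) x a * (1 + r * two_point p (?E \<inter> induced_edges S) x u)"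
          using two_point_insert_edge[OF ES(1,2) 1(2) p, of a] unfolding ES(3) r_def by simp
        also have "\<dots> \<le> two_point p (E \<inter> induced_edges S) x a * t"
          unfolding t_def using r nonneg p E
          by (intro mult_left_mono add_left_mono two_point_mono) auto
        finally show "(two_point p (?E \<inter> induced_edges S) x a + r * two_point p (?E \<inter> induced_edges S) u a)
            * two_point p ?E b y \<le> two_point p (E \<inter> induced_edges S) x a * t * two_point p E b y"
          using nonneg t psubset.hyps p by (intro mult_mono two_point_mono) (auto simp: less_imp_le)
      qed
      also have "\<dots> = B E x * t"
        unfolding B_def by (simp add: sum_distrib_right sum_distrib_left case_prod_unfold algebra_simps)
      finally show "B ?E x + r * B ?E u \<le> B E x * t" .
    qed
    also have "\<dots> = (r * B E x) * t"
      by simp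
    finally show ?thesis
      using t by simp
  next
    case (2 e u)
    let ?E = "E - {e}"
    have E: "finite ?E" "e \<notin> ?E" "insert e ?E = E"
      using 2 fin by auto
    have ES: "?E \<inter> induced_edges S = E \<inter> induced_edges S"
      using 2 by (auto simp: induced_edges_def)
    have D_eq: "D E = insert (x, u) (D ?E)"
    proof -
      have "(a, b) \<in> D E \<longleftrightarrow> (a, b) \<in> insert (x, u) (D ?E)" for a b
      proof -
        have "(\<exists>e'\<in>E. ends e' = {a, b}) \<longleftrightarrow> ends e = {a, b} \<or> (\<exists>e'\<in>?E. ends e' = {a, b})"
          using 2(1) by (metis Diff_iff singletonD)
        moreover have "a \<in> S \<and> b \<notin> S \<and> ends e = {a, b} \<longleftrightarrow> a = x \<and> b = u"
          using 2 psubset.prems by (auto simp: doubleton_eq_iff)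
        ultimately show ?thesis
          unfolding D_def mem_Collect_eq case_prod_conv insert_iff prod.inject by argo
      qed
      then show ?thesis
        by auto
    qed
    have xu: "(x, u) \<notin> D ?E"
      using 2 by (auto simp: D_def ends_inject simp flip: 2(2))
    have "two_point p E x y * 1 \<le> two_point p E x y * (1 + r * two_point p ?E x u)"
      using r nonneg by (intro mult_left_mono) auto
    also have "\<dots> = two_point p ?E x y + r * two_point p ?E u y"
      using two_point_insert_edge[OF E(1,2) 2(2) p, of y] E by (simp add: r_def)
    also have "\<dots> \<le> r * B ?E x + r * two_point p E u y"
      using IH[OF 2(1) psubset.prems] r psubset.hyps p
      by (intro add_mono mult_left_mono two_point_mono) auto
    also have "\<dots> \<le> r * B E x"
    proof -
      have "B ?E x \<le> (\<Sum>(a, b)\<in>D ?E. two_point p (E \<inter> induced_edges S) x a * two_point p E b y)"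
        unfolding B_def ES using nonneg psubset.hyps p
        by (intro sum_mono) (auto intro!: mult_left_mono two_point_mono)
      moreover have "two_point p (E \<inter> induced_edges S) x x = 1"
        using fin p by (simp add: two_point_refl)
      moreover have "B E x = (\<Sum>(a, b)\<in>insert (x, u) (D ?E).
          two_point p (E \<inter> induced_edges S) x a * two_point p E b y)"
        by (simp only: B_def D_eq)
      ultimately have "B ?E x + two_point p E u y \<le> B E x"
        using xu fin_D[of ?E] by simp
      then show ?thesis
        using r by (simp flip: distrib_left add: mult_left_mono)
    qed
    finally show ?thesis
      by simp
  next
    case 3
    then have "two_point p E x y = 0"
      using psubset.prems assms(3) by (intro two_point_isolated) auto
    moreover have "0 \<le> B E x"
      unfolding B_def using nonneg by (intro sum_nonneg) auto
    ultimately show ?thesis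
      using r by simp
  qed
  then show ?case
    by (simp add: B_def D_def r_def)
qed

text \<open>
  By monotonicity in the graph the right-hand side may be computed in the full graph on \<open>S\<close>, which makes
  the factor in front of \<open>two_point p E b y\<close> independent of \<open>E\<close>.
\<close>

corollary simon_lieb_boundary:
  assumes "finite E" "finite S" "x \<in> S" "y \<notin> S" and p: "0 \<le> p" "p \<le> 1"
  shows "two_point p E x y \<le>
    p / (2 - p) * (\<Sum>(a, b)\<in>edge_boundary S. two_point p (induced_edges S) x a * two_point p E b y)"
proof -
  note fin = finite_induced_edges[OF assms(2)]
  have "two_point p E x y \<le>
    p / (2 - p) * (\<Sum>(a, b)\<in>{(a, b). a \<in> S \<and> b \<notin> S \<and> (\<exists>e\<in>E. ends e = {a, b})}.
      two_point p (E \<inter> induced_edges S) x a * two_point p E b y)"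
    by (rule simon_lieb) fact+
  also have "\<dots> \<le> p / (2 - p) * (\<Sum>(a, b)\<in>{(a, b). a \<in> S \<and> b \<notin> S \<and> (\<exists>e\<in>E. ends e = {a, b})}.
      two_point p (induced_edges S) x a * two_point p E b y)"
    using p fin assms(1) two_point_bounds(1)
    by (intro mult_left_mono sum_mono) (auto intro!: mult_right_mono two_point_mono)
  also have "\<dots> \<le> p / (2 - p) * (\<Sum>(a, b)\<in>edge_boundary S.
      two_point p (induced_edges S) x a * two_point p E b y)"
    using p fin assms(1) finite_edge_boundary[OF assms(2)]
    by (intro mult_left_mono sum_mono2)
      (auto simp: edge_boundary_def two_point_bounds dest: edge_ends_nearest)
  finally show ?thesis .
qed

section \<open>Translation invariance\<close>

text \<open>
  Translations reduce the Simon--Lieb inequality for a set around an arbitrary vertex to a set around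
  the origin.
\<close>

definition shift_edge :: "int ^ 'n \<Rightarrow> ('n::finite) edge \<Rightarrow> 'n edge" where
  "shift_edge c e = Abs_edge ((+) c ` ends e)"

lemma nearest_shift: "nearest (c + x) (c + y) \<longleftrightarrow> nearest x y"
  by (simp add: nearest_def)

lemma ends_shift_edge: "ends (shift_edge c e) = (+) c ` ends e"
proof -
  obtain x y where xy: "ends e = {x, y}" "nearest x y"
    using edge_cases by blast
  then have "(+) c ` ends e \<in> {{x, y} | x y. nearest x y}"
    using nearest_shift[of c x y] by auto
  then show ?thesis
    unfolding shift_edge_def by (rule Abs_edge_inverse)
qed

lemma shift_edge_inverse [simp]: "shift_edge (- c) (shift_edge c e) = e"
  "shift_edge c (shift_edge (- c) e) = e"
  by (simp_all add: ends_shift_edge image_image flip: ends_inject)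

lemma inj_shift_edge: "inj (shift_edge c)"
  by (rule inj_on_inverseI[where g = "shift_edge (- c)"]) simp

lemma joined_shift_imp: "joined F x y \<Longrightarrow> joined (shift_edge c ` F) (c + x) (c + y)"
proof (induction rule: joined_induct)
  case (step e y z)
  have "ends (shift_edge c e) = {c + y, c + z}"
    using step by (simp add: ends_shift_edge)
  then show ?case
    using step joined_step[of "shift_edge c ` F" "c + x" "c + y" "shift_edge c e" "c + z"] by blast
qed simp

lemma joined_shift: "joined (shift_edge c ` F) (c + x) (c + y) \<longleftrightarrow> joined F x y"
  using joined_shift_imp[of F x y c] joined_shift_imp[of "shift_edge c ` F" "c + x" "c + y" "- c"]
  by (auto simp: image_image)

lemma rank_shift: "finite F \<Longrightarrow> rank (shift_edge c ` F) = rank F"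
proof (induction F rule: finite_induct)
  case (insert e F)
  obtain u v where uv: "ends e = {u, v}"
    using edge_cases by blast
  then have "ends (shift_edge c e) = {c + u, c + v}"
    by (simp add: ends_shift_edge)
  then show ?case
    using insert rank_insert[OF _ uv, of F] rank_insert[of "shift_edge c ` F" "shift_edge c e" "c + u" "c + v"]
    by (simp add: joined_shift)
qed simp

lemma fk_weight_shift:
  assumes "finite E" "F \<subseteq> E"
  shows "fk_weight q p (shift_edge c ` E) (shift_edge c ` F) = fk_weight q p E F"
proof -
  have "card (shift_edge c ` A) = card A" for A
    by (rule card_image) (meson inj_shift_edge inj_on_subset subset_UNIV)
  moreover have "shift_edge c ` E - shift_edge c ` F = shift_edge c ` (E - F)"
    by (simp add: image_set_diff[OF inj_shift_edge])
  ultimately show ?thesis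
    using assms rank_shift[of F c] by (simp add: fk_weight_def finite_subset)
qed

lemma two_point_shift:
  assumes "finite E"
  shows "two_point p (shift_edge c ` E) (c + x) (c + y) = two_point p E x y"
proof -
  have inj: "inj_on ((`) (shift_edge c)) (Pow E)"
    by (meson inj_image_eq_iff inj_onI inj_shift_edge)
  have Pow: "Pow (shift_edge c ` E) = (`) (shift_edge c) ` Pow E"
    by (rule image_Pow_surj[symmetric]) simp
  show ?thesis
    unfolding two_point_def fk_ex_def fk_Z_def Pow sum.reindex[OF inj]
    using assms by (auto simp: fk_weight_shift joined_shift intro!: arg_cong2[where f = "(/)"] sum.cong)
qed

lemma induced_edges_shift: "induced_edges ((+) c ` S) = shift_edge c ` induced_edges S"
proof
  show "shift_edge c ` induced_edges S \<subseteq> induced_edges ((+) c ` S)"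
    by (rule image_subsetI) (simp add: induced_edges_def ends_shift_edge image_mono)
  show "induced_edges ((+) c ` S) \<subseteq> shift_edge c ` induced_edges S"
  proof
    fix e assume "e \<in> induced_edges ((+) c ` S)"
    then have "shift_edge (- c) e \<in> induced_edges S"
      by (auto simp: induced_edges_def ends_shift_edge)
    then show "e \<in> shift_edge c ` induced_edges S"
      by (metis image_eqI shift_edge_inverse(2))
  qed
qed

lemma edge_boundary_shift:
  "edge_boundary ((+) c ` S) = (\<lambda>(a, b). (c + a, c + b)) ` edge_boundary S"
proof
  show "(\<lambda>(a, b). (c + a, c + b)) ` edge_boundary S \<subseteq> edge_boundary ((+) c ` S)"
    by (auto simp: edge_boundary_def nearest_shift)
  show "edge_boundary ((+) c ` S) \<subseteq> (\<lambda>(a, b). (c + a, c + b)) ` edge_boundary S"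
  proof clarify
    fix a b assume ab: "(a, b) \<in> edge_boundary ((+) c ` S)"
    then obtain a' where a': "a = c + a'" "a' \<in> S"
      by (auto simp: edge_boundary_def)
    then have "(a', b - c) \<in> edge_boundary S"
      using ab nearest_shift[of c a' "b - c"] by (auto simp: edge_boundary_def image_iff)
    then have "(\<lambda>(a, b). (c + a, c + b)) (a', b - c) \<in> (\<lambda>(a, b). (c + a, c + b)) ` edge_boundary S"
      by (rule imageI)
    then show "(a, b) \<in> (\<lambda>(a, b). (c + a, c + b)) ` edge_boundary S"
      using a' by simp
  qed
qed

section \<open>Finite energy\<close>

text \<open>
  Configurations with \<open>e\<close> closed have weight \<open>1 - p\<close> times their old weight, and the normalising constant
  does not grow because an open \<open>e\<close> has weight at most \<open>p\<close>.
\<close>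

lemma finite_energy_insert:
  assumes E: "finite E" "e \<notin> E" and p: "0 \<le> p" "p \<le> 1" and q: "1 \<le> q"
  shows "(1 - p) * fk_prob q p E X \<le> fk_prob q p (insert e E) X"
proof -
  obtain u v where e: "ends e = {u, v}"
    using edge_cases by blast
  have Z: "0 < fk_Z q p E" "0 < fk_Z q p (insert e E)"
    using E p q by (auto intro!: fk_Z_pos)
  define c where "c = (\<lambda>F. if joined F u v then 1 else 1 / q)"
  have c: "0 \<le> c F" "c F \<le> 1" for F
    using q by (auto simp: c_def)
  have w: "0 \<le> fk_weight q p E F" for F
    using p q by (intro fk_weight_nonneg) auto
  have "fk_Z q p (insert e E) = (\<Sum>F\<in>Pow E. fk_weight q p E F * ((1 - p) * 1 + p * c F * 1))"
    using fk_sum_insert_edge[OF E e, of q p "\<lambda>_. 1"] unfolding fk_Z_def c_def by simp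
  also have "\<dots> \<le> (\<Sum>F\<in>Pow E. fk_weight q p E F * 1)"
  proof (intro sum_mono mult_left_mono w)
    fix F
    show "(1 - p) * 1 + p * c F * 1 \<le> 1"
      using mult_left_mono[OF c(2)[of F] p(1)] by simp
  qed
  finally have Z_le: "fk_Z q p (insert e E) \<le> fk_Z q p E"
    by (simp add: fk_Z_def)
  have "(\<Sum>F\<in>Pow E. fk_weight q p E F * ((1 - p) * of_bool (X F)))
    \<le> (\<Sum>F\<in>Pow (insert e E). fk_weight q p (insert e E) F * of_bool (X F))"
    unfolding fk_sum_insert_edge[OF E e] using p q w
    by (intro sum_mono mult_left_mono) auto
  then have "(1 - p) * fk_prob q p E X \<le>
    (\<Sum>F\<in>Pow (insert e E). fk_weight q p (insert e E) F * of_bool (X F)) / fk_Z q p E"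
    using Z unfolding fk_ex_cmult[symmetric] unfolding fk_ex_def by (intro divide_right_mono) auto
  also have "\<dots> \<le> fk_prob q p (insert e E) X"
    unfolding fk_ex_def using Z Z_le p q
    by (intro divide_left_mono sum_nonneg mult_nonneg_nonneg fk_weight_nonneg) auto
  finally show ?thesis .
qed

lemma finite_energy:
  assumes "finite D" "finite E" "D \<inter> E = {}" and p: "0 \<le> p" "p \<le> 1" and q: "1 \<le> q"
  shows "(1 - p) ^ card D * fk_prob q p E X \<le> fk_prob q p (D \<union> E) X"
  using assms(1,3)
proof (induction D rule: finite_induct)
  case (insert e D)
  have "(1 - p) * ((1 - p) ^ card D * fk_prob q p E X) \<le> (1 - p) * fk_prob q p (D \<union> E) X"
    using insert p by (intro mult_left_mono) auto
  also have "\<dots> \<le> fk_prob q p (insert e (D \<union> E)) X"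
    using insert assms(2) p q by (intro finite_energy_insert) auto
  finally show ?case
    using insert by simp
qed simp

text \<open>
  All edges at \<open>x\<close> may be closed at a bounded price. The bound is strictly less than 1 for \<open>p < 1\<close>,
  uniformly in \<open>E\<close>; it covers the short distances, where the iterated Simon--Lieb inequality gives
  nothing and the claimed decay has no multiplicative constant to spare.
\<close>

lemma two_point_le_finite_energy:
  assumes E: "finite E" and p: "0 \<le> p" "p \<le> 1" and "x \<noteq> y"
  shows "two_point p E x y \<le> 1 - (1 - p) ^ card {e. x \<in> ends e}"
proof -
  define D where "D = {e \<in> E. x \<in> ends e}"
  have "{e. x \<in> ends e} \<subseteq> induced_edges {z. l1 z \<le> l1 x + 1}"
  proof
    fix e assume "e \<in> {e. x \<in> ends e}"
    then obtain u where u: "ends e = {x, u}" "nearest x u"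
      using edge_at_cases by blast
    then show "e \<in> induced_edges {z. l1 z \<le> l1 x + 1}"
      using nearest_l1_le[of x u] by (auto simp: induced_edges_def)
  qed
  then have "finite {e. x \<in> ends e}"
    by (rule finite_subset) (intro finite_induced_edges l1_ball_finite)
  then have card_D: "card D \<le> card {e. x \<in> ends e}"
    by (intro card_mono) (auto simp: D_def)
  have "(1 - p) ^ card {e. x \<in> ends e} \<le> (1 - p) ^ card D"
    using p card_D by (intro power_decreasing) auto
  also have "\<dots> = (1 - p) ^ card D * fk_prob 2 p (E - D) (\<lambda>F. \<not> joined F x y)"
  proof -
    have "two_point p (E - D) x y = 0"
      using assms(4) by (intro two_point_isolated) (auto simp: D_def)
    then show ?thesis
      using E p by (subst fk_prob_not) (auto simp: two_point_def)
  qed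
  also have "\<dots> \<le> fk_prob 2 p (D \<union> (E - D)) (\<lambda>F. \<not> joined F x y)"
    using E p by (intro finite_energy) (auto simp: D_def)
  also have "D \<union> (E - D) = E"
    by (auto simp: D_def)
  also have "fk_prob 2 p E (\<lambda>F. \<not> joined F x y) = 1 - two_point p E x y"
    using E p by (subst fk_prob_not) (auto simp: two_point_def)
  finally show ?thesis by simp
qed

section \<open>Exponential decay\<close>

text \<open>
  The Simon--Lieb inequality for the translate of \<open>S\<close> that is centred at the current vertex moves this
  vertex by at most \<open>L\<close>, at the price of one factor. It applies \<open>k\<close> times before \<open>y\<close> can be reached.
\<close>

lemma two_point_iterate:
  fixes S :: "(int ^ ('n::finite)) set" and x y :: "int ^ 'n"
  assumes p: "0 \<le> p" "p \<le> 1" and S: "finite S" "0 \<in> S"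
    and L: "\<And>a. a \<in> S \<Longrightarrow> l1 a < L" and E: "finite E" and far: "k * L \<le> l1 (y - x)"
  shows "two_point p E x y \<le>
    (p / (2 - p) * (\<Sum>(a, b)\<in>edge_boundary S. two_point p (induced_edges S) 0 a)) ^ k"
    (is "_ \<le> ?\<rho> ^ k")
  using far
proof (induction k arbitrary: x)
  case 0
  then show ?case
    using two_point_bounds[OF E p] by simp
next
  case (Suc k)
  let ?c = "two_point p (induced_edges S) 0"
  let ?T = "(+) x ` S"
  note fin = finite_induced_edges[OF S(1)]
  have "y \<notin> ?T"
    using L Suc.prems by fastforce
  moreover have "x \<in> ?T"
    using S by (auto intro: image_eqI[of _ _ 0])
  ultimately have "two_point p E x y \<le> p / (2 - p) *
      (\<Sum>(a, b)\<in>edge_boundary ?T. two_point p (induced_edges ?T) x a * two_point p E b y)"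
    using E S p by (intro simon_lieb_boundary) auto
  also have "(\<Sum>(a, b)\<in>edge_boundary ?T. two_point p (induced_edges ?T) x a * two_point p E b y)
      = (\<Sum>(a, b)\<in>edge_boundary S. ?c a * two_point p E (x + b) y)"
    unfolding edge_boundary_shift induced_edges_shift
    by (subst sum.reindex)
      (auto simp: inj_on_def case_prod_unfold two_point_shift[OF fin, of p x 0, simplified])
  also have "p / (2 - p) * \<dots> \<le> p / (2 - p) * (\<Sum>(a, b)\<in>edge_boundary S. ?c a * ?\<rho> ^ k)"
  proof (intro mult_left_mono sum_mono, clarify)
    fix a b assume ab: "(a, b) \<in> edge_boundary S"
    then have "l1 b \<le> L"
      using L[of a] nearest_l1_le[of a b] by (auto simp: edge_boundary_def)
    then have "k * L \<le> l1 (y - (x + b))"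
      using Suc.prems l1_triangle[of "y - (x + b)" b] by simp
    then show "?c a * two_point p E (x + b) y \<le> ?c a * ?\<rho> ^ k"
      using Suc.IH two_point_bounds[OF fin p] by (intro mult_left_mono) auto
  qed (use p in auto)
  also have "\<dots> = ?\<rho> ^ Suc k"
    by (simp add: sum_distrib_right case_prod_unfold flip: sum_distrib_right)
  finally show ?case .
qed

text \<open>
  Beyond distance \<open>L\<close> the iterated inequality gives a rate of \<open>\<rho>\<close> per \<open>L\<close> steps, and closer to the origin
  finite energy gives the factor \<open>1 - \<delta>\<close>. Since \<open>max 1 (n div L) \<ge> n / (2 * L)\<close>, the larger base \<open>\<kappa>\<close>
  serves both ranges. The rate does not depend on \<open>E\<close>, so it survives the infinite-volume limit.
\<close>

theorem exponential_decay:
  fixes S :: "(int ^ ('n::finite)) set"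
  assumes p: "0 \<le> p" "p < 1" and S: "finite S" "0 \<in> S"
    and \<rho>: "p / (2 - p) * (\<Sum>(a, b)\<in>edge_boundary S. two_point p (induced_edges S) 0 a) < 1"
  obtains c where "0 < c"
    and "\<And>(E :: 'n edge set) x. finite E \<Longrightarrow> two_point p E 0 x \<le> exp (- c * real (l1 x))"
proof -
  define \<rho> where "\<rho> = p / (2 - p) * (\<Sum>(a, b)\<in>edge_boundary S. two_point p (induced_edges S) 0 a)"
  obtain m where m: "S \<subseteq> {x. l1 x \<le> m}"
    using S finite_l1_bounded by blast
  define L where "L = Suc m"
  define \<delta> where "\<delta> = (1 - p) ^ card {e :: 'n edge. 0 \<in> ends e}"
  \<comment> \<open>The value \<open>1 / 2\<close> only keeps \<open>\<kappa>\<close> positive, so that its logarithm makes sense.\<close>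
  define \<kappa> where "\<kappa> = max (max \<rho> (1 - \<delta>)) (1 / 2)"
  define c where "c = - ln \<kappa> / (2 * real L)"
  have \<rho>_nonneg: "0 \<le> \<rho>"
    unfolding \<rho>_def using p two_point_bounds[OF finite_induced_edges[OF S(1)]]
    by (intro mult_nonneg_nonneg sum_nonneg) auto
  have \<kappa>: "0 < \<kappa>" "\<kappa> < 1" "\<rho> \<le> \<kappa>" "1 - \<delta> \<le> \<kappa>"
    using \<rho> p by (auto simp: \<kappa>_def \<rho>_def \<delta>_def)
  have "0 < c"
    using \<kappa> by (simp add: c_def L_def divide_neg_pos)
  moreover have "two_point p E 0 x \<le> exp (- c * real (l1 x))" if E: "finite E" for E :: "'n edge set" and x
  proof (cases "x = 0")
    case True
    then show ?thesis
      using two_point_bounds[OF E, of p 0 x] p by simp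
  next
    case False
    define k where "k = l1 x div L"
    have "two_point p E 0 x \<le> \<rho> ^ k"
      unfolding \<rho>_def
    proof (rule two_point_iterate[where L = L])
      show "k * L \<le> l1 (x - 0)"
        by (simp add: k_def div_times_less_eq_dividend)
    qed (use p S E m in \<open>auto simp: L_def\<close>)
    also have "\<dots> \<le> \<kappa> ^ k"
      using \<rho>_nonneg \<kappa> by (intro power_mono) auto
    finally have 1: "two_point p E 0 x \<le> \<kappa> ^ k" .
    have 2: "two_point p E 0 x \<le> \<kappa> ^ 1"
      using two_point_le_finite_energy[OF E, of p 0 x] p False \<kappa> by (simp add: \<delta>_def)
    have "two_point p E 0 x \<le> \<kappa> ^ max 1 k"
      using 1 2 by (simp add: max_def)
    also have "\<dots> = \<kappa> powr real (max 1 k)"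
      using \<kappa> by (simp add: powr_realpow)
    also have "\<dots> \<le> \<kappa> powr (real (l1 x) / (2 * real L))"
    proof (rule powr_mono')
      have "l1 x < L * (k + 1)"
        unfolding k_def by (metis L_def Suc_eq_plus1 dividend_less_times_div zero_less_Suc mult_Suc_right add.commute)
      also have "\<dots> \<le> L * (2 * max 1 k)"
        by (intro mult_le_mono2) simp
      finally have "real (l1 x) \<le> real (L * (2 * max 1 k))"
        by linarith
      then show "real (l1 x) / (2 * real L) \<le> real (max 1 k)"
        by (simp add: L_def field_simps)
    qed (use \<kappa> in auto)
    also have "\<dots> = exp (- c * real (l1 x))"
      using \<kappa> by (simp add: powr_def c_def)
    finally show ?thesis .
  qed
  ultimately show ?thesis
    by (rule that)
qed

section \<open>The derivative in the edge parameter\<close>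

lemma has_derivative_fk_sum:
  assumes "finite E" and p: "0 < p" "p < 1"
  shows "((\<lambda>p. \<Sum>F\<in>Pow E. fk_weight q p E F * f F) has_real_derivative
    (\<Sum>F\<in>Pow E. fk_weight q p E F * (f F * (real (card F) - p * real (card E)))) / (p * (1 - p))) (at p)"
proof -
  have "((\<lambda>p. fk_weight q p E F * f F) has_real_derivative
      fk_weight q p E F * (f F * (real (card F) - p * real (card E))) / (p * (1 - p))) (at p)"
    if F: "F \<in> Pow E" for F
  proof -
    define a where "a = card F"
    define b where "b = card (E - F)"
    have ab: "card E = a + b"
      using F assms(1) unfolding a_def b_def
      by (metis PowD add.commute card_Diff_subset card_mono finite_subset le_add_diff_inverse2)
    have 1: "real a * p ^ (a - 1) = p ^ a * (real a / p)"
      using p by (cases a) auto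
    have 2: "real b * (1 - p) ^ (b - 1) = (1 - p) ^ b * (real b / (1 - p))"
      using p by (cases b) auto
    have eq: "real a / p - real b / (1 - p) = (real a - p * real (card E)) / (p * (1 - p))"
      using p by (simp add: ab field_simps)
    have "((\<lambda>p. p ^ a * (1 - p) ^ b * ((1 / q) ^ rank F * f F)) has_real_derivative
      ((real a * p ^ (a - 1)) * (1 - p) ^ b - p ^ a * (real b * (1 - p) ^ (b - 1)))
        * ((1 / q) ^ rank F * f F)) (at p)"
      by (auto intro!: derivative_eq_intros simp: algebra_simps)
    also have "((real a * p ^ (a - 1)) * (1 - p) ^ b - p ^ a * (real b * (1 - p) ^ (b - 1)))
        * ((1 / q) ^ rank F * f F)
        = p ^ a * (1 - p) ^ b * (1 / q) ^ rank F * f F * (real a / p - real b / (1 - p))"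
      unfolding 1 2 by (simp add: algebra_simps)
    also have "\<dots> = fk_weight q p E F * (f F * (real (card F) - p * real (card E))) / (p * (1 - p))"
      unfolding eq by (simp add: fk_weight_def a_def b_def)
    finally show ?thesis
      by (simp add: fk_weight_def a_def b_def mult.assoc)
  qed
  then show ?thesis
    unfolding sum_divide_distrib by (intro DERIV_sum) auto
qed

text \<open>
  Differentiating \<open>p ^ o * (1 - p) ^ (m - o)\<close> produces the factor \<open>(o - p * m) / (p * (1 - p))\<close>, and the
  constant \<open>p * m\<close> cancels after normalisation. What remains is the covariance with the number of open
  edges.
\<close>

lemma has_derivative_fk_ex:
  assumes E: "finite E" and p: "0 < p" "p < 1" and q: "0 < q"
  shows "((\<lambda>p. fk_ex q p E f) has_real_derivative
    (fk_ex q p E (\<lambda>F. f F * real (card F)) - fk_ex q p E f * fk_ex q p E (\<lambda>F. real (card F)))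
      / (p * (1 - p))) (at p)"
proof -
  define S where "S = (\<lambda>f. \<Sum>F\<in>Pow E. fk_weight q p E F * f F)"
  define m where "m = p * real (card E)"
  have Z: "0 < fk_Z q p E" "fk_Z q p E = S (\<lambda>_. 1)"
    using fk_Z_pos[of E p q] assms by (auto simp: fk_Z_def S_def)
  have S_diff: "S (\<lambda>F. f F * (real (card F) - m)) = S (\<lambda>F. f F * real (card F)) - m * S f" for f
    by (simp add: S_def algebra_simps sum_subtractf sum_distrib_left)
  have d: "((\<lambda>p. \<Sum>F\<in>Pow E. fk_weight q p E F * f F) has_real_derivative
      (S (\<lambda>F. f F * real (card F)) - m * S f) / (p * (1 - p))) (at p)" for f
    using has_derivative_fk_sum[OF E p, of q f] unfolding S_diff[symmetric] unfolding S_def m_def .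
  have "((\<lambda>p. (\<Sum>F\<in>Pow E. fk_weight q p E F * f F) / (\<Sum>F\<in>Pow E. fk_weight q p E F * 1))
    has_real_derivative
      ((S (\<lambda>F. f F * real (card F)) - m * S f) / (p * (1 - p)) * S (\<lambda>_. 1)
      - S f * ((S (\<lambda>F. 1 * real (card F)) - m * S (\<lambda>_. 1)) / (p * (1 - p)))) / (S (\<lambda>_. 1) * S (\<lambda>_. 1))) (at p)"
    using DERIV_divide[OF d[of f] d[of "\<lambda>_. 1"]] Z unfolding S_def by simp
  also have "((S (\<lambda>F. f F * real (card F)) - m * S f) / (p * (1 - p)) * S (\<lambda>_. 1)
      - S f * ((S (\<lambda>F. 1 * real (card F)) - m * S (\<lambda>_. 1)) / (p * (1 - p)))) / (S (\<lambda>_. 1) * S (\<lambda>_. 1))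
      = (S (\<lambda>F. f F * real (card F)) / S (\<lambda>_. 1) - S f / S (\<lambda>_. 1) * (S (\<lambda>F. real (card F)) / S (\<lambda>_. 1)))
        / (p * (1 - p))"
    using Z p by (simp add: divide_simps) (simp add: algebra_simps)
  finally show ?thesis
    by (simp add: fk_ex_def S_def fk_Z_def)
qed

lemma continuous_fk_ex:
  assumes E: "finite E" and q: "0 < q"
  shows "continuous_on {0..1} (\<lambda>p. fk_ex q p E f)"
proof -
  have "\<forall>p\<in>{0..1}. (\<Sum>F\<in>Pow E. fk_weight q p E F) \<noteq> 0"
    using fk_Z_pos[OF E _ _ q] unfolding fk_Z_def by fastforce
  then show ?thesis
    unfolding fk_ex_def fk_Z_def fk_weight_def
    by (intro continuous_intros) auto
qed

text \<open>
  By monotonicity in the graph the worst case is the graph with the single edge \<open>e\<close>.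
\<close>

lemma fk_prob_edge_open_ge:
  assumes E: "finite E" "e \<in> E" and p: "0 \<le> p" "p \<le> 1" and q: "1 \<le> q"
  shows "p / (p + q * (1 - p)) \<le> fk_prob q p E (\<lambda>F. e \<in> F)"
proof -
  obtain u v where e: "ends e = {u, v}"
    using edge_cases by blast
  then have "rank {e} = 1"
    using rank_insert[of "{}" e u v] edge_ends_neq[OF e] by (simp add: joined_empty)
  then have "p / (p + q * (1 - p)) = fk_prob q p {e} (\<lambda>F. e \<in> F)"
    using q by (simp add: fk_ex_def fk_Z_def fk_weight_def Pow_insert field_simps)
  also have "\<dots> \<le> fk_prob q p E (\<lambda>F. e \<in> F)"
    using E p q by (intro fk_prob_increasing) (auto simp: mono_def)
  finally show ?thesis .
qed

text \<open>
  The event that \<open>X\<close> holds once \<open>e\<close> is opened is increasing and coincides with \<open>X\<close> where \<open>e\<close> is open.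
  Positive association with \<open>e\<close> being open therefore bounds the joint probability below, and the gap
  between this event and \<open>X\<close> is the event that \<open>e\<close> is closed and pivotal.
\<close>

lemma covariance_ge_pivotal:
  assumes E: "finite E" and p: "0 \<le> p" "p \<le> 1" and q: "1 \<le> q" and X: "mono X"
  shows "fk_prob q p E (\<lambda>F. e \<in> F) * fk_prob q p E (\<lambda>F. X (insert e F) \<and> \<not> X F)
    \<le> fk_prob q p E (\<lambda>F. X F \<and> e \<in> F) - fk_prob q p E X * fk_prob q p E (\<lambda>F. e \<in> F)"
proof -
  have "mono (\<lambda>F. X (insert e F))"
  proof (rule monoI)
    fix F G :: "'a edge set" assume "F \<le> G"
    then show "X (insert e F) \<le> X (insert e G)"
      by (intro monoD[OF X]) auto
  qed
  then have "fk_prob q p E (\<lambda>F. X (insert e F)) * fk_prob q p E (\<lambda>F. e \<in> F)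
      \<le> fk_prob q p E (\<lambda>F. X (insert e F) \<and> e \<in> F)"
    using E p q by (intro fk_positive_association) (auto simp: mono_def)
  also have "\<dots> = fk_prob q p E (\<lambda>F. X F \<and> e \<in> F)"
    by (rule fk_ex_cong) (auto simp: insert_absorb)
  also have "fk_prob q p E (\<lambda>F. X (insert e F))
      = fk_prob q p E (\<lambda>F. X (insert e F) \<and> \<not> X F) + fk_prob q p E X"
  proof -
    have "X F \<Longrightarrow> X (insert e F)" for F
      using monoD[OF X, of F "insert e F"] by auto
    then show ?thesis
      unfolding fk_ex_add[symmetric] by (intro fk_ex_cong) (auto simp: of_bool_def)
  qed
  finally show ?thesis
    by (simp add: algebra_simps)
qed

text \<open>
  The random-cluster substitute for Russo's formula, with an inequality in place of the identity that
  holds for independent edges.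
\<close>

lemma derivative_ge_pivotal:
  assumes E: "finite E" and p: "0 < p" "p < 1" and q: "1 \<le> q" and X: "mono X"
  obtains \<theta>' where "((\<lambda>p. fk_prob q p E X) has_real_derivative \<theta>') (at p)"
    and "1 / ((p + q * (1 - p)) * (1 - p)) * fk_ex q p E (\<lambda>F. real (card {e \<in> E. X (insert e F) \<and> \<not> X F})) \<le> \<theta>'"
proof -
  let ?P = "fk_prob q p E"
  define C where "C = (\<lambda>e. ?P (\<lambda>F. X F \<and> e \<in> F) - ?P X * ?P (\<lambda>F. e \<in> F))"
  have pos: "0 < p + q * (1 - p)"
    using p q by (simp add: add_pos_pos)
  have card: "real (card F) = (\<Sum>e\<in>E. of_bool (e \<in> F))" if "F \<subseteq> E" for F
    using that E by (simp add: Int_absorb1 flip: Int_def)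
  have "fk_ex q p E (\<lambda>F. of_bool (X F) * real (card F)) = (\<Sum>e\<in>E. ?P (\<lambda>F. X F \<and> e \<in> F))"
    unfolding fk_ex_sum[symmetric]
    by (intro fk_ex_cong) (simp add: card sum_distrib_left of_bool_conj)
  moreover have "fk_ex q p E (\<lambda>F. real (card F)) = (\<Sum>e\<in>E. ?P (\<lambda>F. e \<in> F))"
    unfolding fk_ex_sum[symmetric] by (intro fk_ex_cong) (simp add: card)
  ultimately have "((\<lambda>p. fk_prob q p E X) has_real_derivative (\<Sum>e\<in>E. C e) / (p * (1 - p))) (at p)"
    using has_derivative_fk_ex[OF E p, of q "\<lambda>F. of_bool (X F)"] q
    by (simp add: C_def sum_subtractf sum_distrib_left)
  moreover have "1 / ((p + q * (1 - p)) * (1 - p)) * fk_ex q p E (\<lambda>F. real (card {e \<in> E. X (insert e F) \<and> \<not> X F}))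
      \<le> (\<Sum>e\<in>E. C e) / (p * (1 - p))"
  proof -
    have "fk_ex q p E (\<lambda>F. real (card {e \<in> E. X (insert e F) \<and> \<not> X F}))
        = (\<Sum>e\<in>E. ?P (\<lambda>F. X (insert e F) \<and> \<not> X F))"
      unfolding fk_ex_sum[symmetric] using E by (intro fk_ex_cong) (simp add: Int_def)
    then have "p / (p + q * (1 - p)) * fk_ex q p E (\<lambda>F. real (card {e \<in> E. X (insert e F) \<and> \<not> X F}))
        = (\<Sum>e\<in>E. p / (p + q * (1 - p)) * ?P (\<lambda>F. X (insert e F) \<and> \<not> X F))"
      by (simp add: sum_distrib_left)
    also have "\<dots> \<le> (\<Sum>e\<in>E. C e)"
    proof (intro sum_mono)
      fix e assume "e \<in> E"
      then have "p / (p + q * (1 - p)) * ?P (\<lambda>F. X (insert e F) \<and> \<not> X F)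
          \<le> ?P (\<lambda>F. e \<in> F) * ?P (\<lambda>F. X (insert e F) \<and> \<not> X F)"
        using E p q fk_prob_bounds[of E p q] by (intro mult_right_mono fk_prob_edge_open_ge) auto
      also have "\<dots> \<le> C e"
        unfolding C_def using E p q X by (intro covariance_ge_pivotal) auto
      finally show "p / (p + q * (1 - p)) * ?P (\<lambda>F. X (insert e F) \<and> \<not> X F) \<le> C e" .
    qed
    finally have "p / (p + q * (1 - p)) * fk_ex q p E (\<lambda>F. real (card {e \<in> E. X (insert e F) \<and> \<not> X F}))
      / (p * (1 - p)) \<le> (\<Sum>e\<in>E. C e) / (p * (1 - p))"
      using p by (intro divide_right_mono) auto
    then show ?thesis
      using p by simp
  qed
  ultimately show ?thesis
    by (rule that)
qed

section \<open>The domain Markov property\<close>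

text \<open>
  A path can leave \<open>T\<close> only through an edge with one endpoint in \<open>T\<close>.
\<close>

lemma joined_confined:
  assumes "\<And>e. e \<in> F \<Longrightarrow> ends e \<subseteq> T \<or> ends e \<inter> T = {}" "x \<in> T" "joined F x y"
  shows "y \<in> T" "joined (F \<inter> induced_edges T) x y"
proof -
  have "y \<in> T \<and> joined (F \<inter> induced_edges T) x y"
    using assms(3)
  proof (induction rule: joined_induct)
    case (step e y z)
    then have "ends e \<subseteq> T"
      using assms(1)[of e] by auto
    then show ?case
      using step joined_step[of "F \<inter> induced_edges T" x y e z] by (auto simp: induced_edges_def)
  qed (use assms(2) in simp)
  then show "y \<in> T" "joined (F \<inter> induced_edges T) x y"
    by auto
qed

lemma rank_disjoint:
  assumes "finite F" "finite G" "F \<subseteq> induced_edges S" "G \<subseteq> induced_edges (- S)"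
  shows "rank (F \<union> G) = rank F + rank G"
  using assms(1,3)
proof (induction F rule: finite_induct)
  case (insert e F)
  obtain u v where e: "ends e = {u, v}"
    using edge_cases by blast
  have u: "u \<in> S"
    using insert e by (auto simp: induced_edges_def)
  have "ends d \<subseteq> S \<or> ends d \<inter> S = {}" if "d \<in> F \<union> G" for d
    using that insert assms by (auto simp: induced_edges_def)
  moreover have "(F \<union> G) \<inter> induced_edges S = F"
  proof -
    have "d \<notin> induced_edges S" if "d \<in> G" for d
      using that assms(4) by (rule_tac edge_cases[of d]) (auto simp: induced_edges_def)
    then show ?thesis
      using insert by auto
  qed
  ultimately have "joined (F \<union> G) u v \<longleftrightarrow> joined F u v"
    using joined_confined(2)[of "F \<union> G" S u v] u joined_mono[of F u v "F \<union> G"] by auto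
  then show ?case
    using insert assms rank_insert[OF _ e, of F] rank_insert[OF _ e, of "F \<union> G"] by simp
qed simp

text \<open>
  With the edges \<open>E3\<close> between \<open>S\<close> and its complement closed, no cluster meets both sides, so the rank and
  with it the weight split into an inner and an outer factor.
\<close>

lemma fk_sum_split:
  assumes E: "finite E"
    and E1: "E1 = E \<inter> induced_edges S" and E2: "E2 = E \<inter> induced_edges (- S)" and E3: "E3 = E - E1 - E2"
  shows "(\<Sum>F\<in>Pow E. fk_weight q p E F * (of_bool (F \<inter> E3 = {}) * f (F \<inter> E1) * g (F \<inter> E2)))
    = (1 - p) ^ card E3 *
      (\<Sum>F\<in>Pow E1. fk_weight q p E1 F * f F) * (\<Sum>F\<in>Pow E2. fk_weight q p E2 F * g F)"
proof -
  have disj: "E1 \<inter> E2 = {}"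
  proof -
    have "\<not> (ends e \<subseteq> S \<and> ends e \<subseteq> - S)" for e
      by (rule edge_cases[of e]) auto
    then show ?thesis
      unfolding E1 E2 induced_edges_def by blast
  qed
  have fin: "finite E1" "finite E2" "finite E3"
    using E by (auto simp: E1 E2 E3)
  have w: "fk_weight q p E (F \<union> G) = (1 - p) ^ card E3 * fk_weight q p E1 F * fk_weight q p E2 G"
    if F: "F \<subseteq> E1" and G: "G \<subseteq> E2" for F G
  proof -
    have FG: "finite F" "finite G" "F \<inter> G = {}"
      using F G fin disj by (auto intro: finite_subset)
    have "E - (F \<union> G) = (E1 - F) \<union> ((E2 - G) \<union> E3)"
      using F G disj by (auto simp: E1 E2 E3)
    moreover have "(E1 - F) \<inter> ((E2 - G) \<union> E3) = {}" "(E2 - G) \<inter> E3 = {}"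
      using disj by (auto simp: E3)
    ultimately have "card (E - (F \<union> G)) = card (E1 - F) + (card (E2 - G) + card E3)"
      using fin by (simp add: card_Un_disjoint)
    moreover have "rank (F \<union> G) = rank F + rank G"
      using FG F G by (intro rank_disjoint[of _ _ S]) (auto simp: E1 E2)
    ultimately show ?thesis
      using FG by (simp add: fk_weight_def card_Un_disjoint power_add)
  qed
  have "(\<Sum>F\<in>Pow E. fk_weight q p E F * (of_bool (F \<inter> E3 = {}) * f (F \<inter> E1) * g (F \<inter> E2)))
     = (\<Sum>F\<in>Pow (E1 \<union> E2). fk_weight q p E F * (f (F \<inter> E1) * g (F \<inter> E2)))"
    using E by (intro sum.mono_neutral_cong_right) (auto simp: E1 E2 E3)
  also have "\<dots> = (\<Sum>(F, G)\<in>Pow E1 \<times> Pow E2. fk_weight q p E (F \<union> G) * (f F * g G))"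
  proof (rule sum.reindex_bij_witness[of _ "\<lambda>(F, G). F \<union> G" "\<lambda>F. (F \<inter> E1, F \<inter> E2)"], goal_cases)
    case (5 F)
    then have "F \<inter> E1 \<union> F \<inter> E2 = F"
      by auto
    then show ?case
      by simp
  qed (use disj in auto)
  also have "\<dots> = (\<Sum>F\<in>Pow E1. \<Sum>G\<in>Pow E2. (1 - p) ^ card E3 * (fk_weight q p E1 F * f F) * (fk_weight q p E2 G * g G))"
    unfolding sum.cartesian_product by (intro sum.cong) (auto simp: w)
  finally show ?thesis
    unfolding mult.assoc[of "(1 - p) ^ card E3"] sum_product by (simp add: sum_distrib_left mult.assoc)
qed

text \<open>
  Given the configuration outside \<open>S\<close> and that all edges leaving \<open>S\<close> are closed, the configuration inside
  \<open>S\<close> has the free law.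
\<close>

lemma domain_markov:
  assumes E: "finite E" and p: "0 \<le> p" "p \<le> 1" and q: "0 < q"
    and E1: "E1 = E \<inter> induced_edges S" and E2: "E2 = E \<inter> induced_edges (- S)" and E3: "E3 = E - E1 - E2"
  shows "fk_ex q p E (\<lambda>F. of_bool (F \<inter> E3 = {}) * f (F \<inter> E1) * g (F \<inter> E2))
    = fk_ex q p E1 f * fk_ex q p E (\<lambda>F. of_bool (F \<inter> E3 = {}) * g (F \<inter> E2))"
proof -
  have "0 < fk_Z q p E1"
    using E p q by (intro fk_Z_pos) (auto simp: E1)
  then show ?thesis
    using fk_sum_split[OF E E1 E2 E3, of q p f g] fk_sum_split[OF E E1 E2 E3, of q p "\<lambda>_. 1" g]
    by (simp add: fk_ex_def fk_Z_def)
qed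

section \<open>The differential inequality for exit probabilities\<close>

definition neighbourhood :: "(int ^ ('n::finite)) set \<Rightarrow> (int ^ 'n) set" where
  "neighbourhood D = D \<union> {y. \<exists>x\<in>D. nearest x y}"

text \<open>
  Reaching the outer vertex boundary of \<open>D\<close>. All edges that leave \<open>D\<close> are present in the graph induced
  by its neighbourhood, and the outer boundary serves as the target.
\<close>

definition exits :: "(int ^ ('n::finite)) set \<Rightarrow> int ^ 'n \<Rightarrow> 'n edge set \<Rightarrow> bool" where
  "exits D x F \<longleftrightarrow> (\<exists>y\<in>neighbourhood D - D. joined F x y)"

lemma finite_neighbourhood: "finite D \<Longrightarrow> finite (neighbourhood D)"
proof -
  assume "finite D"
  then obtain m where "D \<subseteq> {x. l1 x \<le> m}"
    using finite_l1_bounded by blast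
  then have "neighbourhood D \<subseteq> {x. l1 x \<le> m + 1}"
    unfolding neighbourhood_def using nearest_l1_le by fastforce
  then show ?thesis
    using l1_ball_finite finite_subset by blast
qed

lemma mono_exits: "mono (exits D x)"
  unfolding exits_def by (intro monoI) (auto intro: joined_mono)

lemma exits_joined: "joined F x y \<Longrightarrow> exits D y F \<Longrightarrow> exits D x F"
  unfolding exits_def by (blast intro: joined_trans)

text \<open>
  The region that is not connected to the outer boundary. Exploring from the outer boundary reveals it
  without looking at the edges inside it.
\<close>

definition trapped :: "(int ^ ('n::finite)) set \<Rightarrow> 'n edge set \<Rightarrow> (int ^ 'n) set" where
  "trapped D F = {x \<in> D. \<not> exits D x F}"

text \<open>
  If \<open>(a, b)\<close> is a boundary edge of the trapped region then \<open>b\<close> reaches the outer boundary of \<open>D\<close>, either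
  because it lies on it or because it is not trapped. So the edge becomes a bridge from \<open>x\<close> to the outer
  boundary as soon as \<open>x\<close> is joined to \<open>a\<close>. Orienting boundary edges from the inside to the outside makes
  the map from pairs to edges injective.
\<close>

lemma card_pivotal_ge:
  fixes D :: "(int ^ ('n::finite)) set"
  assumes D: "finite D" "x \<in> D" and F: "F \<subseteq> induced_edges (neighbourhood D)" and no: "\<not> exits D x F"
  shows "(\<Sum>(a, b)\<in>edge_boundary (trapped D F). of_bool (joined F x a))
    \<le> real (card {e \<in> induced_edges (neighbourhood D). exits D x (insert e F) \<and> \<not> exits D x F})"
proof -
  let ?S = "trapped D F"
  define P where "P = {(a, b) \<in> edge_boundary ?S. joined F x a}"
  have "\<forall>ab. \<exists>e. ab \<in> P \<longrightarrow> ends e = {fst ab, snd ab}"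
    using ex_edge by (auto simp: P_def edge_boundary_def) 
  then obtain g where g: "\<And>ab. ab \<in> P \<Longrightarrow> ends (g ab) = {fst ab, snd ab}"
    by metis
  have fin: "finite (edge_boundary ?S)"
    using D by (intro finite_edge_boundary) (simp add: trapped_def)
  have inj: "inj_on g P"
  proof (rule inj_onI)
    fix s t assume st: "s \<in> P" "t \<in> P" "g s = g t"
    then have "{fst s, snd s} = {fst t, snd t}"
      using g by metis
    moreover have "fst s \<in> ?S" "snd s \<notin> ?S" "fst t \<in> ?S" "snd t \<notin> ?S"
      using st by (auto simp: P_def edge_boundary_def)
    ultimately show "s = t"
      by (metis doubleton_eq_iff prod.expand)
  qed
  have "g ` P \<subseteq> {e \<in> induced_edges (neighbourhood D). exits D x (insert e F) \<and> \<not> exits D x F}"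
  proof (clarify, intro conjI no)
    fix a b assume ab: "(a, b) \<in> P"
    then have *: "a \<in> D" "nearest a b" "b \<notin> ?S" "joined F x a"
      by (auto simp: P_def edge_boundary_def trapped_def)
    then have b: "b \<in> neighbourhood D"
      by (auto simp: neighbourhood_def)
    then show "g (a, b) \<in> induced_edges (neighbourhood D)"
      using g[OF ab] * by (auto simp: induced_edges_def neighbourhood_def)
    have "exits D b F"
    proof (cases "b \<in> D")
      case True
      then show ?thesis
        using * by (simp add: trapped_def)
    next
      case False
      then show ?thesis
        unfolding exits_def using b by (intro bexI[of _ b]) auto
    qed
    then have "exits D b (insert (g (a, b)) F)"
      using monoD[OF mono_exits[of D b], of F "insert (g (a, b)) F"] by auto
    moreover have "joined (insert (g (a, b)) F) x b"
      using g[OF ab] *(4) joined_insert[of "g (a, b)" a b F x b] by simp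
    ultimately show "exits D x (insert (g (a, b)) F)"
      by (rule exits_joined[rotated])
  qed
  then have "card (g ` P) \<le> card {e \<in> induced_edges (neighbourhood D). exits D x (insert e F) \<and> \<not> exits D x F}"
    using D by (intro card_mono) (simp_all add: finite_induced_edges finite_neighbourhood)
  moreover have "(\<Sum>(a, b)\<in>edge_boundary ?S. of_bool (joined F x a)) = real (card P)"
  proof -
    have "(\<Sum>(a, b)\<in>edge_boundary ?S. of_bool (joined F x a)) = real (card (edge_boundary ?S \<inter> {ab. joined F x (fst ab)}))"
      using fin by (simp add: case_prod_unfold)
    also have "edge_boundary ?S \<inter> {ab. joined F x (fst ab)} = P"
      by (auto simp: P_def)
    finally show ?thesis .
  qed
  ultimately show ?thesis
    using card_image[OF inj] by simp
qed

text \<open>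
  An open edge leaving the trapped region would connect its inner endpoint to the outer boundary. Once
  all edges leaving \<open>S\<close> are closed, paths stay on their side of \<open>S\<close>, so the event that the trapped region
  is \<open>S\<close> is decided by \<open>E2\<close> and connections from \<open>S\<close> by \<open>E1\<close>. This brings the event into the form required
  by the domain Markov property.
\<close>

lemma trapped_eq_iff:
  fixes D :: "(int ^ ('n::finite)) set"
  assumes S: "S \<subseteq> D" and F: "F \<subseteq> E"
    and E: "E = induced_edges (neighbourhood D)"
    and E1: "E1 = E \<inter> induced_edges S" and E2: "E2 = E \<inter> induced_edges (- S)" and E3: "E3 = E - E1 - E2"
  shows "trapped D F = S \<longleftrightarrow> F \<inter> E3 = {} \<and> (\<forall>v\<in>D - S. exits D v (F \<inter> E2))"
    and "F \<inter> E3 = {} \<Longrightarrow> x \<in> S \<Longrightarrow> joined F x y \<longleftrightarrow> joined (F \<inter> E1) x y"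
proof -
  have split: "ends e \<subseteq> S \<or> ends e \<subseteq> - S" if "F \<inter> E3 = {}" "e \<in> F" for e
    using that F by (auto simp: E1 E2 E3 induced_edges_def)
  have inS: "y \<in> S \<and> joined (F \<inter> E1) x y" if "F \<inter> E3 = {}" "x \<in> S" "joined F x y" for x y
  proof -
    have "ends e \<subseteq> S \<or> ends e \<inter> S = {}" if "e \<in> F" for e
      using split[OF \<open>F \<inter> E3 = {}\<close> that] by auto
    moreover have "F \<inter> induced_edges S = F \<inter> E1"
      using F by (auto simp: E1)
    ultimately show ?thesis
      using joined_confined[of F S x y] that by auto
  qed
  have outS: "y \<notin> S \<and> joined (F \<inter> E2) x y" if "F \<inter> E3 = {}" "x \<notin> S" "joined F x y" for x y
  proof -
    have "ends e \<subseteq> - S \<or> ends e \<inter> - S = {}" if "e \<in> F" for e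
      using split[OF \<open>F \<inter> E3 = {}\<close> that] by auto
    moreover have "F \<inter> induced_edges (- S) = F \<inter> E2"
      using F by (auto simp: E2)
    ultimately show ?thesis
      using joined_confined[of F "- S" x y] that by auto
  qed
  show "joined F x y \<longleftrightarrow> joined (F \<inter> E1) x y" if "F \<inter> E3 = {}" "x \<in> S"
    using inS[OF that] joined_mono[of "F \<inter> E1" x y F] by auto
  show "trapped D F = S \<longleftrightarrow> F \<inter> E3 = {} \<and> (\<forall>v\<in>D - S. exits D v (F \<inter> E2))"
  proof
    assume eq: "trapped D F = S"
    have "e \<notin> E3" if "e \<in> F" for e
    proof
      assume "e \<in> E3"
      then have "\<not> ends e \<subseteq> S" "\<not> ends e \<subseteq> - S"
        by (auto simp: E1 E2 E3 induced_edges_def)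
      then obtain a b where ab: "ends e = {a, b}" "a \<in> S" "b \<notin> S"
        by (rule_tac edge_cases[of e]) (auto simp: insert_commute)
      then have "b \<in> neighbourhood D"
        using that F by (auto simp: E induced_edges_def)
      then have "exits D b F"
      proof (cases "b \<in> D")
        case True
        then show ?thesis
          using ab eq by (auto simp: trapped_def)
      next
        case False
        then show ?thesis
          unfolding exits_def using \<open>b \<in> neighbourhood D\<close> by (intro bexI[of _ b]) auto
      qed
      moreover have "joined F a b"
        using ab that by (auto intro: joined_step[of F a a e])
      ultimately have "exits D a F"
        using exits_joined by blast
      then show False
        using ab eq by (auto simp: trapped_def)
    qed
    then have E3: "F \<inter> E3 = {}"
      by auto
    moreover have "exits D v (F \<inter> E2)" if "v \<in> D - S" for v
    proof -
      have "exits D v F"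
        using that eq by (auto simp: trapped_def)
      then show ?thesis
        using outS[OF E3] that by (auto simp: exits_def)
    qed
    ultimately show "F \<inter> E3 = {} \<and> (\<forall>v\<in>D - S. exits D v (F \<inter> E2))"
      by simp
  next
    assume *: "F \<inter> E3 = {} \<and> (\<forall>v\<in>D - S. exits D v (F \<inter> E2))"
    have "exits D v F" if "v \<in> D - S" for v
      using * that monoD[OF mono_exits[of D v], of "F \<inter> E2" F] by auto
    moreover have "\<not> exits D v F" if "v \<in> S" for v
      using inS[OF _ that] * S by (auto simp: exits_def)
    ultimately show "trapped D F = S"
      using S by (auto simp: trapped_def)
  qed
qed

lemma trapped_domain_markov:
  fixes D :: "(int ^ ('n::finite)) set"
  assumes D: "finite D" and S: "S \<subseteq> D" "x \<in> S" and p: "0 \<le> p" "p \<le> 1"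
  shows "fk_prob 2 p (induced_edges (neighbourhood D)) (\<lambda>F. trapped D F = S \<and> joined F x y)
    = fk_prob 2 p (induced_edges (neighbourhood D)) (\<lambda>F. trapped D F = S) * two_point p (induced_edges S) x y"
proof -
  define E :: "'n edge set" where E: "E = induced_edges (neighbourhood D)"
  define E1 where E1: "E1 = E \<inter> induced_edges S"
  define E2 where E2: "E2 = E \<inter> induced_edges (- S)"
  define E3 where E3: "E3 = E - E1 - E2"
  define g where "g = (\<lambda>F. of_bool (\<forall>v\<in>D - S. exits D v F) :: real)"
  have fin: "finite E"
    unfolding E using D by (intro finite_induced_edges finite_neighbourhood)
  note trap = trapped_eq_iff[OF S(1) _ E E1 E2 E3]
  have E1_eq: "E1 = induced_edges S"
    using S by (auto simp: E1 E induced_edges_def neighbourhood_def)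
  have "fk_prob 2 p E (\<lambda>F. trapped D F = S \<and> joined F x y)
      = fk_ex 2 p E (\<lambda>F. of_bool (F \<inter> E3 = {}) * of_bool (joined (F \<inter> E1) x y) * g (F \<inter> E2))"
    using trap S(2) by (intro fk_ex_cong) (auto simp: g_def of_bool_def)
  also have "\<dots> = two_point p E1 x y * fk_ex 2 p E (\<lambda>F. of_bool (F \<inter> E3 = {}) * g (F \<inter> E2))"
    unfolding two_point_def by (rule domain_markov[OF fin p _ E1 E2 E3]) simp
  also have "fk_ex 2 p E (\<lambda>F. of_bool (F \<inter> E3 = {}) * g (F \<inter> E2)) = fk_prob 2 p E (\<lambda>F. trapped D F = S)"
    using trap by (intro fk_ex_cong) (auto simp: g_def of_bool_def)
  finally show ?thesis
    by (simp add: E1_eq E)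
qed

text \<open>
  The pivotal edges found around the trapped region \<open>S\<close> are averaged first over the configuration inside
  \<open>S\<close>, which has the free law, and then over \<open>S\<close>. The events that the trapped region is a given \<open>S\<close>
  containing \<open>x\<close> partition the event that \<open>x\<close> does not exit.
\<close>

lemma expected_pivotal_ge:
  fixes D :: "(int ^ ('n::finite)) set"
  assumes D: "finite D" "x \<in> D" and p: "0 \<le> p" "p \<le> 1"
    and K: "\<And>S. S \<subseteq> D \<Longrightarrow> x \<in> S \<Longrightarrow> K \<le> (\<Sum>(a, b)\<in>edge_boundary S. two_point p (induced_edges S) x a)"
  shows "K * (1 - fk_prob 2 p (induced_edges (neighbourhood D)) (exits D x))
    \<le> fk_ex 2 p (induced_edges (neighbourhood D))
        (\<lambda>F. real (card {e \<in> induced_edges (neighbourhood D). exits D x (insert e F) \<and> \<not> exits D x F}))"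
proof -
  define E :: "'n edge set" where "E = induced_edges (neighbourhood D)"
  have fin: "finite E"
    unfolding E_def using D by (intro finite_induced_edges finite_neighbourhood)
  define \<S> where "\<S> = {S. S \<subseteq> D \<and> x \<in> S}"
  have fin_S: "finite \<S>"
    using D by (auto simp: \<S>_def)
  have trapped_in: "trapped D F \<in> \<S> \<longleftrightarrow> \<not> exits D x F" for F
    using D by (auto simp: trapped_def \<S>_def)
  have "K * (1 - fk_prob 2 p E (exits D x)) = K * fk_prob 2 p E (\<lambda>F. \<not> exits D x F)"
    using fin p by (simp add: fk_prob_not)
  also have "fk_prob 2 p E (\<lambda>F. \<not> exits D x F) = (\<Sum>S\<in>\<S>. fk_prob 2 p E (\<lambda>F. trapped D F = S))"
    unfolding fk_ex_sum[symmetric] trapped_in[symmetric] using fin_S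
    by (intro fk_ex_cong) (simp add: of_bool_def)
  also have "K * \<dots> \<le> (\<Sum>S\<in>\<S>. fk_prob 2 p E (\<lambda>F. trapped D F = S) *
      (\<Sum>(a, b)\<in>edge_boundary S. two_point p (induced_edges S) x a))"
    using fin p K unfolding mult.commute[of K] sum_distrib_right
    by (intro sum_mono mult_left_mono fk_prob_bounds) (auto simp: \<S>_def)
  also have "\<dots> = (\<Sum>S\<in>\<S>. \<Sum>(a, b)\<in>edge_boundary S. fk_prob 2 p E (\<lambda>F. trapped D F = S \<and> joined F x a))"
    using D(1) p unfolding sum_distrib_left E_def
    by (intro sum.cong refl) (auto simp: \<S>_def trapped_domain_markov)
  also have "\<dots> = fk_ex 2 p E (\<lambda>F. \<Sum>S\<in>\<S>. \<Sum>(a, b)\<in>edge_boundary S. of_bool (trapped D F = S \<and> joined F x a))"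
    unfolding fk_ex_sum case_prod_unfold ..
  also have "\<dots> \<le> fk_ex 2 p E (\<lambda>F. real (card {e \<in> E. exits D x (insert e F) \<and> \<not> exits D x F}))"
  proof (rule fk_ex_mono[OF fin p])
    fix F assume F: "F \<subseteq> E"
    have "(\<Sum>S\<in>\<S>. \<Sum>(a, b)\<in>edge_boundary S. of_bool (trapped D F = S \<and> joined F x a))
        = (\<Sum>S\<in>\<S>. if S = trapped D F then \<Sum>(a, b)\<in>edge_boundary S. of_bool (joined F x a) else (0::real))"
      by (intro sum.cong) auto
    also have "\<dots> = (if exits D x F then 0 else \<Sum>(a, b)\<in>edge_boundary (trapped D F). of_bool (joined F x a))"
      using fin_S trapped_in by auto
    also have "\<dots> \<le> real (card {e \<in> E. exits D x (insert e F) \<and> \<not> exits D x F})"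
      using card_pivotal_ge[OF D, of F] F unfolding E_def by auto
    finally show "(\<Sum>S\<in>\<S>. \<Sum>(a, b)\<in>edge_boundary S. of_bool (trapped D F = S \<and> joined F x a))
      \<le> real (card {e \<in> E. exits D x (insert e F) \<and> \<not> exits D x F})" .
  qed simp
  finally show ?thesis
    unfolding E_def .
qed

text \<open>
  The lower bound \<open>p / (2 - p)\<close> for the probability that an edge is open cancels against the lower bound
  \<open>(2 - p) / p\<close> for the boundary sums. What is left is \<open>\<theta>' \<ge> (1 - \<theta>) / (p * (1 - p))\<close>, more than enough
  for \<open>p * (1 - \<theta> p)\<close> to be nonincreasing on \<open>{p0..p1}\<close>. The derivative is needed in the open interval
  only, which covers \<open>p1 = 1\<close>, where the weights degenerate.
\<close>

theorem exit_probability_ge: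
  fixes D :: "(int ^ ('n::finite)) set"
  assumes D: "finite D" "x \<in> D" and p0: "0 \<le> p0" "p0 < p1" "p1 \<le> 1"
    and K: "\<And>p S. p0 < p \<Longrightarrow> p < 1 \<Longrightarrow> S \<subseteq> D \<Longrightarrow> x \<in> S \<Longrightarrow>
      1 \<le> p / (2 - p) * (\<Sum>(a, b)\<in>edge_boundary S. two_point p (induced_edges S) x a)"
  shows "(p1 - p0) / p1 \<le> fk_prob 2 p1 (induced_edges (neighbourhood D)) (exits D x)"
proof -
  define E :: "'n edge set" where "E = induced_edges (neighbourhood D)"
  have fin: "finite E"
    unfolding E_def using D by (intro finite_induced_edges finite_neighbourhood)
  define \<theta> where "\<theta> = (\<lambda>p. fk_prob 2 p E (exits D x))"
  have "p0 * (1 - \<theta> p0) \<ge> p1 * (1 - \<theta> p1)"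
  proof (rule DERIV_nonpos_imp_decreasing_open[where f = "\<lambda>p. p * (1 - \<theta> p)"])
    show "p0 \<le> p1"
      using p0 by simp
    have "continuous_on {p0..p1} \<theta>"
      unfolding \<theta>_def using continuous_fk_ex[OF fin, of 2] p0 by (rule_tac continuous_on_subset) auto
    then show "continuous_on {p0..p1} (\<lambda>p. p * (1 - \<theta> p))"
      by (intro continuous_intros)
  next
    fix p assume p: "p0 < p" "p < p1"
    then have p01: "0 < p" "p < 1"
      using p0 by auto
    define Y where "Y = fk_ex 2 p E (\<lambda>F. real (card {e \<in> E. exits D x (insert e F) \<and> \<not> exits D x F}))"
    obtain \<theta>' where d: "(\<theta> has_real_derivative \<theta>') (at p)"
      and \<theta>': "1 / ((p + 2 * (1 - p)) * (1 - p)) * Y \<le> \<theta>'"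
      unfolding \<theta>_def Y_def using derivative_ge_pivotal[OF fin p01, of 2 "exits D x"] mono_exits by auto
    have \<theta>_le: "0 \<le> 1 - \<theta> p"
      unfolding \<theta>_def using fk_prob_bounds[OF fin, of p 2] p01 by simp
    have "(2 - p) / p * (1 - \<theta> p) \<le> Y"
      unfolding \<theta>_def Y_def E_def
    proof (rule expected_pivotal_ge[OF D])
      fix S assume "S \<subseteq> D" "x \<in> S"
      then show "(2 - p) / p \<le> (\<Sum>(a, b)\<in>edge_boundary S. two_point p (induced_edges S) x a)"
        using K[of p S] p p01 p0 by (simp add: field_simps)
    qed (use p01 in auto)
    then have "(2 - p) * (1 - \<theta> p) \<le> p * Y"
      using p01 by (simp add: field_simps)
    moreover have "Y \<le> (2 - p) * (1 - p) * \<theta>'"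
    proof -
      have "p + 2 * (1 - p) = 2 - p" "0 < (2 - p) * (1 - p)"
        using p01 by auto
      then show ?thesis
        using \<theta>' by (simp add: pos_divide_le_eq mult.commute)
    qed
    ultimately have "(2 - p) * (1 - \<theta> p) \<le> p * ((2 - p) * (1 - p) * \<theta>')"
      using p01 by (meson less_imp_le mult_left_mono order_trans)
    then have "(2 - p) * (1 - \<theta> p) \<le> (2 - p) * ((1 - p) * (p * \<theta>'))"
      by (simp add: mult.assoc mult.left_commute)
    then have *: "1 - \<theta> p \<le> (1 - p) * (p * \<theta>')"
      using p01 by simp
    then have "0 \<le> p * \<theta>'"
      using \<theta>_le p01 by (smt (verit) mult_pos_neg)
    then have "(1 - p) * (p * \<theta>') \<le> 1 * (p * \<theta>')"
      using p01 by (intro mult_right_mono) auto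
    with * have "1 - \<theta> p - p * \<theta>' \<le> 0"
      by simp
    moreover have "((\<lambda>p. p * (1 - \<theta> p)) has_real_derivative (1 - \<theta> p - p * \<theta>')) (at p)"
      by (auto intro!: derivative_eq_intros d)
    ultimately show "\<exists>y. ((\<lambda>p. p * (1 - \<theta> p)) has_real_derivative y) (at p) \<and> y \<le> 0"
      by blast
  qed
  also have "p0 * (1 - \<theta> p0) \<le> p0 * 1"
    unfolding \<theta>_def using fk_prob_bounds(1)[OF fin, of p0 2] p0 by (intro mult_left_mono) auto
  finally have "p1 - p0 \<le> p1 * \<theta> p1"
    by (simp add: algebra_simps)
  then show ?thesis
    using p0 by (simp add: \<theta>_def E_def field_simps)
qed

section \<open>The critical parameter\<close>

lemma rc_phi_eq:
  assumes S: "finite S" and p: "0 \<le> p" "p \<le> 1"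
  shows "rc_phi 2 p S = p * (\<Sum>(a, b)\<in>edge_boundary S. two_point p (induced_edges S) 0 a)"
  unfolding rc_phi_def using prob_rc_measure[OF S p, of 2]
  by (simp add: two_point_def joined_def)

lemma polynomial_times_exp_tendsto_0:
  fixes c :: real
  assumes c: "0 < c"
  shows "(\<lambda>m. real (2 * m + 3) ^ k * exp (- c * real m)) \<longlonglongrightarrow> 0"
proof (rule tendsto_sandwich[where f = "\<lambda>_. 0"
      and h = "\<lambda>m. (5 / c) ^ k * ((c * real m) ^ k / exp (c * real m))"])
  have "filterlim (\<lambda>m. c * real m) at_top sequentially"
    using c by (intro filterlim_tendsto_pos_mult_at_top[OF tendsto_const] filterlim_real_sequentially)
  then have "(\<lambda>m. (c * real m) ^ k / exp (c * real m)) \<longlonglongrightarrow> 0"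
    by (rule filterlim_compose[OF tendsto_power_div_exp_0])
  then show "(\<lambda>m. (5 / c) ^ k * ((c * real m) ^ k / exp (c * real m))) \<longlonglongrightarrow> 0"
    by (intro tendsto_mult_right_zero)
  show "\<forall>\<^sub>F m in sequentially. real (2 * m + 3) ^ k * exp (- c * real m)
      \<le> (5 / c) ^ k * ((c * real m) ^ k / exp (c * real m))"
    using eventually_ge_at_top[of 1]
  proof eventually_elim
    case (elim m)
    then have "real (2 * m + 3) ^ k \<le> (5 / c * (c * real m)) ^ k"
      using c by (intro power_mono) auto
    then have "real (2 * m + 3) ^ k * exp (- c * real m) \<le> (5 / c * (c * real m)) ^ k * exp (- c * real m)"
      by (intro mult_right_mono) auto
    then show ?case
      unfolding power_mult_distrib[of "5 / c"] by (simp add: exp_minus divide_inverse mult.assoc)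
  qed
qed auto

lemma pc_tilde_ge:
  fixes S :: "(int ^ ('n::finite)) set"
  assumes "0 \<le> p" "p \<le> 1" "finite S" "0 \<in> S" "rc_phi q p S < 1"
  shows "p \<le> pc_tilde TYPE('n) q"
  unfolding pc_tilde_def
  by (rule cSup_upper) (use assms in \<open>auto intro: bdd_aboveI[of _ 1]\<close>)

lemma pc_tilde_nonneg: "0 \<le> pc_tilde TYPE('n::finite) q"
  by (rule pc_tilde_ge[of 0 "{0}"]) (auto simp: rc_phi_def)

text \<open>
  The factor \<open>p / (2 - p)\<close> is smaller than the factor \<open>p\<close> in the definition of the critical parameter, so
  this is not the negation of that definition. If it failed for some \<open>S\<close>, exponential decay would follow,
  and on large balls it beats any constant factor, so the ball would put \<open>p\<close> below the critical
  parameter.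
\<close>

lemma boundary_sum_ge_1_above_pc_tilde:
  fixes S :: "(int ^ ('n::finite)) set"
  assumes p: "0 \<le> p" "p < 1" "pc_tilde TYPE('n) 2 < p" and S: "finite S" "0 \<in> S"
  shows "1 \<le> p / (2 - p) * (\<Sum>(a, b)\<in>edge_boundary S. two_point p (induced_edges S) 0 a)"
proof (rule ccontr)
  assume "\<not> ?thesis"
  then obtain c where c: "0 < c"
    and decay: "\<And>(E :: 'n edge set) x. finite E \<Longrightarrow> two_point p E 0 x \<le> exp (- c * real (l1 x))"
    using exponential_decay[OF p(1,2) S] by (metis not_le)
  define k where "k = CARD('n) + CARD('n)"
  have "\<forall>\<^sub>F m in sequentially. real (2 * m + 3) ^ k * exp (- c * real m) < 1"
    using polynomial_times_exp_tendsto_0[OF c] by (rule order_tendstoD) simp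
  then obtain m where m: "real (2 * m + 3) ^ k * exp (- c * real m) < 1"
    by (auto simp: eventually_sequentially)
  define T where "T = {x :: int ^ 'n. l1 x \<le> m}"
  have T: "finite T" "0 \<in> T"
    by (simp_all add: T_def l1_ball_finite)
  have sub: "edge_boundary T \<subseteq> {x. l1 x \<le> m} \<times> {x. l1 x \<le> m + 1}"
    by (auto simp: edge_boundary_def T_def dest!: nearest_l1_le)
  have "card (edge_boundary T) \<le> card ({x :: int ^ 'n. l1 x \<le> m} \<times> {x :: int ^ 'n. l1 x \<le> m + 1})"
    using sub by (intro card_mono) (auto intro: l1_ball_finite)
  also have "\<dots> \<le> (2 * m + 1) ^ CARD('n) * (2 * (m + 1) + 1) ^ CARD('n)"
    unfolding card_cartesian_product by (intro mult_le_mono l1_ball_card)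
  also have "\<dots> \<le> (2 * m + 3) ^ CARD('n) * (2 * m + 3) ^ CARD('n)"
    by (intro mult_le_mono power_mono) auto
  also have "\<dots> = (2 * m + 3) ^ k"
    by (simp add: k_def power_add)
  finally have card: "real (card (edge_boundary T)) \<le> real (2 * m + 3) ^ k"
    by (metis of_nat_mono of_nat_power)
  have "(\<Sum>(a, b)\<in>edge_boundary T. two_point p (induced_edges T) 0 a)
      \<le> (\<Sum>(a, b)\<in>edge_boundary T. exp (- c * real m))"
  proof (intro sum_mono, clarify)
    fix a b assume "(a, b) \<in> edge_boundary T"
    then have "l1 a = m"
      using nearest_l1_le[of a b] by (auto simp: edge_boundary_def T_def)
    then show "two_point p (induced_edges T) 0 a \<le> exp (- c * real m)"
      using decay[of "induced_edges T" a] T by (simp add: finite_induced_edges)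
  qed
  also have "\<dots> = real (card (edge_boundary T)) * exp (- c * real m)"
    by (simp add: case_prod_unfold)
  also have "\<dots> \<le> real (2 * m + 3) ^ k * exp (- c * real m)"
    using card by (intro mult_right_mono) auto
  also note m
  finally have "p * (\<Sum>(a, b)\<in>edge_boundary T. two_point p (induced_edges T) 0 a) < 1"
    using p by (smt (verit) mult_left_le_one_le mult_nonneg_nonpos)
  then have "p \<le> pc_tilde TYPE('n) 2"
    using p T by (intro pc_tilde_ge[of p T]) (auto simp: rc_phi_eq)
  with p show False by simp
qed

corollary exit_probability_ge_pc_tilde:
  fixes D :: "(int ^ ('n::finite)) set"
  assumes D: "finite D" "0 \<in> D" and p: "pc_tilde TYPE('n) 2 < p" "p \<le> 1"
  shows "(p - pc_tilde TYPE('n) 2) / p \<le> fk_prob 2 p (induced_edges (neighbourhood D)) (exits D 0)"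
proof (rule exit_probability_ge[OF D pc_tilde_nonneg p])
  fix p' S assume "pc_tilde TYPE('n) 2 < p'" "p' < 1" "S \<subseteq> D" "0 \<in> S"
  then show "1 \<le> p' / (2 - p') * (\<Sum>(a, b)\<in>edge_boundary S. two_point p' (induced_edges S) 0 a)"
    using pc_tilde_nonneg[where 'n = 'n, of 2] D
    by (intro boundary_sum_ge_1_above_pc_tilde) (auto intro: finite_subset)
qed

text \<open>
  Being below the supremum provides a set \<open>S\<close> for some larger parameter \<open>p'\<close>. The same \<open>S\<close> serves for \<open>p\<close>
  because two-point functions increase with the parameter.
\<close>

corollary exponential_decay_below_pc_tilde:
  assumes p: "0 \<le> p" "p < pc_tilde TYPE('n::finite) 2"
  obtains c where "0 < c"
    and "\<And>(E :: 'n edge set) x. finite E \<Longrightarrow> two_point p E 0 x \<le> exp (- c * real (l1 x))"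
proof -
  let ?X = "{p \<in> {0..1}. \<exists>S :: (int ^ 'n) set. finite S \<and> 0 \<in> S \<and> rc_phi 2 p S < 1}"
  have "0 \<in> ?X"
    by (auto simp: rc_phi_def intro!: exI[of _ "{0}"])
  then obtain p' where p': "p' \<in> ?X" "p < p'"
    using p less_cSupD[of ?X p] unfolding pc_tilde_def by blast
  then obtain S :: "(int ^ 'n) set" where S: "finite S" "0 \<in> S" "rc_phi 2 p' S < 1"
    by auto
  note fin = finite_induced_edges[OF S(1)]
  have p'1: "p' \<le> 1"
    using p' by simp
  have "p / (2 - p) * (\<Sum>(a, b)\<in>edge_boundary S. two_point p (induced_edges S) 0 a)
      \<le> p' * (\<Sum>(a, b)\<in>edge_boundary S. two_point p' (induced_edges S) 0 a)"
  proof (intro mult_mono)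
    have "p / (2 - p) \<le> p / 1"
      using p p' p'1 by (intro divide_left_mono) auto
    then show "p / (2 - p) \<le> p'"
      using p' by simp
    show "(\<Sum>(a, b)\<in>edge_boundary S. two_point p (induced_edges S) 0 a)
      \<le> (\<Sum>(a, b)\<in>edge_boundary S. two_point p' (induced_edges S) 0 a)"
      using fin p p' p'1 by (intro sum_mono) (auto intro!: two_point_mono)
    show "0 \<le> (\<Sum>(a, b)\<in>edge_boundary S. two_point p (induced_edges S) 0 a)"
      using fin p p' p'1 by (intro sum_nonneg) (auto simp: two_point_bounds)
  qed (use p p' in auto)
  also have "\<dots> < 1"
    using S p' by (simp add: rc_phi_eq)
  finally have "p / (2 - p) * (\<Sum>(a, b)\<in>edge_boundary S. two_point p (induced_edges S) 0 a) < 1" .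
  then show ?thesis
    using exponential_decay[OF p(1) _ S(1,2)] p' p'1 that by (metis less_le_trans)
qed

section \<open>Random Boolean functions with given marginals\<close>

abbreviation bool_product :: "('i \<Rightarrow> bool) measure" where
  "bool_product \<equiv> \<Pi>\<^sub>M e\<in>UNIV. count_space UNIV"

lemma space_bool_product [simp]: "space bool_product = UNIV"
  by (simp add: space_PiM)

text \<open>
  An event that depends on finitely many coordinates is a finite union of atoms.
\<close>

lemma sets_cylinder:
  assumes J: "finite J" and Y: "\<And>\<omega> \<omega>'. (\<forall>e\<in>J. \<omega> e = \<omega>' e) \<Longrightarrow> Y \<omega> \<Longrightarrow> Y \<omega>'"
  shows "{\<omega>. Y \<omega>} \<in> sets bool_product"
proof -
  have "{\<omega>. Y \<omega>} = (\<Union>K\<in>{K \<in> Pow J. Y (\<lambda>e. e \<in> K)}. {\<omega>. \<forall>e\<in>J. \<omega> e = (e \<in> K)})"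
  proof (intro set_eqI iffI)
    fix \<omega> assume "\<omega> \<in> {\<omega>. Y \<omega>}"
    then have "{e \<in> J. \<omega> e} \<in> {K \<in> Pow J. Y (\<lambda>e. e \<in> K)}"
      using Y[of \<omega> "\<lambda>e. e \<in> {e \<in> J. \<omega> e}"] by auto
    then show "\<omega> \<in> (\<Union>K\<in>{K \<in> Pow J. Y (\<lambda>e. e \<in> K)}. {\<omega>. \<forall>e\<in>J. \<omega> e = (e \<in> K)})"
      by blast
  next
    fix \<omega> assume "\<omega> \<in> (\<Union>K\<in>{K \<in> Pow J. Y (\<lambda>e. e \<in> K)}. {\<omega>. \<forall>e\<in>J. \<omega> e = (e \<in> K)})"
    then obtain K where "Y (\<lambda>e. e \<in> K)" "\<forall>e\<in>J. \<omega> e = (e \<in> K)"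
      by auto
    then show "\<omega> \<in> {\<omega>. Y \<omega>}"
      using Y[of "\<lambda>e. e \<in> K" \<omega>] by simp
  qed
  moreover have "{\<omega>. \<forall>e\<in>J. \<omega> e = (e \<in> K)} \<in> sets bool_product" for K
  proof -
    have "{\<omega> \<in> space bool_product. \<forall>e\<in>J. \<omega> e = (e \<in> K)} \<in> sets bool_product"
      using J by measurable
    then show ?thesis
      by simp
  qed
  ultimately show ?thesis
    using J by (auto intro!: sets.finite_UN)
qed

text \<open>
  Here \<open>m J K\<close> is the prescribed probability that \<open>K\<close> is the set of true coordinates among \<open>J\<close>. The
  projective limit theorem for Polish spaces is applied to the real values 0 and 1, and the result is
  mapped back by \<open>\<pi>\<close>, which treats every other real number as false.
\<close>

theorem kolmogorov_extension_bool:
  fixes m :: "'i set \<Rightarrow> 'i set \<Rightarrow> real"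
  assumes nonneg: "\<And>J K. finite J \<Longrightarrow> K \<subseteq> J \<Longrightarrow> 0 \<le> m J K"
    and total: "\<And>J. finite J \<Longrightarrow> (\<Sum>K\<in>Pow J. m J K) = 1"
    and consistent: "\<And>H J K. finite H \<Longrightarrow> J \<subseteq> H \<Longrightarrow> K \<subseteq> J \<Longrightarrow> (\<Sum>K'\<in>{K' \<in> Pow H. K' \<inter> J = K}. m H K') = m J K"
  obtains M where "prob_space M" "sets M = sets bool_product"
    "\<And>J K. finite J \<Longrightarrow> K \<subseteq> J \<Longrightarrow> measure M {\<omega>. \<forall>e\<in>J. \<omega> e = (e \<in> K)} = m J K"
proof -
  define N where "N = (\<lambda>J. point_measure (Pow J) (\<lambda>K. ennreal (m J K)))"
  define \<iota> where "\<iota> = (\<lambda>(J :: 'i set) K. \<lambda>e\<in>J. indicator K e :: real)"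
  define P where "P = (\<lambda>J. distr (N J) (\<Pi>\<^sub>M e\<in>J. borel) (\<iota> J))"
  have \<iota>: "\<iota> J \<in> N J \<rightarrow>\<^sub>M (\<Pi>\<^sub>M e\<in>J. borel)" for J
    by (simp add: N_def \<iota>_def space_PiM)
  have N_emeasure: "emeasure (N J) A = ennreal (\<Sum>K\<in>A. m J K)" if "finite J" "A \<subseteq> Pow J" for J A
  proof -
    have "emeasure (N J) A = (\<Sum>K\<in>A. ennreal (m J K))"
      unfolding N_def using that by (intro emeasure_point_measure_finite) auto
    also have "\<dots> = ennreal (\<Sum>K\<in>A. m J K)"
      using that nonneg[of J] by (intro sum_ennreal) auto
    finally show ?thesis .
  qed
  have N_prob: "prob_space (N J)" if "finite J" for J
    using N_emeasure[OF that, of "Pow J"] total[OF that]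
    by (intro prob_spaceI) (simp add: N_def space_point_measure)
  have N_restrict: "distr (N H) (N J) (\<lambda>K. K \<inter> J) = N J" if "finite H" "J \<subseteq> H" for H J
  proof (rule measure_eqI)
    have J: "finite J"
      using that finite_subset by blast
    fix A assume "A \<in> sets (distr (N H) (N J) (\<lambda>K. K \<inter> J))"
    then have A: "A \<subseteq> Pow J"
      by (simp add: N_def sets_point_measure)
    have meas: "(\<lambda>K. K \<inter> J) \<in> N H \<rightarrow>\<^sub>M N J"
      using J that by (auto simp: N_def space_point_measure)
    have "emeasure (distr (N H) (N J) (\<lambda>K. K \<inter> J)) A = emeasure (N H) ((\<lambda>K. K \<inter> J) -` A \<inter> space (N H))"
      using meas A by (intro emeasure_distr) (auto simp: N_def sets_point_measure)
    also have "(\<lambda>K. K \<inter> J) -` A \<inter> space (N H) = {K' \<in> Pow H. K' \<inter> J \<in> A}"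
      by (auto simp: N_def space_point_measure)
    also have "emeasure (N H) \<dots> = ennreal (\<Sum>K'\<in>{K' \<in> Pow H. K' \<inter> J \<in> A}. m H K')"
      using that by (intro N_emeasure) auto
    also have "(\<Sum>K'\<in>{K' \<in> Pow H. K' \<inter> J \<in> A}. m H K') = (\<Sum>K\<in>A. \<Sum>K'\<in>{K' \<in> {K' \<in> Pow H. K' \<inter> J \<in> A}. K' \<inter> J = K}. m H K')"
      using that A J by (intro sum.group[symmetric]) (auto intro: finite_subset)
    also have "\<dots> = (\<Sum>K\<in>A. m J K)"
    proof (intro sum.cong refl)
      fix K assume "K \<in> A"
      then have "{K' \<in> {K' \<in> Pow H. K' \<inter> J \<in> A}. K' \<inter> J = K} = {K' \<in> Pow H. K' \<inter> J = K}"
        by auto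
      then show "(\<Sum>K'\<in>{K' \<in> {K' \<in> Pow H. K' \<inter> J \<in> A}. K' \<inter> J = K}. m H K') = m J K"
        using consistent[OF that, of K] A \<open>K \<in> A\<close> by auto
    qed
    also have "ennreal (\<Sum>K\<in>A. m J K) = emeasure (N J) A"
      using N_emeasure[OF J A] by simp
    finally show "emeasure (distr (N H) (N J) (\<lambda>K. K \<inter> J)) A = emeasure (N J) A" .
  qed simp
  interpret polish_projective "UNIV :: 'i set" P
  proof (intro polish_projective.intro projective_family.intro)
    fix J H :: "'i set" assume JH: "J \<subseteq> H" "finite H"
    have meas: "(\<lambda>K. K \<inter> J) \<in> N H \<rightarrow>\<^sub>M N J"
      using JH by (auto simp: N_def space_point_measure intro: finite_subset)
    have restr: "(\<lambda>f. restrict f J) \<in> (\<Pi>\<^sub>M e\<in>H. borel) \<rightarrow>\<^sub>M (\<Pi>\<^sub>M e\<in>J. (borel :: real measure))"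
      using JH by (intro measurable_restrict_subset)
    have "distr (P H) (\<Pi>\<^sub>M e\<in>J. borel) (\<lambda>f. restrict f J)
        = distr (N H) (\<Pi>\<^sub>M e\<in>J. borel) (\<lambda>K. restrict (\<iota> H K) J)"
      unfolding P_def by (subst distr_distr[OF restr \<iota>]) (simp add: o_def)
    also have "\<dots> = distr (N H) (\<Pi>\<^sub>M e\<in>J. borel) (\<iota> J \<circ> (\<lambda>K. K \<inter> J))"
      using JH by (intro distr_cong) (auto simp: \<iota>_def fun_eq_iff restrict_def indicator_def)
    also have "\<dots> = distr (distr (N H) (N J) (\<lambda>K. K \<inter> J)) (\<Pi>\<^sub>M e\<in>J. borel) (\<iota> J)"
      by (rule distr_distr[symmetric, OF \<iota> meas])
    also have "\<dots> = P J"
      using N_restrict[OF JH(2,1)] by (simp add: P_def)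
    finally show "P J = distr (P H) (\<Pi>\<^sub>M e\<in>J. borel) (\<lambda>f. restrict f J)" by simp
  next
    fix J :: "'i set" assume "finite J"
    then show "prob_space (P J)"
      unfolding P_def by (rule prob_space.prob_space_distr[OF N_prob \<iota>])
  qed
  define \<pi> where "\<pi> = (\<lambda>f :: 'i \<Rightarrow> real. \<lambda>e. f e = 1)"
  have sets_lim: "sets lim = sets (\<Pi>\<^sub>M e\<in>UNIV. borel)"
    by simp
  have \<pi>: "\<pi> \<in> lim \<rightarrow>\<^sub>M bool_product"
  proof -
    have "(\<lambda>f. \<lambda>e\<in>UNIV. f e = (1::real)) \<in> (\<Pi>\<^sub>M e\<in>(UNIV :: 'i set). borel) \<rightarrow>\<^sub>M bool_product"
      by (intro measurable_restrict) measurable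
    moreover have "(\<lambda>f. \<lambda>e\<in>UNIV. f e = 1) = \<pi>"
      by (simp add: \<pi>_def restrict_def)
    ultimately show ?thesis
      using sets_lim by (simp cong: measurable_cong_sets)
  qed
  define M where "M = distr lim bool_product \<pi>"
  have "measure M {\<omega>. \<forall>e\<in>J. \<omega> e = (e \<in> K)} = m J K" if J: "finite J" and K: "K \<subseteq> J" for J K
  proof -
    define X where "X = {f \<in> space (\<Pi>\<^sub>M e\<in>J. (borel :: real measure)). \<forall>e\<in>J. (f e = 1) = (e \<in> K)}"
    have X: "X \<in> sets (\<Pi>\<^sub>M e\<in>J. borel)"
      unfolding X_def using J by measurable
    have "measure M {\<omega>. \<forall>e\<in>J. \<omega> e = (e \<in> K)} = measure lim (\<pi> -` {\<omega>. \<forall>e\<in>J. \<omega> e = (e \<in> K)} \<inter> space lim)"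
      unfolding M_def by (intro measure_distr \<pi> sets_cylinder[OF J]) auto
    also have "\<pi> -` {\<omega>. \<forall>e\<in>J. \<omega> e = (e \<in> K)} \<inter> space lim = emb UNIV J X"
      by (auto simp: \<pi>_def X_def prod_emb_def space_PiM)
    also have "measure lim \<dots> = measure (P J) X"
      using J X by (intro measure_lim_emb) auto
    also have "\<dots> = measure (N J) (\<iota> J -` X \<inter> space (N J))"
      unfolding P_def by (intro measure_distr \<iota> X)
    also have "\<iota> J -` X \<inter> space (N J) = {K}"
      using K by (auto simp: \<iota>_def X_def N_def space_point_measure space_PiM indicator_def split: if_splits)
    also have "measure (N J) {K} = m J K"
      using N_emeasure[OF J, of "{K}"] nonneg[OF J K] K by (simp add: measure_def)
    finally show ?thesis .
  qed
  moreover have "prob_space M"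
    unfolding M_def by (rule P.prob_space_distr[OF \<pi>])
  ultimately show ?thesis
    using that[of M] by (simp add: M_def)
qed

section \<open>Continuous functions of infinitely many Boolean variables\<close>

lemma continuous_on_cylinder:
  fixes f :: "('i \<Rightarrow> bool) \<Rightarrow> 'b::topological_space"
  assumes J: "finite J" and f: "\<And>\<omega> \<omega>'. (\<forall>e\<in>J. \<omega> e = \<omega>' e) \<Longrightarrow> f \<omega> = f \<omega>'"
  shows "continuous_on UNIV f"
proof -
  have "open (f -` B)" for B
  proof (subst open_subopen, intro ballI)
    fix \<omega> assume \<omega>: "\<omega> \<in> f -` B"
    define X where "X = (\<lambda>e. if e \<in> J then {\<omega> e} else UNIV)"
    have "open (Pi\<^sub>E UNIV X)"
    proof (rule open_PiE)
      show "finite {e. X e \<noteq> UNIV}"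
        by (rule finite_subset[OF _ J]) (auto simp: X_def)
    qed (simp add: X_def Topological_Spaces.open_discrete)
    moreover have "\<omega> \<in> Pi\<^sub>E UNIV X"
      by (auto simp: X_def)
    moreover have "Pi\<^sub>E UNIV X \<subseteq> f -` B"
    proof
      fix \<omega>' assume "\<omega>' \<in> Pi\<^sub>E UNIV X"
      then have "\<forall>e\<in>J. \<omega>' e = \<omega> e"
        by (metis (no_types, lifting) PiE_E UNIV_I X_def singletonD)
      then show "\<omega>' \<in> f -` B"
        using f[of \<omega>' \<omega>] \<omega> by simp
    qed
    ultimately show "\<exists>T. open T \<and> \<omega> \<in> T \<and> T \<subseteq> f -` B"
      by blast
  qed
  then show ?thesis
    by (simp add: continuous_on_open_vimage)
qed

lemma compact_UNIV_bool_fun: "compact (UNIV :: ('i \<Rightarrow> bool) set)"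
proof -
  have "compact_space (product_topology (\<lambda>_. euclidean :: bool topology) (UNIV :: 'i set))"
    unfolding compact_space_product_topology by (auto simp: compact_space_def finite_imp_compact)
  then show ?thesis
    by (simp add: euclidean_product_topology compact_space_def)
qed

text \<open>
  Uniform continuity on the Cantor space: finitely many cylinders on which \<open>f\<close> varies by less than
  \<open>\<epsilon> / 2\<close> from its value at the centre cover the space, and \<open>J\<close> collects their coordinates.
\<close>

lemma continuous_approx_cylinder:
  fixes f :: "('i \<Rightarrow> bool) \<Rightarrow> real"
  assumes f: "continuous_on UNIV f" and \<epsilon>: "0 < \<epsilon>"
  obtains J where "finite J" "\<And>\<omega> \<omega>'. (\<forall>e\<in>J. \<omega> e = \<omega>' e) \<Longrightarrow> \<bar>f \<omega> - f \<omega>'\<bar> < \<epsilon>"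
proof -
  define cyl where "cyl = (\<lambda>\<omega> J. {\<omega>'. \<forall>e\<in>J. \<omega>' e = (\<omega> :: 'i \<Rightarrow> bool) e})"
  have "\<exists>J. finite J \<and> (\<forall>\<omega>'\<in>cyl \<omega> J. \<bar>f \<omega>' - f \<omega>\<bar> < \<epsilon> / 2)" for \<omega>
  proof -
    define U where "U = f -` ball (f \<omega>) (\<epsilon> / 2)"
    have "open U"
      unfolding U_def using f by (simp add: continuous_on_open_vimage)
    then have "openin (product_topology (\<lambda>_. euclidean) UNIV) U"
      by (simp add: euclidean_product_topology)
    moreover have "\<omega> \<in> U"
      using \<epsilon> by (simp add: U_def)
    ultimately obtain X where X: "\<omega> \<in> Pi\<^sub>E UNIV X" "finite {e. X e \<noteq> UNIV}" "Pi\<^sub>E UNIV X \<subseteq> U"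
      using product_topology_open_contains_basis[of "\<lambda>_. euclidean" UNIV U \<omega>] by auto
    have "\<omega>' \<in> U" if "\<omega>' \<in> cyl \<omega> {e. X e \<noteq> UNIV}" for \<omega>'
    proof -
      have "\<omega>' e \<in> X e" for e
        using that X(1) by (cases "X e = UNIV") (auto simp: cyl_def)
      then show ?thesis
        using X(3) by auto
    qed
    then show ?thesis
      using X(2) by (intro exI[of _ "{e. X e \<noteq> UNIV}"]) (auto simp: U_def dist_real_def abs_minus_commute)
  qed
  then obtain \<J> where \<J>: "\<And>\<omega>. finite (\<J> \<omega>)" "\<And>\<omega> \<omega>'. \<omega>' \<in> cyl \<omega> (\<J> \<omega>) \<Longrightarrow> \<bar>f \<omega>' - f \<omega>\<bar> < \<epsilon> / 2"
    by metis
  have op: "open (cyl \<omega> (\<J> \<omega>))" for \<omega>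
  proof -
    have "continuous_on UNIV (\<lambda>\<omega>'. \<omega>' \<in> cyl \<omega> (\<J> \<omega>))"
      by (rule continuous_on_cylinder[OF \<J>(1)[of \<omega>]]) (auto simp: cyl_def)
    then have "open ((\<lambda>\<omega>'. \<omega>' \<in> cyl \<omega> (\<J> \<omega>)) -` {True})"
      by (simp add: continuous_on_open_vimage Topological_Spaces.open_discrete)
    then show ?thesis
      by (simp add: vimage_def)
  qed
  obtain C where C: "finite C" "UNIV \<subseteq> (\<Union>\<omega>\<in>C. cyl \<omega> (\<J> \<omega>))"
    using compactE_image[OF compact_UNIV_bool_fun, of UNIV "\<lambda>\<omega>. cyl \<omega> (\<J> \<omega>)"] op
    by (auto simp: cyl_def)
  show ?thesis
  proof
    show "finite (\<Union>\<omega>\<in>C. \<J> \<omega>)"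
      using C \<J> by auto
    fix \<omega> \<omega>' :: "'i \<Rightarrow> bool" assume agree: "\<forall>e\<in>(\<Union>\<omega>\<in>C. \<J> \<omega>). \<omega> e = \<omega>' e"
    obtain c where c: "c \<in> C" "\<omega> \<in> cyl c (\<J> c)"
      using C by auto
    then have "\<omega>' \<in> cyl c (\<J> c)"
      using agree by (auto simp: cyl_def)
    with c show "\<bar>f \<omega> - f \<omega>'\<bar> < \<epsilon>"
      using \<J>(2)[of \<omega> c] \<J>(2)[of \<omega>' c] by linarith
  qed
qed

section \<open>The infinite-volume limit\<close>

lemma induced_edges_mono: "S \<subseteq> T \<Longrightarrow> induced_edges S \<subseteq> induced_edges T"
  by (auto simp: induced_edges_def)

text \<open>
  Probabilities of increasing events increase along the net of finite volumes.
\<close>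

lemma fk_prob_increasing_limit:
  fixes X :: "('n::finite) edge set \<Rightarrow> bool"
  assumes p: "0 \<le> p" "p \<le> 1" and q: "1 \<le> q" and X: "mono X"
  shows "\<exists>l. ((\<lambda>S. fk_prob q p (induced_edges S) X) \<longlongrightarrow> l) (finite_subsets_at_top UNIV)"
proof -
  let ?f = "\<lambda>S. fk_prob q p (induced_edges S) X"
  define l where "l = (SUP S\<in>Collect finite. ?f S)"
  have bdd: "bdd_above (?f ` Collect finite)"
    using p q by (auto intro!: bdd_aboveI2[of _ _ 1] fk_prob_bounds finite_induced_edges)
  have "(?f \<longlongrightarrow> l) (finite_subsets_at_top UNIV)"
  proof (rule increasing_tendsto)
    show "\<forall>\<^sub>F S in finite_subsets_at_top UNIV. ?f S \<le> l"
      unfolding l_def using bdd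
      by (intro eventually_finite_subsets_at_top_weakI cSUP_upper) auto
    fix y assume "y < l"
    then obtain S where S: "finite S" "y < ?f S"
      unfolding l_def using bdd by (subst (asm) less_cSUP_iff) auto
    show "\<forall>\<^sub>F S in finite_subsets_at_top UNIV. y < ?f S"
      unfolding eventually_finite_subsets_at_top
    proof (intro exI[of _ S] conjI allI impI)
      fix T assume T: "finite T \<and> S \<subseteq> T \<and> T \<subseteq> UNIV"
      then have "?f S \<le> ?f T"
        using p q X by (intro fk_prob_increasing finite_induced_edges induced_edges_mono) auto
      with S show "y < ?f T"
        by simp
    qed (use S in auto)
  qed
  then show ?thesis by blast
qed

text \<open>
  Prescribing a closed edge is a difference of two events with one closed edge less, so convergence
  reduces to increasing events.
\<close>

lemma fk_prob_pattern_limit: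
  fixes K :: "('n::finite) edge set"
  assumes p: "0 \<le> p" "p \<le> 1" and q: "1 \<le> q" and H: "finite H"
  shows "\<exists>l. ((\<lambda>S. fk_prob q p (induced_edges S) (\<lambda>F. K \<subseteq> F \<and> F \<inter> H = {})) \<longlongrightarrow> l)
    (finite_subsets_at_top UNIV)"
  using H
proof (induction H arbitrary: K rule: finite_induct)
  case empty
  show ?case
    using fk_prob_increasing_limit[OF p q, of "\<lambda>F. K \<subseteq> F"] by (auto simp: mono_def)
next
  case (insert h H)
  have "fk_prob q p E (\<lambda>F. K \<subseteq> F \<and> F \<inter> Set.insert h H = {}) =
    fk_prob q p E (\<lambda>F. K \<subseteq> F \<and> F \<inter> H = {}) - fk_prob q p E (\<lambda>F. Set.insert h K \<subseteq> F \<and> F \<inter> H = {})"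
    for E :: "'n edge set"
    unfolding fk_ex_diff[symmetric] by (intro fk_ex_cong) auto
  moreover obtain l1 l2 where
    "((\<lambda>S. fk_prob q p (induced_edges S) (\<lambda>F. K \<subseteq> F \<and> F \<inter> H = {})) \<longlongrightarrow> l1) (finite_subsets_at_top UNIV)"
    "((\<lambda>S. fk_prob q p (induced_edges S) (\<lambda>F. Set.insert h K \<subseteq> F \<and> F \<inter> H = {})) \<longlongrightarrow> l2) (finite_subsets_at_top UNIV)"
    using insert.IH by blast
  ultimately show ?case
    by (auto intro: tendsto_diff)
qed

lemma fk_prob_trace_limit:
  fixes J :: "('n::finite) edge set"
  assumes p: "0 \<le> p" "p \<le> 1" and q: "1 \<le> q" and J: "finite J" and K: "K \<subseteq> J"
  shows "\<exists>l. ((\<lambda>S. fk_prob q p (induced_edges S) (\<lambda>F. F \<inter> J = K)) \<longlongrightarrow> l) (finite_subsets_at_top UNIV)"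
proof -
  have "F \<inter> J = K \<longleftrightarrow> K \<subseteq> F \<and> F \<inter> (J - K) = {}" for F
    using K by auto
  then show ?thesis
    using fk_prob_pattern_limit[OF p q, of "J - K" K] J by simp
qed

lemma fk_ex_trace:
  assumes J: "finite J"
  shows "fk_ex q p E (\<lambda>F. f (F \<inter> J)) = (\<Sum>K\<in>Pow J. f K * fk_prob q p E (\<lambda>F. F \<inter> J = K))"
proof -
  have "fk_ex q p E (\<lambda>F. f (F \<inter> J)) = fk_ex q p E (\<lambda>F. \<Sum>K\<in>Pow J. f K * of_bool (F \<inter> J = K))"
    using J by (intro fk_ex_cong) (simp add: of_bool_def if_distrib[of "(*) _"] cong: if_cong)
  then show ?thesis
    by (simp add: fk_ex_sum fk_ex_cmult)
qed

text \<open>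
  Finite additivity passes to the limits of the marginals, which makes them consistent and of total
  mass one.
\<close>

lemma ex_marginal_limit:
  fixes p q :: real
  assumes p: "0 \<le> p" "p \<le> 1" and q: "1 \<le> q"
  obtains M :: "('n::finite) config measure" where "prob_space M" "sets M = sets bool_product"
    "\<And>J K. finite J \<Longrightarrow> K \<subseteq> J \<Longrightarrow>
      ((\<lambda>S. fk_prob q p (induced_edges S) (\<lambda>F. F \<inter> J = K)) \<longlongrightarrow> measure M {\<omega>. \<forall>e\<in>J. \<omega> e = (e \<in> K)})
        (finite_subsets_at_top UNIV)"
proof -
  let ?\<mu> = "\<lambda>S J K. fk_prob q p (induced_edges S :: 'n edge set) (\<lambda>F. F \<inter> J = K)"
  define m where "m = (\<lambda>J K. Lim (finite_subsets_at_top UNIV) (\<lambda>S. ?\<mu> S J K))"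
  have m: "((\<lambda>S. ?\<mu> S J K) \<longlongrightarrow> m J K) (finite_subsets_at_top UNIV)" if "finite J" "K \<subseteq> J" for J K
  proof -
    have "\<exists>l. ((\<lambda>S. ?\<mu> S J K) \<longlongrightarrow> l) (finite_subsets_at_top UNIV)"
      using fk_prob_trace_limit[OF p q that] .
    then obtain l where "((\<lambda>S. ?\<mu> S J K) \<longlongrightarrow> l) (finite_subsets_at_top UNIV)" ..
    moreover from this have "m J K = l"
      unfolding m_def by (intro tendsto_Lim) auto
    ultimately show ?thesis by simp
  qed
  have ev: "\<forall>\<^sub>F S in finite_subsets_at_top (UNIV :: (int ^ 'n) set). finite (induced_edges S)"
    by (intro eventually_finite_subsets_at_top_weakI finite_induced_edges)
  have "\<exists>M. prob_space M \<and> sets M = sets bool_product \<and>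
    (\<forall>J K. finite J \<longrightarrow> K \<subseteq> J \<longrightarrow> measure M {\<omega>. \<forall>e\<in>J. \<omega> e = (e \<in> K)} = m J K)"
  proof (rule kolmogorov_extension_bool[of m])
    fix J K :: "'n edge set" assume JK: "finite J" "K \<subseteq> J"
    show "0 \<le> m J K"
      using m[OF JK]
    proof (rule tendsto_lowerbound)
      show "\<forall>\<^sub>F S in finite_subsets_at_top UNIV. 0 \<le> ?\<mu> S J K"
        using ev by eventually_elim (use p q in \<open>simp add: fk_prob_bounds\<close>)
    qed simp
  next
    fix J :: "'n edge set" assume J: "finite J"
    have "((\<lambda>S. \<Sum>K\<in>Pow J. ?\<mu> S J K) \<longlongrightarrow> (\<Sum>K\<in>Pow J. m J K)) (finite_subsets_at_top UNIV)"
      using J by (intro tendsto_sum m) auto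
    moreover have "\<forall>\<^sub>F S in finite_subsets_at_top UNIV. (\<Sum>K\<in>Pow J. ?\<mu> S J K) = 1"
      using ev
    proof eventually_elim
      case (elim S)
      then show ?case
        using fk_ex_trace[OF J, of q p "induced_edges S" "\<lambda>_. 1"] p q by (simp add: fk_ex_const)
    qed
    ultimately have "((\<lambda>S. 1) \<longlongrightarrow> (\<Sum>K\<in>Pow J. m J K)) (finite_subsets_at_top (UNIV :: (int ^ 'n) set))"
      by (rule Lim_transform_eventually)
    then show "(\<Sum>K\<in>Pow J. m J K) = 1"
      using tendsto_unique[OF finite_subsets_at_top_neq_bot _ tendsto_const] by blast
  next
    fix H J K :: "'n edge set" assume *: "finite H" "J \<subseteq> H" "K \<subseteq> J"
    have J: "finite J"
      using * finite_subset by blast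
    have "((\<lambda>S. \<Sum>K'\<in>{K' \<in> Pow H. K' \<inter> J = K}. ?\<mu> S H K') \<longlongrightarrow> (\<Sum>K'\<in>{K' \<in> Pow H. K' \<inter> J = K}. m H K'))
        (finite_subsets_at_top UNIV)"
      using * by (intro tendsto_sum m) auto
    moreover have "(\<Sum>K'\<in>{K' \<in> Pow H. K' \<inter> J = K}. ?\<mu> S H K') = ?\<mu> S J K" for S
    proof -
      have "?\<mu> S J K = fk_ex q p (induced_edges S) (\<lambda>F. of_bool (F \<inter> H \<inter> J = K))"
        using * by (intro fk_ex_cong) (simp add: Int_assoc Int_absorb1)
      also have "\<dots> = (\<Sum>K'\<in>Pow H. of_bool (K' \<inter> J = K) * ?\<mu> S H K')"
        by (rule fk_ex_trace[OF *(1)])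
      also have "\<dots> = (\<Sum>K'\<in>{K' \<in> Pow H. K' \<inter> J = K}. ?\<mu> S H K')"
        using * by (intro sum.mono_neutral_cong_right) auto
      finally show ?thesis by simp
    qed
    ultimately have "((\<lambda>S. ?\<mu> S J K) \<longlongrightarrow> (\<Sum>K'\<in>{K' \<in> Pow H. K' \<inter> J = K}. m H K')) (finite_subsets_at_top UNIV)"
      by simp
    then show "(\<Sum>K'\<in>{K' \<in> Pow H. K' \<inter> J = K}. m H K') = m J K"
      using tendsto_unique[OF finite_subsets_at_top_neq_bot _ m[OF J *(3)]] by blast
  qed blast
  then obtain M where M: "prob_space M" "sets M = sets bool_product"
    "\<And>J K. finite J \<Longrightarrow> K \<subseteq> J \<Longrightarrow> measure M {\<omega>. \<forall>e\<in>J. \<omega> e = (e \<in> K)} = m J K"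
    by blast
  show ?thesis
  proof (rule that[OF M(1,2)])
    fix J K :: "'n edge set" assume JK: "finite J" "K \<subseteq> J"
    show "((\<lambda>S. ?\<mu> S J K) \<longlongrightarrow> measure M {\<omega>. \<forall>e\<in>J. \<omega> e = (e \<in> K)}) (finite_subsets_at_top UNIV)"
      using m[OF JK] M(3)[OF JK] by simp
  qed
qed

text \<open>
  A function of the coordinates in \<open>J\<close> takes finitely many values, so its integral is a finite sum over
  the traces \<open>K\<close> on \<open>J\<close>.
\<close>

lemma integral_trace:
  fixes M :: "('i \<Rightarrow> bool) measure" and f :: "('i \<Rightarrow> bool) \<Rightarrow> real"
  assumes M: "prob_space M" "sets M = sets bool_product" and J: "finite J"
  shows "(\<lambda>\<omega>. f (\<lambda>e. e \<in> J \<and> \<omega> e)) \<in> borel_measurable M"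
    and "(\<integral>\<omega>. f (\<lambda>e. e \<in> J \<and> \<omega> e) \<partial>M) = (\<Sum>K\<in>Pow J. f (\<lambda>e. e \<in> K) * measure M {\<omega>. \<forall>e\<in>J. \<omega> e = (e \<in> K)})"
proof -
  interpret prob_space M by fact
  define A where "A = (\<lambda>K. {\<omega> :: 'i \<Rightarrow> bool. \<forall>e\<in>J. \<omega> e = (e \<in> K)})"
  have A: "A K \<in> sets M" for K
    unfolding A_def M(2) by (rule sets_cylinder[OF J]) auto
  have eq: "f (\<lambda>e. e \<in> J \<and> \<omega> e) = (\<Sum>K\<in>Pow J. f (\<lambda>e. e \<in> K) * indicator (A K) \<omega>)" for \<omega>
  proof -
    have "indicator (A K) \<omega> = (if K = {e \<in> J. \<omega> e} then 1 else 0 :: real)" if "K \<in> Pow J" for K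
      using that by (auto simp: A_def indicator_def)
    then have "(\<Sum>K\<in>Pow J. f (\<lambda>e. e \<in> K) * indicator (A K) \<omega>)
        = (\<Sum>K\<in>Pow J. if K = {e \<in> J. \<omega> e} then f (\<lambda>e. e \<in> K) else 0)"
      by (intro sum.cong) auto
    also have "\<dots> = f (\<lambda>e. e \<in> {e \<in> J. \<omega> e})"
      using J by (subst sum.delta) auto
    finally show ?thesis by simp
  qed
  show "(\<lambda>\<omega>. f (\<lambda>e. e \<in> J \<and> \<omega> e)) \<in> borel_measurable M"
    unfolding eq using A by measurable
  have int: "integrable M (indicator (A K) :: _ \<Rightarrow> real)" for K
    using A by (intro integrable_const_bound[where B = 1]) auto
  have "A K \<inter> space M = A K" for K
    using A by (rule sets.Int_space_eq2)
  then show "(\<integral>\<omega>. f (\<lambda>e. e \<in> J \<and> \<omega> e) \<partial>M) = (\<Sum>K\<in>Pow J. f (\<lambda>e. e \<in> K) * measure M {\<omega>. \<forall>e\<in>J. \<omega> e = (e \<in> K)})"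
    unfolding eq using A int
    by (subst Bochner_Integration.integral_sum) (auto simp: A_def intro!: sum.cong)
qed

text \<open>
  Measurability refers to the product of the discrete coordinates, and \<open>f\<close> is a uniform limit of
  functions of finitely many of them.
\<close>

lemma borel_measurable_continuous_bool_product:
  fixes f :: "('i \<Rightarrow> bool) \<Rightarrow> real"
  assumes M: "prob_space M" "sets M = sets bool_product" and f: "continuous_on UNIV f"
  shows "f \<in> borel_measurable M"
proof -
  have "\<exists>J. finite J \<and> (\<forall>\<omega> \<omega>'. (\<forall>e\<in>J. \<omega> e = \<omega>' e) \<longrightarrow> \<bar>f \<omega> - f \<omega>'\<bar> < 1 / real (Suc n))" for n
    using continuous_approx_cylinder[OF f, of "1 / real (Suc n)"] by (metis of_nat_0_less_iff zero_less_Suc zero_less_divide_1_iff)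
  then obtain J where J: "\<And>n. finite (J n)"
    "\<And>n \<omega> \<omega>'. (\<forall>e\<in>J n. \<omega> e = \<omega>' e) \<Longrightarrow> \<bar>f \<omega> - f \<omega>'\<bar> < 1 / real (Suc n)"
    by metis
  show ?thesis
  proof (rule borel_measurable_LIMSEQ_real)
    fix \<omega>
    have "\<bar>f (\<lambda>e. e \<in> J n \<and> \<omega> e) - f \<omega>\<bar> \<le> 1 / real (Suc n)" for n
      using J(2)[of n "\<lambda>e. e \<in> J n \<and> \<omega> e" \<omega>] by (simp add: less_imp_le)
    note le = this
    show "(\<lambda>n. f (\<lambda>e. e \<in> J n \<and> \<omega> e)) \<longlonglongrightarrow> f \<omega>"
    proof (rule metric_tendsto_imp_tendsto[where f = "\<lambda>n. 1 / real (Suc n)" and a = 0, rotated])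
      show "\<forall>\<^sub>F n in sequentially. dist (f (\<lambda>e. e \<in> J n \<and> \<omega> e)) (f \<omega>) \<le> dist (1 / real (Suc n)) 0"
        using le by (simp add: dist_real_def)
      show "(\<lambda>n. 1 / real (Suc n)) \<longlonglongrightarrow> 0"
        using LIMSEQ_inverse_real_of_nat by (simp add: inverse_eq_divide)
    qed
    show "(\<lambda>\<omega>. f (\<lambda>e. e \<in> J n \<and> \<omega> e)) \<in> borel_measurable M" for n
      using integral_trace(1)[OF M J(1)] .
  qed
qed

text \<open>
  Closing all edges outside a large finite \<open>J\<close> changes \<open>f\<close> by at most \<open>\<epsilon> / 3\<close>, uniformly in the
  configuration and hence in every integral; the resulting function depends on finitely many edges,
  where convergence is known.
\<close>

lemma ex_rc_limit:
  fixes p q :: real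
  assumes p: "0 \<le> p" "p \<le> 1" and q: "1 \<le> q"
  shows "\<exists>M :: ('n::finite) config measure. is_rc_limit p q M"
proof -
  obtain M :: "'n config measure" where M: "prob_space M" "sets M = sets bool_product"
    and lim: "\<And>J K. finite J \<Longrightarrow> K \<subseteq> J \<Longrightarrow>
      ((\<lambda>S. fk_prob q p (induced_edges S) (\<lambda>F. F \<inter> J = K)) \<longlongrightarrow> measure M {\<omega>. \<forall>e\<in>J. \<omega> e = (e \<in> K)})
        (finite_subsets_at_top UNIV)"
    using ex_marginal_limit[OF p q] by blast
  interpret prob_space M by fact
  have "((\<lambda>S. \<integral>\<omega>. f \<omega> \<partial>rc_measure_on S p q) \<longlongrightarrow> (\<integral>\<omega>. f \<omega> \<partial>M)) (finite_subsets_at_top UNIV)"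
    if f: "continuous_on UNIV f" "bounded (range f)" for f :: "'n config \<Rightarrow> real"
  proof (rule tendstoI)
    fix \<epsilon> :: real assume "0 < \<epsilon>"
    then obtain J where J: "finite J"
      and close: "\<And>\<omega> \<omega>'. (\<forall>e\<in>J. \<omega> e = \<omega>' e) \<Longrightarrow> \<bar>f \<omega> - f \<omega>'\<bar> < \<epsilon> / 3"
      using continuous_approx_cylinder[OF f(1), of "\<epsilon> / 3"] by auto
    define g where "g = (\<lambda>\<omega>. f (\<lambda>e. e \<in> J \<and> \<omega> e))"
    have fg: "\<bar>f \<omega> - g \<omega>\<bar> \<le> \<epsilon> / 3" for \<omega>
      unfolding g_def using close[of \<omega> "\<lambda>e. e \<in> J \<and> \<omega> e"] by (simp add: less_imp_le)
    obtain b where b: "\<And>\<omega>. \<bar>f \<omega>\<bar> \<le> b"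
      using f(2) by (auto simp: bounded_iff)
    have int: "integrable M f" "integrable M g"
      using integral_trace(1)[OF M J, of f] borel_measurable_continuous_bool_product[OF M f(1)] b
      by (auto simp: g_def intro!: integrable_const_bound[where B = b])
    have fg_M: "\<bar>(\<integral>\<omega>. f \<omega> \<partial>M) - (\<integral>\<omega>. g \<omega> \<partial>M)\<bar> \<le> \<epsilon> / 3"
    proof -
      have "\<bar>\<integral>\<omega>. f \<omega> - g \<omega> \<partial>M\<bar> \<le> (\<integral>\<omega>. \<bar>f \<omega> - g \<omega>\<bar> \<partial>M)"
        by (rule integral_abs_bound)
      also have "\<dots> \<le> (\<integral>\<omega>. \<epsilon> / 3 \<partial>M)"
        using int fg by (intro integral_mono) auto
      finally show ?thesis
        using int by (simp add: prob_space)
    qed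
    have g_eq: "g (\<lambda>e. e \<in> F) = f (\<lambda>e. e \<in> F \<inter> J)" for F
      unfolding g_def by (rule arg_cong[of _ _ f]) auto
    have "((\<lambda>S. \<Sum>K\<in>Pow J. f (\<lambda>e. e \<in> K) * fk_prob q p (induced_edges S) (\<lambda>F. F \<inter> J = K))
        \<longlongrightarrow> (\<Sum>K\<in>Pow J. f (\<lambda>e. e \<in> K) * measure M {\<omega>. \<forall>e\<in>J. \<omega> e = (e \<in> K)})) (finite_subsets_at_top UNIV)"
      using J by (intro tendsto_sum tendsto_mult_left lim) auto
    then have "((\<lambda>S. fk_ex q p (induced_edges S) (\<lambda>F. g (\<lambda>e. e \<in> F))) \<longlongrightarrow> (\<integral>\<omega>. g \<omega> \<partial>M)) (finite_subsets_at_top UNIV)"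
      using fk_ex_trace[OF J, of q p _ "\<lambda>K. f (\<lambda>e. e \<in> K)"] integral_trace(2)[OF M J, of f]
      unfolding g_eq by (simp add: g_def)
    then have "\<forall>\<^sub>F S in finite_subsets_at_top UNIV.
        dist (fk_ex q p (induced_edges S) (\<lambda>F. g (\<lambda>e. e \<in> F))) (\<integral>\<omega>. g \<omega> \<partial>M) < \<epsilon> / 3"
      using \<open>0 < \<epsilon>\<close> by (intro tendstoD) auto
    moreover have "\<forall>\<^sub>F S in finite_subsets_at_top UNIV. finite (S :: (int ^ 'n) set)"
      by (intro eventually_finite_subsets_at_top_weakI)
    ultimately show "\<forall>\<^sub>F S in finite_subsets_at_top UNIV. dist (\<integral>\<omega>. f \<omega> \<partial>rc_measure_on S p q) (\<integral>\<omega>. f \<omega> \<partial>M) < \<epsilon>"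
    proof eventually_elim
      case (elim S)
      let ?ex = "fk_ex q p (induced_edges S)"
      note fin = finite_induced_edges[OF elim(2)]
      have "\<bar>?ex (\<lambda>F. f (\<lambda>e. e \<in> F)) - ?ex (\<lambda>F. g (\<lambda>e. e \<in> F))\<bar> \<le> \<epsilon> / 3"
      proof -
        have "f (\<lambda>e. e \<in> F) - g (\<lambda>e. e \<in> F) \<le> \<epsilon> / 3" "- (\<epsilon> / 3) \<le> f (\<lambda>e. e \<in> F) - g (\<lambda>e. e \<in> F)" for F
          using fg[of "\<lambda>e. e \<in> F"] by linarith+
        then have "?ex (\<lambda>F. f (\<lambda>e. e \<in> F) - g (\<lambda>e. e \<in> F)) \<le> ?ex (\<lambda>F. \<epsilon> / 3)"
          "?ex (\<lambda>F. - (\<epsilon> / 3)) \<le> ?ex (\<lambda>F. f (\<lambda>e. e \<in> F) - g (\<lambda>e. e \<in> F))"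
          using p q by (auto intro!: fk_ex_mono fin)
        then show ?thesis
          using fin p q unfolding fk_ex_diff by (simp add: fk_ex_const abs_le_iff del: le_divide_eq_numeral1 divide_le_eq_numeral1)
      qed
      then show ?case
        using elim fg_M integral_rc_measure[OF elim(2) p, of q f] q
        unfolding dist_real_def by linarith
    qed
  qed
  then show ?thesis
    using M unfolding is_rc_limit_def by (intro exI[of _ M]) simp
qed

text \<open>
  Indicators of events that depend on finitely many edges are continuous, so weak convergence applies to
  them.
\<close>

lemma rc_limit_cylinder:
  fixes M :: "('n::finite) config measure"
  assumes M: "is_rc_limit p q M" and p: "0 \<le> p" "p \<le> 1" and q: "1 \<le> q"
    and J: "finite J" and Y: "\<And>\<omega> \<omega>'. (\<forall>e\<in>J. \<omega> e = \<omega>' e) \<Longrightarrow> Y \<omega> \<longleftrightarrow> Y \<omega>'"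
  shows "((\<lambda>S. fk_prob q p (induced_edges S) (\<lambda>F. Y (\<lambda>e. e \<in> F))) \<longlongrightarrow> measure M {\<omega>. Y \<omega>})
    (finite_subsets_at_top UNIV)"
proof -
  interpret prob_space M
    using M by (simp add: is_rc_limit_def)
  have sets: "sets M = sets bool_product"
    using M by (simp add: is_rc_limit_def)
  have space: "space M = UNIV"
    using sets_eq_imp_space_eq[OF sets] by simp
  have conv: "((\<lambda>S. \<integral>\<omega>. f \<omega> \<partial>rc_measure_on S p q) \<longlongrightarrow> (\<integral>\<omega>. f \<omega> \<partial>M)) (finite_subsets_at_top UNIV)"
    if "continuous_on UNIV f" "bounded (range f)" for f :: "'n config \<Rightarrow> real"
    using M that by (simp add: is_rc_limit_def)
  have "continuous_on UNIV (\<lambda>\<omega>. of_bool (Y \<omega>) :: real)"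
    by (rule continuous_on_cylinder[OF J]) (use Y in auto)
  moreover have "bounded (range (\<lambda>\<omega>. of_bool (Y \<omega>) :: real))"
    by (rule finite_imp_bounded, rule finite_subset[of _ "{0, 1}"]) auto
  ultimately have "((\<lambda>S. \<integral>\<omega>. (of_bool (Y \<omega>) :: real) \<partial>rc_measure_on S p q) \<longlongrightarrow> (\<integral>\<omega>. (of_bool (Y \<omega>) :: real) \<partial>M))
      (finite_subsets_at_top UNIV)"
    by (rule conv)
  moreover have "(\<integral>\<omega>. (of_bool (Y \<omega>) :: real) \<partial>M) = measure M {\<omega>. Y \<omega>}"
  proof -
    have "{\<omega>. Y \<omega>} \<in> sets M"
      unfolding sets by (rule sets_cylinder[OF J]) (use Y in blast)
    moreover have "(\<lambda>\<omega>. of_bool (Y \<omega>) :: real) = indicator {\<omega>. Y \<omega>}"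
      by (auto simp: indicator_def)
    ultimately show ?thesis
      by (simp add: space)
  qed
  moreover have "\<forall>\<^sub>F S in finite_subsets_at_top UNIV. (\<integral>\<omega>. (of_bool (Y \<omega>) :: real) \<partial>rc_measure_on S p q)
      = fk_prob q p (induced_edges S) (\<lambda>F. Y (\<lambda>e. e \<in> F))"
    using p q by (intro eventually_finite_subsets_at_top_weakI integral_rc_measure) auto
  ultimately show ?thesis
    by (auto intro: Lim_transform_eventually)
qed

text \<open>
  Weak limits agree on events that depend on finitely many edges, and these determine the measure.
\<close>

lemma rc_limit_unique:
  fixes M M' :: "('n::finite) config measure"
  assumes M: "is_rc_limit p q M" and M': "is_rc_limit p q M'"
    and p: "0 \<le> p" "p \<le> 1" and q: "1 \<le> q"
  shows "M = M'"
proof (rule measure_eqI_PiM_infinite)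
  show "sets M = sets bool_product" "sets M' = sets bool_product"
    using M M' by (simp_all add: is_rc_limit_def)
  have prob: "prob_space M" "prob_space M'"
    using M M' by (simp_all add: is_rc_limit_def)
  then show "finite_measure M"
    by (simp add: prob_space_def)
  fix A :: "'n edge \<Rightarrow> bool set" and J :: "'n edge set" assume J: "finite J"
  have "measure M {\<omega>. \<forall>e\<in>J. \<omega> e \<in> A e} = measure M' {\<omega>. \<forall>e\<in>J. \<omega> e \<in> A e}"
    by (rule tendsto_unique[OF finite_subsets_at_top_neq_bot
          rc_limit_cylinder[OF M p q J] rc_limit_cylinder[OF M' p q J]]) auto
  moreover have "prod_emb UNIV (\<lambda>_. count_space UNIV) J (Pi\<^sub>E J A) = {\<omega>. \<forall>e\<in>J. \<omega> e \<in> A e}"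
    by (auto simp: prod_emb_def)
  ultimately show "emeasure M (prod_emb UNIV (\<lambda>_. count_space UNIV) J (Pi\<^sub>E J A))
      = emeasure M' (prod_emb UNIV (\<lambda>_. count_space UNIV) J (Pi\<^sub>E J A))"
    using prob by (simp add: finite_measure.emeasure_eq_measure prob_space_def)
qed

theorem is_rc_limit_rc_lattice:
  assumes "0 \<le> p" "p \<le> 1" "1 \<le> q"
  shows "is_rc_limit p q (rc_lattice p q :: ('n::finite) config measure)"
proof -
  obtain M :: "'n config measure" where M: "is_rc_limit p q M"
    using ex_rc_limit[OF assms] by blast
  then show ?thesis
    unfolding rc_lattice_def using rc_limit_unique[OF _ M assms] by (rule theI)
qed

section \<open>Comparison of norms\<close>

lemma real_l1: "real (l1 x) = (\<Sum>i\<in>UNIV. \<bar>real_vec x $ i\<bar>)"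
proof -
  have "real (l1 x) = real_of_int (int (l1 x))"
    by simp
  also have "\<dots> = (\<Sum>i\<in>UNIV. \<bar>real_vec x $ i\<bar>)"
    unfolding int_l1 by (simp add: real_vec_def)
  finally show ?thesis .
qed

text \<open>
  With the next lemma, this replaces the given norm by the \<open>\<ell>\<^sup>1\<close> norm, in which distances in the lattice
  graph are measured.
\<close>

lemma is_norm_le_coordinates:
  assumes N: "is_norm N"
  obtains C where "0 < C" "\<And>v :: real ^ ('n::finite). N v \<le> C * (\<Sum>i\<in>UNIV. \<bar>v $ i\<bar>)"
proof -
  have zero: "N 0 = 0" and tri: "N (x + y) \<le> N x + N y" and scale: "N (a *\<^sub>R x) = \<bar>a\<bar> * N x"
    and nonneg: "0 \<le> N x" for x y a
    using N by (auto simp: is_norm_def)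
  define C where "C = (\<Sum>i\<in>UNIV. N (axis i 1 :: real ^ 'n)) + 1"
  have sum: "N (\<Sum>i\<in>I. f i) \<le> (\<Sum>i\<in>I. N (f i))" if "finite I" for I and f :: "'n \<Rightarrow> real ^ 'n"
    using that
  proof (induction I rule: finite_induct)
    case (insert i I)
    then show ?case
      using tri[of "f i" "\<Sum>i\<in>I. f i"] by simp
  qed (simp add: zero)
  have "N v \<le> C * (\<Sum>i\<in>UNIV. \<bar>v $ i\<bar>)" for v :: "real ^ 'n"
  proof -
    have "v = (\<Sum>i\<in>UNIV. v $ i *\<^sub>R axis i 1)"
      by (simp add: vec_eq_iff axis_def if_distrib cong: if_cong)
    then have "N v \<le> (\<Sum>i\<in>UNIV. N (v $ i *\<^sub>R axis i 1))"
      using sum[of UNIV "\<lambda>i. v $ i *\<^sub>R axis i 1"] by simp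
    also have "\<dots> \<le> (\<Sum>i\<in>UNIV. C * \<bar>v $ i\<bar>)"
    proof (intro sum_mono)
      fix i :: 'n
      have "N (axis i 1) \<le> (\<Sum>i\<in>UNIV. N (axis i 1 :: real ^ 'n))"
        by (rule member_le_sum) (auto simp: nonneg)
      then have "N (axis i 1) \<le> C"
        by (simp add: C_def)
      then show "N (v $ i *\<^sub>R axis i 1) \<le> C * \<bar>v $ i\<bar>"
        unfolding scale by (subst mult.commute) (intro mult_right_mono, auto)
    qed
    finally show ?thesis
      by (simp add: sum_distrib_left)
  qed
  moreover have "0 < C"
    unfolding C_def using nonneg by (simp add: sum_nonneg add_nonneg_pos)
  ultimately show ?thesis
    using that by blast
qed

text \<open>
  Being Lipschitz, \<open>N\<close> attains its minimum on the Euclidean unit sphere, and this minimum is positive. So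
  balls of \<open>N\<close> are bounded.
\<close>

lemma finite_norm_less:
  assumes N: "is_norm N"
  shows "finite {x :: int ^ ('n::finite). N (real_vec x) < r}"
proof -
  have tri: "N (x + y) \<le> N x + N y" and scale: "N (a *\<^sub>R x) = \<bar>a\<bar> * N x" and nonneg: "0 \<le> N x"
    and zero: "N x = 0 \<longleftrightarrow> x = 0" for x y a
    using N by (auto simp: is_norm_def)
  obtain C where C: "0 < C" "\<And>v :: real ^ 'n. N v \<le> C * (\<Sum>i\<in>UNIV. \<bar>v $ i\<bar>)"
    using is_norm_le_coordinates[OF N] by blast
  define D where "D = C * real CARD('n)"
  have coord: "(\<Sum>i\<in>UNIV. \<bar>v $ i\<bar>) \<le> real CARD('n) * norm v" for v :: "real ^ 'n"
    by (rule sum_bounded_above[THEN order_trans]) (auto intro: component_le_norm_cart)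
  have le_norm: "N v \<le> D * norm v" for v
    using order_trans[OF C(2)[of v] mult_left_mono[OF coord[of v], of C]] C(1)
    by (simp add: D_def mult.assoc)
  have lip: "\<bar>N x - N y\<bar> \<le> D * norm (x - y)" for x y
  proof -
    have "N x \<le> N y + D * norm (x - y)"
      using tri[of y "x - y"] le_norm[of "x - y"] by simp
    moreover have "N y \<le> N x + D * norm (x - y)"
      using tri[of x "y - x"] le_norm[of "y - x"] by (simp add: norm_minus_commute)
    ultimately show ?thesis
      by linarith
  qed
  have "D-lipschitz_on UNIV N"
    using lip C(1) by (intro lipschitz_onI) (auto simp: dist_real_def dist_norm D_def)
  then have cont: "continuous_on (sphere 0 1) N"
    using lipschitz_on_continuous_on continuous_on_subset by blast
  have "(axis undefined 1 :: real ^ 'n) \<in> sphere 0 1"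
    by (simp add: norm_axis_1)
  then obtain u :: "real ^ 'n" where u: "u \<in> sphere 0 1" "\<And>v. v \<in> sphere 0 1 \<Longrightarrow> N u \<le> N v"
    using continuous_attains_inf[OF compact_sphere _ cont] by blast
  have c: "0 < N u"
    using u(1) nonneg[of u] zero[of u] by (cases "u = 0") auto
  have ge: "N u * norm v \<le> N v" for v
  proof (cases "v = 0")
    case False
    then have "N u \<le> N ((1 / norm v) *\<^sub>R v)"
      by (intro u) auto
    also have "\<dots> = N v / norm v"
      unfolding scale by simp
    finally show ?thesis
      using False by (simp add: pos_le_divide_eq)
  qed (use nonneg in auto)
  have "{x :: int ^ 'n. N (real_vec x) < r} \<subseteq> {x. l1 x \<le> nat \<lfloor>real CARD('n) * (r / N u)\<rfloor>}"
  proof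
    fix x :: "int ^ 'n" assume "x \<in> {x. N (real_vec x) < r}"
    then have "norm (real_vec x) \<le> r / N u"
      using ge[of "real_vec x"] c by (simp add: pos_le_divide_eq mult.commute)
    then have "real (l1 x) \<le> real CARD('n) * (r / N u)"
      using coord[of "real_vec x"] unfolding real_l1 by (meson mult_left_mono of_nat_0_le_iff order_trans)
    then show "x \<in> {x. l1 x \<le> nat \<lfloor>real CARD('n) * (r / N u)\<rfloor>}"
      by (simp add: le_nat_floor)
  qed
  then show ?thesis
    using l1_ball_finite finite_subset by blast
qed

section \<open>Connections in the infinite volume\<close>

lemma UNIV_edges_exhaustion:
  "incseq (\<lambda>m. induced_edges {x. l1 x \<le> m} :: ('n::finite) edge set)"
  "(\<Union>m. induced_edges {x. l1 x \<le> m}) = (UNIV :: ('n::finite) edge set)"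
proof -
  show "incseq (\<lambda>m. induced_edges {x. l1 x \<le> m} :: 'n edge set)"
    by (intro monoI induced_edges_mono) auto
  have "\<exists>m. e \<in> induced_edges {x. l1 x \<le> m}" for e :: "'n edge"
    using finite_l1_bounded[OF finite_ends[of e]] by (auto simp: induced_edges_def)
  then show "(\<Union>m. induced_edges {x. l1 x \<le> m}) = (UNIV :: 'n edge set)"
    by auto
qed

text \<open>
  A path is finite and therefore contained in a ball.
\<close>

lemma connects_finite_volume:
  "connects \<omega> x y \<longleftrightarrow> (\<exists>m. joined {e \<in> induced_edges {x. l1 x \<le> m}. \<omega> e} x y)"
proof
  assume "connects \<omega> x y"
  then show "\<exists>m. joined {e \<in> induced_edges {x. l1 x \<le> m}. \<omega> e} x y"
    unfolding connects_def
  proof (induction rule: rtranclp_induct)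
    case base
    then show ?case by simp
  next
    case (step y z)
    then obtain m where m: "joined {e \<in> induced_edges {x. l1 x \<le> m}. \<omega> e} x y"
      by blast
    obtain e where e: "ends e = {y, z}" "\<omega> e"
      using step by (auto simp: open_adj_def)
    obtain m' where m': "e \<in> induced_edges {x. l1 x \<le> m'}"
      using UNIV_edges_exhaustion(2) by blast
    have sub: "induced_edges {x. l1 x \<le> m} \<subseteq> induced_edges {x. l1 x \<le> max m m'}"
      "induced_edges {x. l1 x \<le> m'} \<subseteq> induced_edges {x. l1 x \<le> max m m'}"
      by (intro induced_edges_mono; auto)+
    have "joined {e \<in> induced_edges {x. l1 x \<le> max m m'}. \<omega> e} x y"
      using m by (rule joined_mono) (use sub in auto)
    then have "joined {e \<in> induced_edges {x. l1 x \<le> max m m'}. \<omega> e} x z"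
      by (rule joined_step[OF _ _ e(1)]) (use sub m' e in auto)
    then show ?case by blast
  qed
next
  assume "\<exists>m. joined {e \<in> induced_edges {x. l1 x \<le> m}. \<omega> e} x y"
  then show "connects \<omega> x y"
    unfolding joined_def by (auto intro: connects_mono)
qed

lemma sets_connects:
  "{\<omega>. connects \<omega> x y} \<in> sets (bool_product :: ('n::finite) config measure)"
proof -
  have "{\<omega> :: 'n config. connects \<omega> x y}
      = (\<Union>m. {\<omega>. joined {e \<in> induced_edges {x. l1 x \<le> m}. \<omega> e} x y})"
    using connects_finite_volume by auto
  also have "\<dots> \<in> sets bool_product"
  proof (intro sets.countable_UN image_subsetI)
    fix m
    show "{\<omega>. joined {e \<in> induced_edges {x. l1 x \<le> m}. \<omega> e} x y} \<in> sets (bool_product :: 'n config measure)"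
    proof (rule sets_cylinder[OF finite_induced_edges[OF l1_ball_finite[of m]]])
      fix \<omega> \<omega>' :: "'n config"
      assume "\<forall>e\<in>induced_edges {x. l1 x \<le> m}. \<omega> e = \<omega>' e"
      then have "{e \<in> induced_edges {x. l1 x \<le> m}. \<omega> e} = {e \<in> induced_edges {x. l1 x \<le> m}. \<omega>' e}"
        by auto
      then show "joined {e \<in> induced_edges {x. l1 x \<le> m}. \<omega> e} x y \<Longrightarrow>
          joined {e \<in> induced_edges {x. l1 x \<le> m}. \<omega>' e} x y"
        by simp
    qed
  qed
  finally show ?thesis .
qed

text \<open>
  Connections inside a ball depend on finitely many edges and are at most as likely as connections in a
  large volume; letting the ball grow exhausts all connections.
\<close>

lemma rc_limit_connects_le:
  fixes M :: "('n::finite) config measure"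
  assumes M: "is_rc_limit p q M" and p: "0 \<le> p" "p \<le> 1" and q: "1 \<le> q"
    and bound: "\<And>E. finite E \<Longrightarrow> fk_prob q p E (\<lambda>F. joined F x y) \<le> B"
  shows "measure M {\<omega>. connects \<omega> x y} \<le> B"
proof -
  interpret prob_space M
    using M by (simp add: is_rc_limit_def)
  have sets: "sets M = sets bool_product"
    using M by (simp add: is_rc_limit_def)
  define G where "G = (\<lambda>m. induced_edges {x. l1 x \<le> m} :: 'n edge set)"
  define A where "A = (\<lambda>m. {\<omega> :: 'n config. joined {e \<in> G m. \<omega> e} x y})"
  have G: "finite (G m)" for m
    by (simp add: G_def finite_induced_edges l1_ball_finite)
  have local: "joined {e \<in> G m. \<omega> e} x y \<longleftrightarrow> joined {e \<in> G m. \<omega>' e} x y"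
    if "\<forall>e\<in>G m. \<omega> e = \<omega>' e" for m \<omega> \<omega>'
  proof -
    have "{e \<in> G m. \<omega> e} = {e \<in> G m. \<omega>' e}"
      using that by auto
    then show ?thesis by simp
  qed
  have A_sets: "A m \<in> sets M" for m
    unfolding A_def sets by (rule sets_cylinder[OF G[of m]]) (use local in blast)
  have bound_A: "measure M (A m) \<le> B" for m
  proof -
    have "((\<lambda>S. fk_prob q p (induced_edges S) (\<lambda>F. joined {e \<in> G m. e \<in> F} x y)) \<longlongrightarrow> measure M (A m))
        (finite_subsets_at_top UNIV)"
      unfolding A_def using rc_limit_cylinder[OF M p q G, of m "\<lambda>\<omega>. joined {e \<in> G m. \<omega> e} x y"] local
      by blast
    then show ?thesis
    proof (rule tendsto_upperbound)
      show "\<forall>\<^sub>F S in finite_subsets_at_top UNIV. fk_prob q p (induced_edges S) (\<lambda>F. joined {e \<in> G m. e \<in> F} x y) \<le> B"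
      proof (rule eventually_finite_subsets_at_top_weakI)
        fix S :: "(int ^ 'n) set" assume "finite S"
        then have "fk_prob q p (induced_edges S) (\<lambda>F. joined {e \<in> G m. e \<in> F} x y)
            \<le> fk_prob q p (induced_edges S) (\<lambda>F. joined F x y)"
          using p q by (intro fk_prob_mono finite_induced_edges) (auto elim: joined_mono)
        also have "\<dots> \<le> B"
          using \<open>finite S\<close> by (intro bound finite_induced_edges)
        finally show "fk_prob q p (induced_edges S) (\<lambda>F. joined {e \<in> G m. e \<in> F} x y) \<le> B" .
      qed
    qed simp
  qed
  have lim: "(\<lambda>m. measure M (A m)) \<longlonglongrightarrow> measure M (\<Union>m. A m)"
  proof (rule finite_Lim_measure_incseq)
    show "range A \<subseteq> sets M"
      using A_sets by auto
    show "incseq A"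
    proof (rule monoI)
      fix m n :: nat assume "m \<le> n"
      then have "G m \<subseteq> G n"
        using UNIV_edges_exhaustion(1) unfolding G_def incseq_def by blast
      then show "A m \<subseteq> A n"
        unfolding A_def by (auto elim: joined_mono)
    qed
  qed
  have "(\<Union>m. A m) = {\<omega>. connects \<omega> x y}"
    unfolding A_def G_def using connects_finite_volume by auto
  then show ?thesis
    using LIMSEQ_le_const2[OF lim, of B] bound_A by auto
qed

text \<open>
  Exiting \<open>D\<close> inside its neighbourhood is increasing and depends on finitely many edges, so its
  probability in the limit is at least that in the volume \<open>neighbourhood D\<close> itself.
\<close>

lemma rc_limit_exits_ge:
  fixes M :: "('n::finite) config measure"
  assumes M: "is_rc_limit p q M" and p: "0 \<le> p" "p \<le> 1" and q: "1 \<le> q"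
    and D: "finite D"
    and Y: "{\<omega>. Y \<omega>} \<in> sets M" "\<And>\<omega> y. y \<in> neighbourhood D - D \<Longrightarrow> connects \<omega> x y \<Longrightarrow> Y \<omega>"
  shows "fk_prob q p (induced_edges (neighbourhood D)) (exits D x) \<le> measure M {\<omega>. Y \<omega>}"
proof -
  interpret prob_space M
    using M by (simp add: is_rc_limit_def)
  have sets: "sets M = sets bool_product"
    using M by (simp add: is_rc_limit_def)
  define G where "G = (induced_edges (neighbourhood D) :: 'n edge set)"
  define X where "X = (\<lambda>\<omega> :: 'n config. exits D x {e \<in> G. \<omega> e})"
  have G: "finite G"
    unfolding G_def using D by (intro finite_induced_edges finite_neighbourhood)
  have local: "X \<omega> \<longleftrightarrow> X \<omega>'" if "\<forall>e\<in>G. \<omega> e = \<omega>' e" for \<omega> \<omega>'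
  proof -
    have "{e \<in> G. \<omega> e} = {e \<in> G. \<omega>' e}"
      using that by auto
    then show ?thesis by (simp add: X_def)
  qed
  have "((\<lambda>S. fk_prob q p (induced_edges S) (\<lambda>F. X (\<lambda>e. e \<in> F))) \<longlongrightarrow> measure M {\<omega>. X \<omega>})
      (finite_subsets_at_top UNIV)"
    by (rule rc_limit_cylinder[OF M p q G]) (rule local)
  then have "fk_prob q p G (exits D x) \<le> measure M {\<omega>. X \<omega>}"
  proof (rule tendsto_lowerbound)
    show "\<forall>\<^sub>F S in finite_subsets_at_top UNIV. fk_prob q p G (exits D x)
        \<le> fk_prob q p (induced_edges S) (\<lambda>F. X (\<lambda>e. e \<in> F))"
      unfolding eventually_finite_subsets_at_top
    proof (intro exI[of _ "neighbourhood D"] conjI allI impI)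
      fix T assume T: "finite T \<and> neighbourhood D \<subseteq> T \<and> T \<subseteq> UNIV"
      have "mono (\<lambda>F. exits D x (G \<inter> F))"
      proof (rule monoI)
        fix F F' :: "'n edge set" assume "F \<le> F'"
        then show "exits D x (G \<inter> F) \<le> exits D x (G \<inter> F')"
          by (intro monoD[OF mono_exits]) auto
      qed
      then have "fk_prob q p G (\<lambda>F. exits D x (G \<inter> F)) \<le> fk_prob q p (induced_edges T) (\<lambda>F. exits D x (G \<inter> F))"
        using T p q unfolding G_def
        by (intro fk_prob_increasing finite_induced_edges induced_edges_mono) auto
      moreover have "fk_prob q p G (\<lambda>F. exits D x (G \<inter> F)) = fk_prob q p G (exits D x)"
        by (intro fk_ex_cong) (simp add: Int_absorb1)
      ultimately show "fk_prob q p G (exits D x) \<le> fk_prob q p (induced_edges T) (\<lambda>F. X (\<lambda>e. e \<in> F))"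
        by (simp add: X_def Int_def)
    qed (use D finite_neighbourhood in auto)
  qed (rule finite_subsets_at_top_neq_bot)
  also have "\<dots> \<le> measure M {\<omega>. Y \<omega>}"
  proof (rule finite_measure_mono[OF _ Y(1)], clarify)
    fix \<omega> assume "X \<omega>"
    then obtain y where "y \<in> neighbourhood D - D" "joined {e \<in> G. \<omega> e} x y"
      by (auto simp: X_def exits_def)
    then show "Y \<omega>"
      using Y(2)[of y \<omega>] connects_mono[of "\<lambda>e. e \<in> {e \<in> G. \<omega> e}" x y \<omega>] unfolding joined_def by blast
  qed
  finally show ?thesis
    unfolding G_def .
qed

section \<open>Sharpness of the phase transition\<close>

text \<open>
  If \<open>D\<close> contains all vertices of norm less than \<open>n\<close>, then exiting \<open>D\<close> leads to a vertex of norm at least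
  \<open>n\<close>. The bound does not depend on \<open>n\<close>, and the events decrease to \<open>connects_infinity N\<close>.
\<close>

lemma connects_infinity_ge:
  fixes N :: "real ^ ('n::finite) \<Rightarrow> real"
  assumes N: "is_norm N" and p: "pc_tilde TYPE('n) 2 < p" "p \<le> 1"
  shows "(p - pc_tilde TYPE('n) 2) / p \<le> \<P>(\<omega> in rc_lattice p 2. connects_infinity N \<omega>)"
proof -
  let ?M = "rc_lattice p 2 :: 'n config measure"
  let ?b = "(p - pc_tilde TYPE('n) 2) / p"
  have p0: "0 \<le> p"
    using p pc_tilde_nonneg[where 'n = 'n, of 2] by simp
  have M: "is_rc_limit p 2 ?M"
    using p p0 by (intro is_rc_limit_rc_lattice) auto
  interpret prob_space ?M
    using M by (simp add: is_rc_limit_def)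
  have sets: "sets ?M = sets bool_product"
    using M by (simp add: is_rc_limit_def)
  have space: "space ?M = UNIV"
    using sets_eq_imp_space_eq[OF sets] by simp
  define A where "A = (\<lambda>n :: nat. {\<omega> :: 'n config. \<exists>x. N (real_vec x) \<ge> real n \<and> connects \<omega> 0 x})"
  have countable: "countable (UNIV :: (int ^ 'n) set)"
  proof -
    have "(UNIV :: (int ^ 'n) set) = (\<Union>m. {x. l1 x \<le> m})"
      by auto
    then show ?thesis
      by (metis countable_UN countable_finite l1_ball_finite countableI_type)
  qed
  have A_sets: "A n \<in> sets ?M" for n
  proof -
    have "A n = (\<Union>x\<in>{x. N (real_vec x) \<ge> real n}. {\<omega>. connects \<omega> 0 x})"
      by (auto simp: A_def)
    also have "\<dots> \<in> sets ?M"
      unfolding sets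
      by (intro sets.countable_UN' image_subsetI sets_connects countable_subset[OF subset_UNIV countable])
    finally show ?thesis .
  qed
  have bound: "?b \<le> measure ?M (A n)" for n
  proof -
    \<comment> \<open>For \<open>n = 0\<close> the origin has to be added by hand.\<close>
    define D where "D = insert 0 {x :: int ^ 'n. N (real_vec x) < real n}"
    have D: "finite D" "0 \<in> D"
      unfolding D_def using finite_norm_less[OF N] by auto
    have "?b \<le> fk_prob 2 p (induced_edges (neighbourhood D)) (exits D 0)"
      using exit_probability_ge_pc_tilde[OF D p] .
    also have "\<dots> \<le> measure ?M (A n)"
      unfolding A_def
    proof (rule rc_limit_exits_ge[OF M p0 p(2) _ D(1)])
      show "{\<omega>. \<exists>x. real n \<le> N (real_vec x) \<and> connects \<omega> 0 x} \<in> sets ?M"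
        using A_sets[of n] by (simp add: A_def)
    qed (auto simp: D_def not_less)
    finally show ?thesis .
  qed
  have lim: "(\<lambda>n. measure ?M (A n)) \<longlonglongrightarrow> measure ?M (\<Inter>n. A n)"
  proof (rule finite_Lim_measure_decseq)
    show "range A \<subseteq> sets ?M"
      using A_sets by auto
    show "decseq A"
    proof (rule antimonoI)
      fix m n :: nat assume "m \<le> n"
      then have "real m \<le> N v" if "real n \<le> N v" for v
        using that by (meson of_nat_le_iff order_trans)
      then show "A n \<subseteq> A m"
        unfolding A_def by blast
    qed
  qed
  have "(\<Inter>n. A n) = {\<omega> \<in> space ?M. connects_infinity N \<omega>}"
    by (auto simp: A_def connects_infinity_def space)
  then show ?thesis
    using LIMSEQ_le_const[OF lim, of ?b] bound by auto
qed

lemma connects_exponential_decay: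
  fixes N :: "real ^ ('n::finite) \<Rightarrow> real"
  assumes N: "is_norm N" and p: "0 \<le> p" "p < pc_tilde TYPE('n) 2" "p \<le> 1"
  obtains c where "0 < c"
    "\<And>x :: int ^ 'n. \<P>(\<omega> in rc_lattice p 2. connects \<omega> 0 x) \<le> exp (- c * N (real_vec x))"
proof -
  let ?M = "rc_lattice p 2 :: 'n config measure"
  have M: "is_rc_limit p 2 ?M"
    using p by (intro is_rc_limit_rc_lattice) auto
  have "sets ?M = sets bool_product"
    using M by (simp add: is_rc_limit_def)
  from sets_eq_imp_space_eq[OF this] have space: "space ?M = UNIV"
    by simp
  obtain c where c: "0 < c"
    and decay: "\<And>(E :: 'n edge set) x. finite E \<Longrightarrow> two_point p E 0 x \<le> exp (- c * real (l1 x))"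
    using exponential_decay_below_pc_tilde[OF p(1,2)] by blast
  obtain C where C: "0 < C" "\<And>v :: real ^ 'n. N v \<le> C * (\<Sum>i\<in>UNIV. \<bar>v $ i\<bar>)"
    using is_norm_le_coordinates[OF N] by blast
  show ?thesis
  proof
    show "0 < c / C"
      using c C by simp
    fix x :: "int ^ 'n"
    have "\<P>(\<omega> in ?M. connects \<omega> 0 x) \<le> exp (- c * real (l1 x))"
      unfolding space using decay[of _ x] p
      by (simp, intro rc_limit_connects_le[OF M]) (auto simp: two_point_def)
    also have "\<dots> \<le> exp (- (c / C) * N (real_vec x))"
      using C(2)[of "real_vec x"] c C(1) by (simp add: real_l1[symmetric] field_simps)
    finally show "\<P>(\<omega> in ?M. connects \<omega> 0 x) \<le> exp (- (c / C) * N (real_vec x))" .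
  qed
qed

theorem theorem1:
  fixes N :: "real ^ ('n::finite) \<Rightarrow> real"
  assumes "is_norm N"
  shows "(\<forall>p\<in>{0..1}. p > pc_tilde TYPE('n) 2 \<longrightarrow>
            \<P>(\<omega> in rc_lattice p 2. connects_infinity N \<omega>) \<ge> (p - pc_tilde TYPE('n) 2) / p) \<and>
         (\<forall>p\<in>{0..1}. p < pc_tilde TYPE('n) 2 \<longrightarrow>
            (\<exists>c>0. \<forall>x :: int ^ 'n.
               \<P>(\<omega> in rc_lattice p 2. connects \<omega> 0 x) \<le> exp (- c * N (real_vec x))))"
proof (intro conjI ballI impI)
  fix p :: real assume "p \<in> {0..1}" "pc_tilde TYPE('n) 2 < p"
  then show "\<P>(\<omega> in rc_lattice p 2. connects_infinity N \<omega>) \<ge> (p - pc_tilde TYPE('n) 2) / p"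
    using connects_infinity_ge[OF assms] by simp
next
  fix p :: real assume p: "p \<in> {0..1}" "p < pc_tilde TYPE('n) 2"
  show "\<exists>c>0. \<forall>x :: int ^ 'n.
      \<P>(\<omega> in rc_lattice p 2. connects \<omega> 0 x) \<le> exp (- c * N (real_vec x))"
    by (rule connects_exponential_decay[OF assms, of p]) (use p in auto)
qed

end
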